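(* Let $(G,\sigma)$ be a flow-admissible signed graph whose underlying graph $G$ is cubic and $3$-edge colorable. Then $(G,\sigma)$ has a sign-circuit cover $\mathcal{F}$ with length $\ell(\mathcal{F}) \le \frac{20}{9}|E(G)|$.
   Context: Graphs are finite and may have parallel edges and loops. A circuit is a connected $2$-regular graph (a loop is a circuit with one edge, a pair of parallel edges is a circuit with two edges). A signed graph $(G,\sigma)$ is a graph $G$ together with a mapping $\sigma:E(G)\to\{+1,-1\}$; an edge $e$ is positive if $\sigma(e)=+1$ and negative if $\sigma(e)=-1$. A circuit in a signed graph is balanced if it contains an even number of negative edges, and unbalanced otherwise. A barbell is a signed graph consisting of two unbalanced circuits joined by a (possibly trivial) path which intersects the circuits only at its ends: if the path is trivial (short barbell) the two circuits share exactly one vertex; otherwise (long barbell) the two circuits are vertex-disjoint, and the path meets each of them in exactly one of its end-vertices. A sign-circuit of a signed graph is a subgraph that is a balanced circuit or a barbell. A sign-circuit cover of $(G,\sigma)$ is a family $\mathcal{F}$ of sign-circuits of $(G,\sigma)$ such that every edge of $G$ lies in at least one member of $\mathcal{F}$; its length is $\ell(\mathcal{F})=\sum_{C\in\mathcal{F}}|E(C)|$. A signed graph is flow-admissible if it admits a nowhere-zero integer flow; equivalently, every edge lies in a sign-circuit. A graph is $3$-edge colorable if its edges can be properly colored with $3$ colors (adjacent edges receive different colors). *)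

theory Defs
  imports
    Complex_Main
    "HOL-Library.Multiset"
    "Graph_Theory.Digraph_Component"
begin

text \<open>
  A finite undirected graph, possibly with loops and parallel edges, is represented by a finite
  multidigraph (\<^locale>\<open>fin_digraph\<close>). The arcs are the edges; tail and head merely name the
  two ends of an edge, and no notion below depends on which end is the tail. In particular the
  library notion of connectedness used here is the undirected one.
\<close>

text \<open>
  An edge e has the two half-edges (e, False) and (e, True), attached to its tail and to its head.
  A loop thus contributes two half-edges at its vertex.
\<close>

definition half_edges :: "('v, 'e) pre_digraph \<Rightarrow> 'v \<Rightarrow> ('e \<times> bool) set" where
  "half_edges G v = {(e, b). e \<in> arcs G \<and> (if b then head G e else tail G e) = v}"

definition degree :: "('v, 'e) pre_digraph \<Rightarrow> 'v \<Rightarrow> nat" where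
  "degree G v = card (half_edges G v)"

definition regular :: "nat \<Rightarrow> ('v, 'e) pre_digraph \<Rightarrow> bool" where
  "regular d G \<longleftrightarrow> (\<forall>v \<in> verts G. degree G v = d)"

abbreviation cubic :: "('v, 'e) pre_digraph \<Rightarrow> bool" where
  "cubic \<equiv> regular 3"

text \<open>
  Two edges are adjacent when they have half-edges at a common vertex. A loop is therefore adjacent
  to itself, so that, as usual, a graph with a loop has no proper edge coloring.
\<close>

definition proper_edge_coloring :: "('v, 'e) pre_digraph \<Rightarrow> ('e \<Rightarrow> nat) \<Rightarrow> bool" where
  "proper_edge_coloring G c \<longleftrightarrow>
     (\<forall>v \<in> verts G. \<forall>h \<in> half_edges G v. \<forall>h' \<in> half_edges G v.
        h \<noteq> h' \<longrightarrow> c (fst h) \<noteq> c (fst h'))"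

definition edge_colorable :: "nat \<Rightarrow> ('v, 'e) pre_digraph \<Rightarrow> bool" where
  "edge_colorable k G \<longleftrightarrow>
     (\<exists>c. (\<forall>e \<in> arcs G. c e < k) \<and> proper_edge_coloring G c)"

definition circuit :: "('v, 'e) pre_digraph \<Rightarrow> bool" where
  "circuit C \<longleftrightarrow> fin_digraph C \<and> Digraph_Component.connected C \<and> regular 2 C"

text \<open>The path may be trivial, in which case it is the single vertex u = v.\<close>

definition path_graph :: "('v, 'e) pre_digraph \<Rightarrow> 'v \<Rightarrow> 'v \<Rightarrow> bool" where
  "path_graph P u v \<longleftrightarrow>
     (\<exists>xs es. length xs = Suc (length es) \<and> distinct xs \<and> hd xs = u \<and> last xs = v \<and>
        verts P = set xs \<and> arcs P = set es \<and>
        (\<forall>i < length es. {tail P (es ! i), head P (es ! i)} = {xs ! i, xs ! Suc i}))"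

locale signed_graph = fin_digraph G
  for G :: "('v, 'e) pre_digraph" +
  fixes \<sigma> :: "'e \<Rightarrow> int"
  assumes signature: "e \<in> arcs G \<Longrightarrow> \<sigma> e \<in> {1, -1}"

text \<open>
  A bidirection orients each half-edge, towards its end-vertex (1) or away from it (-1). On a
  positive edge exactly one of the two half-edges points to its end-vertex; on a negative edge both
  do or both do not.
\<close>

definition bidirection ::
    "('v, 'e) pre_digraph \<Rightarrow> ('e \<Rightarrow> int) \<Rightarrow> ('e \<times> bool \<Rightarrow> int) \<Rightarrow> bool" where
  "bidirection G \<sigma> \<tau> \<longleftrightarrow>
     (\<forall>e \<in> arcs G. \<tau> (e, False) \<in> {1, -1} \<and> \<tau> (e, True) \<in> {1, -1} \<and>
        \<tau> (e, False) * \<tau> (e, True) = - \<sigma> e)"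

definition integer_flow ::
    "('v, 'e) pre_digraph \<Rightarrow> ('e \<Rightarrow> int) \<Rightarrow> ('e \<times> bool \<Rightarrow> int) \<Rightarrow> ('e \<Rightarrow> int) \<Rightarrow> bool" where
  "integer_flow G \<sigma> \<tau> f \<longleftrightarrow>
     bidirection G \<sigma> \<tau> \<and> (\<forall>v \<in> verts G. (\<Sum>h \<in> half_edges G v. \<tau> h * f (fst h)) = 0)"

definition flow_admissible :: "('v, 'e) pre_digraph \<Rightarrow> ('e \<Rightarrow> int) \<Rightarrow> bool" where
  "flow_admissible G \<sigma> \<longleftrightarrow>
     (\<exists>\<tau> f. integer_flow G \<sigma> \<tau> f \<and> (\<forall>e \<in> arcs G. f e \<noteq> 0))"

definition balanced_circuit :: "('v, 'e) pre_digraph \<Rightarrow> ('e \<Rightarrow> int) \<Rightarrow> bool" where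
  "balanced_circuit C \<sigma> \<longleftrightarrow> circuit C \<and> even (card {e \<in> arcs C. \<sigma> e = -1})"

definition unbalanced_circuit :: "('v, 'e) pre_digraph \<Rightarrow> ('e \<Rightarrow> int) \<Rightarrow> bool" where
  "unbalanced_circuit C \<sigma> \<longleftrightarrow> circuit C \<and> odd (card {e \<in> arcs C. \<sigma> e = -1})"

text \<open>
  The case u = v is the short barbell. The condition that the two circuits be different only
  excludes taking the same negative loop twice.
\<close>

definition barbell :: "('v, 'e) pre_digraph \<Rightarrow> ('e \<Rightarrow> int) \<Rightarrow> bool" where
  "barbell B \<sigma> \<longleftrightarrow>
     (\<exists>C\<^sub>1 C\<^sub>2 P u v.
        subgraph C\<^sub>1 B \<and> subgraph C\<^sub>2 B \<and> subgraph P B \<and>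
        verts B = verts C\<^sub>1 \<union> verts C\<^sub>2 \<union> verts P \<and>
        arcs B = arcs C\<^sub>1 \<union> arcs C\<^sub>2 \<union> arcs P \<and>
        unbalanced_circuit C\<^sub>1 \<sigma> \<and> unbalanced_circuit C\<^sub>2 \<sigma> \<and> C\<^sub>1 \<noteq> C\<^sub>2 \<and>
        path_graph P u v \<and>
        verts P \<inter> verts C\<^sub>1 = {u} \<and> verts P \<inter> verts C\<^sub>2 = {v} \<and>
        verts C\<^sub>1 \<inter> verts C\<^sub>2 = (if u = v then {u} else {}))"

definition sign_circuit ::
    "('v, 'e) pre_digraph \<Rightarrow> ('e \<Rightarrow> int) \<Rightarrow> ('v, 'e) pre_digraph \<Rightarrow> bool" where
  "sign_circuit G \<sigma> C \<longleftrightarrow> subgraph C G \<and> (balanced_circuit C \<sigma> \<or> barbell C \<sigma>)"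

text \<open>A family may contain the same sign-circuit several times, hence multisets.\<close>

definition sign_circuit_cover ::
    "('v, 'e) pre_digraph \<Rightarrow> ('e \<Rightarrow> int) \<Rightarrow> ('v, 'e) pre_digraph multiset \<Rightarrow> bool" where
  "sign_circuit_cover G \<sigma> F \<longleftrightarrow>
     (\<forall>C \<in># F. sign_circuit G \<sigma> C) \<and> (\<forall>e \<in> arcs G. \<exists>C \<in># F. e \<in> arcs C)"

definition cover_length :: "('v, 'e) pre_digraph multiset \<Rightarrow> nat" where
  "cover_length F = (\<Sum>C \<in># F. card (arcs C))"

end

theory Submission
  imports Defs
begin

text \<open>
  Let G be connected with n vertices. A 2-factor with an even number of unbalanced circuits, c circuits
  in all, can be covered with length at most 3n/2 + c - 1, by pairing up its unbalanced circuits along a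
  join that uses at most c - 1 edges between the circuits and half of the edges on each of them. If all
  three pairs of colour classes are even in this sense, the two cheapest of them cover G, and the bound
  follows, because the bicoloured circuits are the faces of a surface embedding, so that there are at
  most n/2 + 2 of them.

  Otherwise exactly one pair is even. If it has an unbalanced circuit, a Kempe switch along it makes all
  pairs even; so all its circuits are balanced, and they cost n. Let U be an unbalanced circuit of an odd
  pair. A Kempe switch along U makes the third pair even, and again one may assume that its circuits are
  then balanced. Two choices of U thus give a cover of length 3n. If there is only one U, the even pair
  and the circuits other than U have total length 2n - |U|, and it remains to cover U with length at
  most 4n/3 + |U|. This is done by a barbell, if some unbalanced circuit is disjoint from U, and by
  balanced circuits made of an ear and an arc of U otherwise: either two of the three balanced circuits
  of a subdivided complete graph on four vertices, or a minimal family of disjoint ears.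
\<close>

section \<open>Boundaries of edge sets\<close>

text \<open>Cubicity gives |E| = 3n/2, so the target 20/9 |E| is 10n/3. With all pairs even, the
  three covers cost at most 9n/2 + (n/2 + 2) - 3 < 5n together, and the two cheapest at most two
  thirds of that. Every edge lies in two pairs, so the signs of the three pairs multiply to 1 and
  odd pairs come in twos. An odd pair has an odd number of unbalanced circuits, which no join can
  pair up; this is the obstacle. Since n + (n - |U|) is already spent, U may cost exactly 4n/3 +
  |U|. Flow-admissibility enters only there: it says that no switching leaves just one negative
  edge. If U meets all unbalanced circuits, the part of G away from U can be switched positive and U
  be given a single negative edge. An ear then closes with exactly one of its two arcs of U to a
  balanced circuit, and an edge of U missed by all these circuits could be made the only negative
  edge of G. Parity is treated throughout as a product of signs or as a boundary modulo 2, so that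
  joins, faces and Kempe switches all become symmetric differences.\<close>

definition bd :: "('e \<Rightarrow> 'x) \<Rightarrow> ('e \<Rightarrow> 'x) \<Rightarrow> 'e set \<Rightarrow> 'x \<Rightarrow> bool" where
  "bd p q F x \<longleftrightarrow> odd (card {e \<in> F. (p e = x) \<noteq> (q e = x)})"

lemma odd_card_sym_diff:
  assumes "finite A" "finite B"
  shows "odd (card (sym_diff A B)) \<longleftrightarrow> odd (card A) \<noteq> odd (card B)"
proof -
  have "card (sym_diff A B) = card (A - B) + card (B - A)"
    using assms by (intro card_Un_disjoint) auto
  moreover have "card A = card (A \<inter> B) + card (A - B)" "card B = card (B \<inter> A) + card (B - A)"
    using card_Int_Diff assms by blast+
  ultimately show ?thesis by (auto simp: Int_commute)
qed

lemma card_sym_diff_le: "finite A \<Longrightarrow> finite B \<Longrightarrow> card (sym_diff A B) \<le> card A + card B"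
  using card_Un_le[of "A - B" "B - A"] card_mono[of A "A - B"] card_mono[of B "B - A"] by simp

lemma bd_sym_diff:
  assumes "finite A" "finite B"
  shows "bd p q (sym_diff A B) x \<longleftrightarrow> bd p q A x \<noteq> bd p q B x"
proof -
  let ?c = "\<lambda>F. {e \<in> F. (p e = x) \<noteq> (q e = x)}"
  have "?c (sym_diff A B) = sym_diff (?c A) (?c B)" by auto
  then show ?thesis
    unfolding bd_def using odd_card_sym_diff[of "?c A" "?c B"] assms by simp
qed

lemma bd_empty [simp]: "\<not> bd p q {} x"
  by (simp add: bd_def)

lemma bd_singleton: "bd p q {e} x \<longleftrightarrow> (p e = x) \<noteq> (q e = x)"
proof -
  have "{e' \<in> {e}. (p e' = x) \<noteq> (q e' = x)} = (if (p e = x) \<noteq> (q e = x) then {e} else {})"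
    by auto
  then show ?thesis by (simp add: bd_def)
qed

lemma bd_insert:
  assumes "finite F" "e \<notin> F"
  shows "bd p q (insert e F) x \<longleftrightarrow> bd p q F x \<noteq> ((p e = x) \<noteq> (q e = x))"
proof -
  have "insert e F = sym_diff F {e}" using assms by auto
  then show ?thesis using bd_sym_diff[of F "{e}" p q x] assms by (simp add: bd_singleton)
qed

text \<open>Handshake parity: an edge with two distinct ends in S changes the count at two vertices,
  so modulo 2 only the edges leaving S remain. Loops are invisible to \<open>bd\<close>.\<close>

lemma odd_card_bd:
  assumes "finite F" "finite S"
  shows "odd (card {v \<in> S. bd p q F v}) \<longleftrightarrow> odd (card {e \<in> F. (p e \<in> S) \<noteq> (q e \<in> S)})"
  using assms(1)
proof (induction F rule: finite_induct)
  case empty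
  then show ?case by simp
next
  case (insert e F)
  let ?D = "{v \<in> S. (p e = v) \<noteq> (q e = v)}"
  let ?E = "if (p e \<in> S) \<noteq> (q e \<in> S) then {e} else {}"
  have D: "odd (card ?D) \<longleftrightarrow> (p e \<in> S) \<noteq> (q e \<in> S)"
  proof -
    consider "p e = q e" | "p e \<noteq> q e" by blast
    then show ?thesis
    proof cases
      case 1
      then have "?D = {}" by auto
      then show ?thesis using 1 by (metis card.empty even_zero)
    next
      case 2
      then have "?D = ({p e} \<inter> S) \<union> ({q e} \<inter> S)" by auto
      then show ?thesis using 2 by (auto simp: Int_insert_left)
    qed
  qed
  have "{v \<in> S. bd p q (insert e F) v} = sym_diff {v \<in> S. bd p q F v} ?D"
    using insert by (auto simp: bd_insert)
  then have "odd (card {v \<in> S. bd p q (insert e F) v})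
      \<longleftrightarrow> odd (card {v \<in> S. bd p q F v}) \<noteq> odd (card ?D)"
    using odd_card_sym_diff[of "{v \<in> S. bd p q F v}" ?D] assms(2) by simp
  moreover have "{e' \<in> insert e F. (p e' \<in> S) \<noteq> (q e' \<in> S)}
      = sym_diff {e' \<in> F. (p e' \<in> S) \<noteq> (q e' \<in> S)} ?E"
    using insert by auto
  then have "odd (card {e' \<in> insert e F. (p e' \<in> S) \<noteq> (q e' \<in> S)})
      \<longleftrightarrow> odd (card {e' \<in> F. (p e' \<in> S) \<noteq> (q e' \<in> S)}) \<noteq> odd (card ?E)"
    using odd_card_sym_diff[of "{e' \<in> F. (p e' \<in> S) \<noteq> (q e' \<in> S)}" ?E] insert by simp
  ultimately show ?case using insert.IH D by (auto split: if_splits)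
qed

text \<open>A spanning tree is grown without building it: take a largest vertex set containing r
  whose even subsets all have joins with fewer edges than the set has vertices; a crossing edge
  would attach one more vertex as a leaf. The end maps p and q are arbitrary because the result
  serves both G and the graph with the circuits of a 2-factor contracted.\<close>

lemma T_join_exists:
  assumes finX: "finite X" and r: "r \<in> X" and finE: "finite E"
    and conn: "\<And>S. \<lbrakk>r \<in> S; S \<subset> X\<rbrakk> \<Longrightarrow>
        \<exists>e \<in> E. (p e \<in> S \<and> q e \<in> X - S) \<or> (q e \<in> S \<and> p e \<in> X - S)"
    and T: "T \<subseteq> X" "even (card T)"
  shows "\<exists>F \<subseteq> E. card F < card X \<and> (\<forall>x. bd p q F x \<longleftrightarrow> x \<in> T)"
proof -
  define P where "P S \<longleftrightarrow> r \<in> S \<and> S \<subseteq> X \<and> (\<forall>T \<subseteq> S. even (card T) \<longrightarrow>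
      (\<exists>F \<subseteq> E. card F < card S \<and> (\<forall>x. bd p q F x \<longleftrightarrow> x \<in> T)))" for S
  have "P {r}"
    unfolding P_def
  proof (intro conjI allI impI)
    fix T assume "T \<subseteq> {r}" "even (card T)"
    then have "T = {}" by (auto simp: subset_singleton_iff)
    then show "\<exists>F\<subseteq>E. card F < card {r} \<and> (\<forall>x. bd p q F x \<longleftrightarrow> x \<in> T)"
      by (intro exI[of _ "{}"]) auto
  qed (use r in auto)
  moreover have "P S \<Longrightarrow> card S < Suc (card X)" for S
    using card_mono[OF finX] by (auto simp: P_def less_Suc_eq_le)
  ultimately obtain S where S: "P S" and max: "\<And>S'. P S' \<Longrightarrow> card S' \<le> card S"
    using ex_has_greatest_nat[of P "{r}" card "Suc (card X)"] by blast
  have "S = X"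
  proof (rule ccontr)
    assume "S \<noteq> X"
    then obtain e where e: "e \<in> E" "(p e \<in> S \<and> q e \<in> X - S) \<or> (q e \<in> S \<and> p e \<in> X - S)"
      using conn[of S] S by (auto simp: P_def)
    then obtain w v where wv: "w \<in> S" "v \<in> X - S" "{p e, q e} = {w, v}" by blast
    then have "w \<noteq> v" by blast
    have finS: "finite S" using S finX finite_subset by (auto simp: P_def)
    have b1: "bd p q {e} x \<longleftrightarrow> x \<in> {w, v}" for x
      using wv by (auto simp: bd_singleton doubleton_eq_iff)
    have "P (insert v S)"
      unfolding P_def
    proof (intro conjI allI impI)
      fix T assume T: "T \<subseteq> insert v S" "even (card T)"
      have finT: "finite T" using T finS finite_subset by blast
      show "\<exists>F\<subseteq>E. card F < card (insert v S) \<and> (\<forall>x. bd p q F x \<longleftrightarrow> x \<in> T)"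
      proof (cases "v \<in> T")
        case False
        then have "T \<subseteq> S" using T by blast
        then obtain F where "F \<subseteq> E" "card F < card S" "\<forall>x. bd p q F x \<longleftrightarrow> x \<in> T"
          using S T unfolding P_def by blast
        moreover have "card S \<le> card (insert v S)" by (rule card_insert_le)
        ultimately show ?thesis using order_less_le_trans by blast
      next
        case True
        \<comment> \<open>The new edge e serves the demand at v and transfers it to w; if w was
          demanded already, the two cancel.\<close>
        define T' where "T' = sym_diff T {w, v}"
        have "T' \<subseteq> S" using T True wv by (auto simp: T'_def)
        moreover have "even (card T')"
          using odd_card_sym_diff[of T "{w, v}"] finT T(2) \<open>w \<noteq> v\<close> by (auto simp: T'_def)
        moreover have "\<forall>T\<subseteq>S. even (card T) \<longrightarrow> (\<exists>F\<subseteq>E. card F < card S \<and> (\<forall>x. bd p q F x = (x \<in> T)))"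
          using S by (simp add: P_def)
        ultimately obtain F where F: "F \<subseteq> E" "card F < card S" "\<forall>x. bd p q F x \<longleftrightarrow> x \<in> T'"
          by blast
        have finF: "finite F" using F finE finite_subset by blast
        show ?thesis
        proof (intro exI[of _ "sym_diff F {e}"] conjI allI)
          show "card (sym_diff F {e}) < card (insert v S)"
            using card_sym_diff_le[of F "{e}"] finF F(2) wv finS by auto
          fix x show "bd p q (sym_diff F {e}) x \<longleftrightarrow> x \<in> T"
            using bd_sym_diff[of F "{e}" p q x] finF spec[OF F(3), of x] b1[of x]
            by (auto simp: T'_def)
        qed (use F e in auto)
      qed
    qed (use S wv in \<open>auto simp: P_def\<close>)
    then have "card (insert v S) \<le> card S" by (rule max)
    then show False using finS wv by auto
  qed
  then show ?thesis using S T by (auto simp: P_def)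
qed

section \<open>Paths\<close>

lemma rtrancl_crossing:
  assumes "(x, y) \<in> R\<^sup>*" "x \<in> S" "y \<notin> S"
  obtains a b where "(a, b) \<in> R" "a \<in> S" "b \<notin> S"
  using assms by (induction rule: rtrancl_induct) blast+

text \<open>A proper colouring excludes loops. Without them an edge has two distinct ends, and
  degrees count edges instead of half-edges.\<close>

locale loopless_graph = fin_digraph G for G :: "('v, 'e) pre_digraph" +
  assumes no_loop: "e \<in> arcs G \<Longrightarrow> tail G e \<noteq> head G e"
begin

abbreviation "V \<equiv> verts G"
abbreviation "E \<equiv> arcs G"
abbreviation "bdG \<equiv> bd (tail G) (head G)"

definition ends :: "'e \<Rightarrow> 'v set" where
  "ends e = {tail G e, head G e}"

definition adj :: "'e set \<Rightarrow> ('v \<times> 'v) set" where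
  "adj A = {(x, y). \<exists>e \<in> A. ends e = {x, y}}"

definition deg :: "'e set \<Rightarrow> 'v \<Rightarrow> nat" where
  "deg A v = card {e \<in> A. v \<in> ends e}"

definition is_path :: "'e set \<Rightarrow> 'v list \<Rightarrow> 'e list \<Rightarrow> bool" where
  "is_path A xs es \<longleftrightarrow> length xs = Suc (length es) \<and> distinct xs \<and> set es \<subseteq> A \<and>
     (\<forall>i < length es. ends (es ! i) = {xs ! i, xs ! Suc i})"

lemma card_ends: "e \<in> E \<Longrightarrow> card (ends e) = 2"
  using no_loop by (auto simp: ends_def)

lemma ends_in_V: "e \<in> E \<Longrightarrow> ends e \<subseteq> V"
  by (auto simp: ends_def)

lemma ends_other:
  assumes "e \<in> E" "v \<in> ends e"
  obtains w where "ends e = {v, w}" "w \<noteq> v"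
proof (cases "v = tail G e")
  case True
  show thesis by (rule that[of "head G e"]) (use True no_loop[OF assms(1)] in \<open>auto simp: ends_def\<close>)
next
  case False
  then have "v = head G e" using assms(2) by (simp add: ends_def)
  then show thesis using False by (intro that[of "tail G e"]) (auto simp: ends_def)
qed

lemma bdG_deg: "A \<subseteq> E \<Longrightarrow> bdG A v \<longleftrightarrow> odd (deg A v)"
proof -
  assume "A \<subseteq> E"
  then have "{e \<in> A. (tail G e = v) \<noteq> (head G e = v)} = {e \<in> A. v \<in> ends e}"
    using no_loop by (force simp: ends_def)
  then show ?thesis by (simp add: bd_def deg_def)
qed

lemma sym_adj: "sym (adj A)"
  by (auto simp: sym_def adj_def insert_commute)

lemma adj_rtrancl_sym: "(x, y) \<in> (adj A)\<^sup>* \<Longrightarrow> (y, x) \<in> (adj A)\<^sup>*"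
  using sym_rtrancl[OF sym_adj[of A]] by (auto dest: symD)

lemma adj_mono: "A \<subseteq> B \<Longrightarrow> adj A \<subseteq> adj B"
  by (auto simp: adj_def)

lemma adj_rtrancl_mono: "A \<subseteq> B \<Longrightarrow> (x, y) \<in> (adj A)\<^sup>* \<Longrightarrow> (x, y) \<in> (adj B)\<^sup>*"
  using rtrancl_mono[OF adj_mono] by blast

lemma adjI: "e \<in> A \<Longrightarrow> ends e = {x, y} \<Longrightarrow> (x, y) \<in> adj A"
  by (auto simp: adj_def)

lemma ends_adj: "e \<in> A \<Longrightarrow> x \<in> ends e \<Longrightarrow> y \<in> ends e \<Longrightarrow> (x, y) \<in> (adj A)\<^sup>*"
  by (cases "x = y") (auto simp: ends_def adj_def intro!: r_into_rtrancl)

lemma adj_rtrancl_in: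
  assumes "(x, y) \<in> (adj A)\<^sup>*" "x \<in> S" "\<And>e. e \<in> A \<Longrightarrow> ends e \<inter> S \<noteq> {} \<Longrightarrow> ends e \<subseteq> S"
  shows "y \<in> S"
  using assms(1,2)
proof (induction rule: rtrancl_induct)
  case (step y z)
  then obtain e where "e \<in> A" "ends e = {y, z}" by (auto simp: adj_def)
  then show ?case using assms(3)[of e] step by simp
qed

lemma path_single [simp]: "is_path A [x] []"
  by (simp add: is_path_def)

lemma path_nonempty: "is_path A xs es \<Longrightarrow> xs \<noteq> []"
  by (auto simp: is_path_def)

lemma path_mono: "is_path A xs es \<Longrightarrow> A \<subseteq> B \<Longrightarrow> is_path B xs es"
  by (auto simp: is_path_def)

lemma path_cons:
  "is_path A xs es \<Longrightarrow> e \<in> A \<Longrightarrow> ends e = {x, hd xs} \<Longrightarrow> x \<notin> set xs \<Longrightarrow> is_path A (x # xs) (e # es)"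
  unfolding is_path_def by (cases xs) (auto simp: less_Suc_eq_0_disj)

lemma path_consD:
  "is_path A (x # y # xs) (e # es) \<Longrightarrow>
    is_path A (y # xs) es \<and> e \<in> A \<and> ends e = {x, y} \<and> x \<notin> set (y # xs)"
  unfolding is_path_def by (auto simp: less_Suc_eq_0_disj)

lemma path_take:
  assumes "is_path A xs es" "j < length xs"
  shows "is_path A (take (Suc j) xs) (take j es)" "hd (take (Suc j) xs) = hd xs"
    "last (take (Suc j) xs) = xs ! j"
  using assms unfolding is_path_def
    apply (auto dest: in_set_takeD)[1]
  using assms by (auto simp: take_Suc_conv_app_nth hd_append hd_conv_nth)

lemma path_drop:
  assumes "is_path A xs es" "j < length xs"
  shows "is_path A (drop j xs) (drop j es)" "hd (drop j xs) = xs ! j"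
    "last (drop j xs) = last xs"
  using assms unfolding is_path_def
  by (auto simp: hd_drop_conv_nth dest: in_set_dropD)

lemma path_rev:
  assumes "is_path A xs es"
  shows "is_path A (rev xs) (rev es)"
  unfolding is_path_def
proof (intro conjI allI impI)
  fix i assume "i < length (rev es)"
  then have i: "i < length es" by simp
  then have "ends (es ! (length es - Suc i))
      = {xs ! (length es - Suc i), xs ! Suc (length es - Suc i)}"
    using assms by (simp add: is_path_def)
  moreover have "rev es ! i = es ! (length es - Suc i)" using i by (simp add: rev_nth)
  moreover have "rev xs ! i = xs ! Suc (length es - Suc i)" "rev xs ! Suc i = xs ! (length es - Suc i)"
    using i assms by (simp_all add: is_path_def rev_nth Suc_diff_Suc)
  ultimately show "ends (rev es ! i) = {rev xs ! i, rev xs ! Suc i}"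
    by (simp add: insert_commute)
qed (use assms in \<open>auto simp: is_path_def\<close>)

lemma path_append:
  assumes "is_path A xs es" "is_path A ys fs" "last xs = hd ys" "set xs \<inter> set ys = {hd ys}"
  shows "is_path A (xs @ tl ys) (es @ fs)" "hd (xs @ tl ys) = hd xs" "last (xs @ tl ys) = last ys"
    "set (xs @ tl ys) = set xs \<union> set ys"
proof -
  obtain y ys' where ys: "ys = y # ys'" using path_nonempty[OF assms(2)] by (cases ys) auto
  have ne: "xs \<noteq> []" using path_nonempty[OF assms(1)] .
  have dis: "set xs \<inter> set ys' = {}"
    using assms(2,4) ys by (auto simp: is_path_def)
  show "is_path A (xs @ tl ys) (es @ fs)"
    unfolding is_path_def
  proof (intro conjI allI impI)
    fix i assume i: "i < length (es @ fs)"
    show "ends ((es @ fs) ! i) = {(xs @ tl ys) ! i, (xs @ tl ys) ! Suc i}"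
    proof (cases "i < length es")
      case True
      then show ?thesis using assms(1) by (auto simp: is_path_def nth_append)
    next
      case False
      then obtain k where k: "i = length es + k" by (metis le_add_diff_inverse not_less)
      have "ends (fs ! k) = {ys ! k, ys ! Suc k}" using assms(2) i k by (auto simp: is_path_def)
      moreover have "(xs @ tl ys) ! i = ys ! k"
        using assms(1,3) ne ys k
        by (cases k) (auto simp: is_path_def nth_append last_conv_nth)
      moreover have "(xs @ tl ys) ! Suc i = ys ! Suc k"
        using assms(1) ys k by (auto simp: is_path_def nth_append)
      ultimately show ?thesis using k by (simp add: nth_append)
    qed
  qed (use assms(1,2) ys dis in \<open>auto simp: is_path_def\<close>)
  show "hd (xs @ tl ys) = hd xs" using ne by simp
  show "last (xs @ tl ys) = last ys" using assms(3) ys ne by auto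
  show "set (xs @ tl ys) = set xs \<union> set ys"
    using assms(3) ys ne last_in_set[OF ne] by auto
qed

lemma path_distinct_edges:
  assumes "is_path A xs es"
  shows "distinct es"
  unfolding distinct_conv_nth
proof (intro allI impI)
  fix i j assume ij: "i < length es" "j < length es" "i \<noteq> j"
  have "{xs ! i, xs ! Suc i} \<noteq> {xs ! j, xs ! Suc j}"
  proof -
    have "length xs = Suc (length es)" "distinct xs" using assms by (auto simp: is_path_def)
    then have "xs ! i = xs ! j \<longleftrightarrow> i = j" "xs ! i = xs ! Suc j \<longleftrightarrow> i = Suc j"
      "xs ! Suc i = xs ! j \<longleftrightarrow> Suc i = j"
      using ij by (simp_all add: nth_eq_iff_index_eq)
    then show ?thesis unfolding doubleton_eq_iff using ij by linarith
  qed
  moreover have "ends (es ! i) = {xs ! i, xs ! Suc i}" "ends (es ! j) = {xs ! j, xs ! Suc j}"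
    using ij assms by (auto simp: is_path_def)
  ultimately have "ends (es ! i) \<noteq> ends (es ! j)" by simp
  then show "es ! i \<noteq> es ! j" by (rule contrapos_nn) simp
qed

lemma path_card:
  assumes "is_path A xs es"
  shows "card (set es) = length es" "card (set xs) = Suc (length es)"
  using path_distinct_edges[OF assms] assms by (auto simp: is_path_def distinct_card)

lemma path_ends_subset:
  assumes "is_path A xs es" "e \<in> set es"
  shows "ends e \<subseteq> set xs"
proof -
  obtain i where "i < length es" "e = es ! i" using assms(2) by (auto simp: in_set_conv_nth)
  then have "ends e = {xs ! i, xs ! Suc i}" "Suc i < length xs" using assms(1) by (auto simp: is_path_def)
  then show ?thesis by auto
qed

lemma path_connected:
  assumes "is_path A xs es" "x \<in> set xs" "y \<in> set xs"
  shows "(x, y) \<in> (adj (set es))\<^sup>*"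
proof -
  have *: "i < length xs \<Longrightarrow> (xs ! 0, xs ! i) \<in> (adj (set es))\<^sup>*" for i
  proof (induction i)
    case (Suc i)
    then have "(xs ! i, xs ! Suc i) \<in> adj (set es)"
      using assms(1) by (auto simp: is_path_def intro!: adjI[of "es ! i"])
    then show ?case using Suc by (auto intro: rtrancl_into_rtrancl)
  qed simp
  have "(xs ! 0, x) \<in> (adj (set es))\<^sup>*" "(xs ! 0, y) \<in> (adj (set es))\<^sup>*"
    using assms(2,3) * by (auto simp: in_set_conv_nth)
  then show ?thesis by (meson adj_rtrancl_sym rtrancl_trans)
qed

lemma path_in_V:
  assumes "is_path A xs es" "A \<subseteq> E" "hd xs \<in> V"
  shows "set xs \<subseteq> V"
proof
  fix x assume "x \<in> set xs"
  then have "(hd xs, x) \<in> (adj (set es))\<^sup>*"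
    using path_connected[OF assms(1)] path_nonempty[OF assms(1)] by auto
  moreover have "set es \<subseteq> E" using assms by (auto simp: is_path_def)
  ultimately show "x \<in> V"
    using adj_rtrancl_in[of "hd xs" x "set es" V] assms(3) ends_in_V by blast
qed

text \<open>The walk is built from its far end and shortened on the fly: a vertex met again cuts off
  the part of the path before it.\<close>

lemma path_exists:
  assumes "(x, y) \<in> (adj A)\<^sup>*"
  obtains xs es where "is_path A xs es" "hd xs = x" "last xs = y"
proof -
  have "\<exists>xs es. is_path A xs es \<and> hd xs = x \<and> last xs = y"
    using assms
  proof (induction rule: converse_rtrancl_induct)
    case base
    show ?case by (intro exI[of _ "[y]"] exI[of _ "[]"]) simp
  next
    case (step x z)
    then obtain xs es where p: "is_path A xs es" "hd xs = z" "last xs = y" by blast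
    obtain e where e: "e \<in> A" "ends e = {x, z}" using step(1) by (auto simp: adj_def)
    show ?case
    proof (cases "x \<in> set xs")
      case True
      then obtain j where "j < length xs" "xs ! j = x" by (auto simp: in_set_conv_nth)
      then show ?thesis using path_drop[OF p(1), of j] p(3) by blast
    next
      case False
      then have "is_path A (x # xs) (e # es)" using path_cons[OF p(1) e(1)] e(2) p(2) by simp
      moreover have "last (x # xs) = y" using p path_nonempty[OF p(1)] by simp
      ultimately show ?thesis
        by (intro exI[of _ "x # xs"] exI[of _ "e # es"]) simp
    qed
  qed
  then show thesis using that by blast
qed

text \<open>Needed for barbells, whose path may touch the circuits only at its ends: cut at the
  first vertex in T, then at the last vertex in S not beyond it.\<close>

lemma path_between_sets:
  assumes "is_path A xs es" "hd xs \<in> S" "last xs \<in> T"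
  obtains ys fs where "is_path A ys fs" "set fs \<subseteq> set es" "set ys \<subseteq> set xs"
    "set ys \<inter> S = {hd ys}" "set ys \<inter> T = {last ys}"
proof -
  have len: "length xs = Suc (length es)" and ne: "xs \<noteq> []" and dis: "distinct xs"
    using assms(1) by (auto simp: is_path_def)
  define j where "j = (LEAST j. j < length xs \<and> xs ! j \<in> T)"
  have "length xs - 1 < length xs \<and> xs ! (length xs - 1) \<in> T"
    using assms(3) ne by (simp add: last_conv_nth)
  then have j: "j < length xs" "xs ! j \<in> T" and jmin: "\<And>k. k < j \<Longrightarrow> xs ! k \<notin> T"
    unfolding j_def using LeastI[of "\<lambda>j. j < length xs \<and> xs ! j \<in> T"]
    by (auto dest: not_less_Least intro: less_trans)
  define i where "i = (GREATEST i. i \<le> j \<and> xs ! i \<in> S)"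
  have "0 \<le> j \<and> xs ! 0 \<in> S" using assms(2) ne by (simp add: hd_conv_nth)
  then have i: "i \<le> j \<and> xs ! i \<in> S" and imax: "\<And>k. k \<le> j \<and> xs ! k \<in> S \<Longrightarrow> k \<le> i"
    unfolding i_def
    using GreatestI_nat[of "\<lambda>i. i \<le> j \<and> xs ! i \<in> S" 0 j]
      Greatest_le_nat[of "\<lambda>i. i \<le> j \<and> xs ! i \<in> S" _ j] by auto
  define ys where "ys = drop i (take (Suc j) xs)"
  define fs where "fs = drop i (take j es)"
  have p: "is_path A (take (Suc j) xs) (take j es)" "last (take (Suc j) xs) = xs ! j"
    using path_take[OF assms(1) j(1)] by auto
  have il: "i < length (take (Suc j) xs)" using i j by auto
  have q: "is_path A ys fs" "hd ys = xs ! i" "last ys = xs ! j"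
    using path_drop[OF p(1) il] p(2) i unfolding ys_def fs_def by auto
  have mem: "x \<in> set ys \<longleftrightarrow> (\<exists>k. i \<le> k \<and> k \<le> j \<and> x = xs ! k)" for x
  proof
    assume "x \<in> set ys"
    then obtain k where "k < length ys" "x = ys ! k" by (auto simp: in_set_conv_nth)
    then show "\<exists>k. i \<le> k \<and> k \<le> j \<and> x = xs ! k"
      using j by (intro exI[of _ "i + k"]) (auto simp: ys_def)
  next
    assume "\<exists>k. i \<le> k \<and> k \<le> j \<and> x = xs ! k"
    then obtain k where k: "i \<le> k" "k \<le> j" "x = xs ! k" by blast
    then have "x = ys ! (k - i)" "k - i < length ys" using j by (auto simp: ys_def)
    then show "x \<in> set ys" by simp
  qed
  show thesis
  proof
    show "is_path A ys fs" by (rule q)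
    show "set fs \<subseteq> set es" unfolding fs_def by (meson set_drop_subset set_take_subset subset_trans)
    show "set ys \<subseteq> set xs" unfolding ys_def by (meson set_drop_subset set_take_subset subset_trans)
    show "set ys \<inter> S = {hd ys}"
      using mem q(2) i imax le_antisym by (fastforce simp del: le_antisym)
    show "set ys \<inter> T = {last ys}"
      using mem q(3) i j jmin by (auto simp: le_less)
  qed
qed

lemma bdG_path:
  assumes "is_path A xs es" "A \<subseteq> E"
  shows "bdG (set es) v \<longleftrightarrow> (hd xs = v) \<noteq> (last xs = v)"
  using assms(1)
proof (induction es arbitrary: xs)
  case Nil
  then obtain x where "xs = [x]" by (auto simp: is_path_def length_Suc_conv)
  then show ?case by simp
next
  case (Cons e es)
  then obtain x y ys where xs: "xs = x # y # ys" by (auto simp: is_path_def length_Suc_conv)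
  then have p: "is_path A (y # ys) es" "ends e = {x, y}" "x \<noteq> y" "e \<in> A"
    using path_consD[of A x y ys e es] Cons.prems by auto
  have "e \<notin> set es" using path_distinct_edges[OF Cons.prems] by simp
  moreover have "(tail G e = v) \<noteq> (head G e = v) \<longleftrightarrow> (x = v) \<noteq> (y = v)"
    using p(2) by (auto simp: ends_def doubleton_eq_iff)
  ultimately show ?case using Cons.IH[OF p(1)] xs by (auto simp: bd_insert)
qed

section \<open>Circuits\<close>

definition sub :: "'v set \<Rightarrow> 'e set \<Rightarrow> ('v, 'e) pre_digraph" where
  "sub S A = \<lparr>verts = S, arcs = A, tail = tail G, head = head G\<rparr>"

lemma sub_simps [simp]: "verts (sub S A) = S" "arcs (sub S A) = A"
  "tail (sub S A) = tail G" "head (sub S A) = head G"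
  by (auto simp: sub_def)

lemma subgraph_sub:
  assumes "S \<subseteq> S'" "A \<subseteq> A'" "S' \<subseteq> V" "A' \<subseteq> E" "\<And>e. e \<in> A \<Longrightarrow> ends e \<subseteq> S" "\<And>e. e \<in> A' \<Longrightarrow> ends e \<subseteq> S'"
  shows "subgraph (sub S A) (sub S' A')"
  unfolding subgraph_def compatible_def
  using assms by (auto simp: ends_def intro!: wf_digraph.intro)

lemma subgraph_sub_G:
  assumes "S \<subseteq> V" "A \<subseteq> E" "\<And>e. e \<in> A \<Longrightarrow> ends e \<subseteq> S"
  shows "subgraph (sub S A) G"
  unfolding subgraph_def compatible_def
  using assms wf_digraph_axioms by (auto simp: ends_def intro!: wf_digraph.intro)

lemma connected_sub:
  assumes "S \<noteq> {}" "\<And>e. e \<in> A \<Longrightarrow> ends e \<subseteq> S" "\<And>x y. x \<in> S \<Longrightarrow> y \<in> S \<Longrightarrow> (x, y) \<in> (adj A)\<^sup>*"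
  shows "Digraph_Component.connected (sub S A)"
proof -
  let ?M = "with_proj (mk_symmetric (sub S A))"
  have M: "verts ?M = S" "arcs_ends ?M = adj A"
    by (auto simp: mk_symmetric_def arcs_ends_def arc_to_ends_def adj_def ends_def doubleton_eq_iff)
  have "(x, y) \<in> rtrancl_on S (adj A)" if "x \<in> S" "(x, y) \<in> (adj A)\<^sup>*" for x y
    using that(2)
  proof (induction rule: rtrancl_induct)
    case base
    then show ?case using that(1) by auto
  next
    case (step y z)
    then have "z \<in> S" using assms(2) by (auto simp: adj_def)
    then show ?case using step by (auto intro: rtrancl_on_into_rtrancl_on)
  qed
  then show ?thesis
    unfolding Digraph_Component.connected_def strongly_connected_def reachable_def
    using M assms(1,3) by auto
qed

text \<open>The notion \<open>circuit\<close> for a vertex set and an edge set of G, phrased by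
  \<open>deg\<close> and \<open>adj\<close> so that circuits can be handled as sets;
  \<open>circuit_sub\<close> leads back to the graph notion.\<close>

definition ring :: "'v set \<Rightarrow> 'e set \<Rightarrow> bool" where
  "ring S A \<longleftrightarrow> S \<noteq> {} \<and> S \<subseteq> V \<and> A \<subseteq> E \<and> (\<forall>e \<in> A. ends e \<subseteq> S) \<and> (\<forall>v \<in> S. deg A v = 2) \<and>
     (\<forall>x \<in> S. \<forall>y \<in> S. (x, y) \<in> (adj A)\<^sup>*)"

lemma ringD:
  assumes "ring S A"
  shows "S \<noteq> {}" "S \<subseteq> V" "A \<subseteq> E" "finite S" "finite A" "\<And>e. e \<in> A \<Longrightarrow> ends e \<subseteq> S"
    "\<And>v. v \<in> S \<Longrightarrow> deg A v = 2" "\<And>x y. x \<in> S \<Longrightarrow> y \<in> S \<Longrightarrow> (x, y) \<in> (adj A)\<^sup>*"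
  using assms finite_subset[of S V] finite_subset[of A E] by (auto simp: ring_def)

lemma degree_sub:
  assumes "A \<subseteq> E"
  shows "degree (sub S A) v = deg A v"
proof -
  have "bij_betw fst (half_edges (sub S A) v) {e \<in> A. v \<in> ends e}"
    unfolding bij_betw_def
  proof
    show "inj_on fst (half_edges (sub S A) v)"
      using assms no_loop by (force simp: inj_on_def half_edges_def split: if_splits)
    show "fst ` half_edges (sub S A) v = {e \<in> A. v \<in> ends e}"
      by (force simp: half_edges_def ends_def image_iff)
  qed
  then show ?thesis by (simp add: degree_def deg_def bij_betw_same_card)
qed

lemma circuit_sub:
  assumes "ring S A"
  shows "circuit (sub S A)"
proof -
  note r = ringD[OF assms]
  have "fin_digraph (sub S A)"
    using r by unfold_locales (auto simp: ends_def)
  moreover have "Digraph_Component.connected (sub S A)"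
    using r by (intro connected_sub) auto
  moreover have "regular 2 (sub S A)"
    using r by (auto simp: regular_def degree_sub)
  ultimately show ?thesis by (simp add: circuit_def)
qed

lemma sum_deg:
  assumes "A \<subseteq> E" "finite S" "\<And>e. e \<in> A \<Longrightarrow> ends e \<subseteq> S"
  shows "(\<Sum>v\<in>S. deg A v) = 2 * card A"
proof -
  have fA: "finite A" using finite_subset[OF assms(1)] by simp
  have "(\<Sum>v\<in>S. deg A v) = (\<Sum>v\<in>S. \<Sum>e\<in>{e \<in> A. v \<in> ends e}. 1)"
    by (simp add: deg_def)
  also have "\<dots> = (\<Sum>e\<in>A. \<Sum>v\<in>{v \<in> S. v \<in> ends e}. 1)"
    using sum.swap_restrict[OF assms(2) fA, of "\<lambda>v e. 1::nat" "\<lambda>v e. v \<in> ends e"] .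
  also have "\<dots> = (\<Sum>e\<in>A. 2)"
  proof (rule sum.cong)
    fix e assume "e \<in> A"
    then have "{v \<in> S. v \<in> ends e} = ends e" "card (ends e) = 2"
      using assms card_ends by auto
    then show "(\<Sum>v\<in>{v \<in> S. v \<in> ends e}. 1) = (2::nat)" by simp
  qed simp
  finally show ?thesis by simp
qed

lemma ring_card:
  assumes "ring S A"
  shows "card A = card S"
  using sum_deg[of A S] ringD[OF assms] by simp

lemma ring_card_ge_2:
  assumes "ring S A"
  shows "2 \<le> card S"
proof -
  obtain v where "v \<in> S" using ringD(1)[OF assms] by blast
  then have "deg A v \<le> card A" unfolding deg_def
    using ringD(5)[OF assms] by (intro card_mono) auto
  then show ?thesis using ringD(7)[OF assms \<open>v \<in> S\<close>] ring_card[OF assms] by simp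
qed

lemma T_join_connected:
  assumes "finite S" "S \<noteq> {}" "finite A" "\<And>e. e \<in> A \<Longrightarrow> ends e \<subseteq> S"
    and conn: "\<And>x y. x \<in> S \<Longrightarrow> y \<in> S \<Longrightarrow> (x, y) \<in> (adj A)\<^sup>*"
    and T: "T \<subseteq> S" "even (card T)"
  shows "\<exists>F\<subseteq>A. \<forall>x. bdG F x \<longleftrightarrow> x \<in> T"
proof -
  obtain x where x: "x \<in> S" using assms(2) by blast
  have "\<exists>F\<subseteq>A. card F < card S \<and> (\<forall>x. bdG F x \<longleftrightarrow> x \<in> T)"
  proof (rule T_join_exists[OF assms(1) x assms(3) _ T])
    fix S' assume S': "x \<in> S'" "S' \<subset> S"
    then obtain y where "y \<in> S" "y \<notin> S'" by blast
    then obtain a b where "(a, b) \<in> adj A" "a \<in> S'" "b \<notin> S'"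
      using rtrancl_crossing[OF conn[OF x, of y] S'(1)] by blast
    then show "\<exists>e\<in>A. (tail G e \<in> S' \<and> head G e \<in> S - S') \<or> (head G e \<in> S' \<and> tail G e \<in> S - S')"
      using assms(4) by (fastforce simp: adj_def ends_def doubleton_eq_iff)
  qed
  then show ?thesis by blast
qed

text \<open>All degrees in the circuit are even, so a join and its complement in A have the same
  boundary on S; the smaller of the two is taken.\<close>

lemma ring_T_join:
  assumes "ring S A" "T \<subseteq> S" "even (card T)"
  obtains J where "J \<subseteq> A" "2 * card J \<le> card A" "\<And>v. v \<in> S \<Longrightarrow> bdG J v \<longleftrightarrow> v \<in> T"
proof -
  note r = ringD[OF assms(1)]
  have "\<exists>F\<subseteq>A. \<forall>x. bdG F x \<longleftrightarrow> x \<in> T"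
    by (rule T_join_connected[OF r(4,1,5,6,8) assms(2,3)])
  then obtain F where F: "F \<subseteq> A" "\<forall>x. bdG F x \<longleftrightarrow> x \<in> T" by blast
  show thesis
  proof (cases "2 * card F \<le> card A")
    case True
    then show thesis using F that by blast
  next
    case False
    have fF: "finite F" using F r(5) finite_subset by blast
    have eq: "A - F = sym_diff A F" using F by blast
    show thesis
    proof (rule that[of "A - F"])
      show "2 * card (A - F) \<le> card A"
        using False F(1) fF r(5) by (simp add: card_Diff_subset)
      fix v assume "v \<in> S"
      have "\<not> bdG A v" using bdG_deg[OF r(3), of v] r(7)[OF \<open>v \<in> S\<close>] by simp
      then show "bdG (A - F) v \<longleftrightarrow> v \<in> T"
        using bd_sym_diff[OF r(5) fF, of "tail G" "head G" v, folded eq] F(2) by simp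
    qed (use F in blast)
  qed
qed

section \<open>Circuits as cyclic sequences of vertices and edges\<close>

definition cyc :: "'v list \<Rightarrow> 'e list \<Rightarrow> bool" where
  "cyc xs es \<longleftrightarrow> xs \<noteq> [] \<and> length xs = length es \<and> distinct xs \<and> distinct es \<and> set es \<subseteq> E \<and>
     (\<forall>i < length xs. ends (es ! i) = {xs ! i, xs ! (Suc i mod length xs)})"

text \<open>The two edges at the k-th vertex are those at positions k and k - 1 modulo the length.
  Distinctness of the edges is a separate clause of \<open>cyc\<close> because a circuit of two
  parallel edges repeats the same pair of ends.\<close>

lemma ring_cyc:
  assumes "cyc xs es"
  shows "ring (set xs) (set es)"
proof -
  let ?n = "length xs"
  have c: "xs \<noteq> []" "?n = length es" "distinct xs" "distinct es" "set es \<subseteq> E"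
    "\<And>i. i < ?n \<Longrightarrow> ends (es ! i) = {xs ! i, xs ! (Suc i mod ?n)}"
    using assms by (auto simp: cyc_def)
  have n0: "0 < ?n" using c(1) by simp
  \<comment> \<open>A cycle of length 1 would be a loop.\<close>
  have "?n \<noteq> 1"
  proof
    assume 1: "?n = 1"
    then have "ends (es ! 0) = {xs ! 0}" using c(6)[of 0] by simp
    moreover have "es ! 0 \<in> E" using c(2,5) 1 by (metis less_one nth_mem subset_eq)
    ultimately show False using card_ends[of "es ! 0"] by simp
  qed
  then have n2: "2 \<le> ?n" using n0 by linarith
  have sub: "ends e \<subseteq> set xs" if "e \<in> set es" for e
  proof -
    obtain i where "i < ?n" "e = es ! i" using \<open>e \<in> set es\<close> c(2) by (auto simp: in_set_conv_nth)
    then show ?thesis using c(6) n0 by auto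
  qed
  have conn: "i < ?n \<Longrightarrow> (xs ! 0, xs ! i) \<in> (adj (set es))\<^sup>*" for i
  proof (induction i)
    case (Suc i)
    then have "(xs ! i, xs ! Suc i) \<in> adj (set es)"
      using c(2) c(6)[of i] by (intro adjI[of "es ! i"]) auto
    then show ?case using Suc by (auto intro: rtrancl_into_rtrancl)
  qed simp
  have deg2: "deg (set es) v = 2" if v: "v \<in> set xs" for v
  proof -
    obtain k where k: "k < ?n" "v = xs ! k" using v by (auto simp: in_set_conv_nth)
    define k' where "k' = (k + ?n - 1) mod ?n"
    have k': "k' < ?n" "Suc k' mod ?n = k" "k' \<noteq> k"
      using k n2 unfolding k'_def by (cases k; simp add: mod_Suc mod_if)+
    have uniq: "i = k'" if "i < ?n" "Suc i mod ?n = k" for i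
      using that k' by (auto simp: mod_Suc split: if_splits)
    have "{e \<in> set es. v \<in> ends e} = {es ! k, es ! k'}"
    proof (intro equalityI subsetI)
      fix e assume "e \<in> {e \<in> set es. v \<in> ends e}"
      then obtain i where i: "i < ?n" "e = es ! i" "v \<in> ends (es ! i)"
        using c(2) by (auto simp: in_set_conv_nth)
      then have "xs ! k = xs ! i \<or> xs ! k = xs ! (Suc i mod ?n)" using c(6) k by auto
      then have "k = i \<or> k = Suc i mod ?n"
        using nth_eq_iff_index_eq[OF c(3)] i k n0 by (meson mod_less_divisor)
      then show "e \<in> {es ! k, es ! k'}" using uniq i by blast
    next
      fix e assume "e \<in> {es ! k, es ! k'}"
      then show "e \<in> {e \<in> set es. v \<in> ends e}" using c(2,6) k k' by auto
    qed
    moreover have "es ! k \<noteq> es ! k'"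
      using k k' c(2,4) by (auto simp: nth_eq_iff_index_eq)
    ultimately show ?thesis by (simp add: deg_def)
  qed
  have "(x, y) \<in> (adj (set es))\<^sup>*" if xy: "x \<in> set xs" "y \<in> set xs" for x y
  proof -
    obtain i j where "i < ?n" "x = xs ! i" "j < ?n" "y = xs ! j" using xy unfolding in_set_conv_nth by blast
    then show ?thesis using adj_rtrancl_sym[OF conn[of i]] conn[of j] by (auto intro: rtrancl_trans)
  qed
  moreover have "set xs \<subseteq> V"
  proof
    fix x assume "x \<in> set xs"
    then obtain e where "e \<in> set es" "x \<in> ends e" using deg2[of x]
      by (metis (mono_tags, lifting) card.empty deg_def empty_Collect_eq zero_neq_numeral)
    then show "x \<in> V" using ends_in_V c(5) by blast
  qed
  ultimately show ?thesis
    unfolding ring_def using c sub deg2 by auto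
qed

text \<open>Each path is listed without its last vertex, which is the first vertex of the other one.
  Edge-disjointness matters when both paths are a single edge between the same two vertices.\<close>

lemma cyc_two_paths:
  assumes "is_path E xs es" "is_path E ys fs" "hd ys = last xs" "last ys = hd xs"
    "set xs \<inter> set ys = {hd xs, last xs}" "hd xs \<noteq> last xs" "set es \<inter> set fs = {}"
  shows "ring (set xs \<union> set ys) (set es \<union> set fs)"
proof -
  have lx: "length xs = Suc (length es)" "distinct xs" "xs \<noteq> []"
    and ly: "length ys = Suc (length fs)" "distinct ys" "ys \<noteq> []"
    using assms(1,2) by (auto simp: is_path_def)
  have bx: "xs = butlast xs @ [last xs]" and by': "ys = butlast ys @ [last ys]"
    using lx ly by simp_all
  have lb: "length (butlast xs) = length es" "length (butlast ys) = length fs" using lx ly by auto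
  let ?z = "butlast xs @ butlast ys" and ?g = "es @ fs"
  have ne: "es \<noteq> []" "fs \<noteq> []"
    using assms(3,4,6) lx ly by (auto simp: length_Suc_conv)
  have sx: "set xs = insert (last xs) (set (butlast xs))" by (subst bx) simp
  have sy: "set ys = insert (hd xs) (set (butlast ys))" by (subst by') (simp add: assms(4))
  have "distinct (butlast xs @ [last xs])" "distinct (butlast ys @ [last ys])"
    using lx(2,3) ly(2,3) by simp_all
  then have nlx: "last xs \<notin> set (butlast xs)" and nly: "hd xs \<notin> set (butlast ys)"
    using assms(4) by simp_all
  have hx: "hd xs \<in> set (butlast xs)" using sx assms(6) hd_in_set[OF lx(3)] by blast
  have hy: "last xs \<in> set (butlast ys)" using sy assms(3,6) hd_in_set[OF ly(3)] by auto
  have "set (butlast xs) \<inter> set (butlast ys) = {}"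
  proof (rule equals0I)
    fix x assume x: "x \<in> set (butlast xs) \<inter> set (butlast ys)"
    then have "x \<in> {hd xs, last xs}" using assms(5) by (auto dest: in_set_butlastD)
    then show False using x nlx nly by auto
  qed
  then have dz: "distinct ?z" using lx ly by (simp add: distinct_butlast)
  have dg: "distinct ?g"
    using path_distinct_edges[OF assms(1)] path_distinct_edges[OF assms(2)] assms(7) by simp
  have "cyc ?z ?g"
    unfolding cyc_def
  proof (intro conjI allI impI)
    fix i assume i: "i < length ?z"
    show "ends (?g ! i) = {?z ! i, ?z ! (Suc i mod length ?z)}"
    proof (cases "i < length es")
      case True
      then have "ends (?g ! i) = {xs ! i, xs ! Suc i}"
        using assms(1) by (simp add: is_path_def nth_append)
      moreover have "?z ! i = xs ! i" using True lb by (simp add: nth_append nth_butlast)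
      moreover have "?z ! (Suc i mod length ?z) = xs ! Suc i"
      proof (cases "Suc i < length es")
        case True
        then show ?thesis using lb by (simp add: nth_append nth_butlast)
      next
        case False
        then have "Suc i = length es" using True by simp
        then have "?z ! (Suc i mod length ?z) = butlast ys ! 0" "xs ! Suc i = last xs"
          using lb ne lx by (auto simp: nth_append last_conv_nth)
        then show ?thesis using assms(3) ne lb ly by (simp add: nth_butlast hd_conv_nth)
      qed
      ultimately show ?thesis by simp
    next
      case False
      then obtain k where k: "i = length es + k" by (metis le_add_diff_inverse not_less)
      then have kf: "k < length fs" using i lb by simp
      then have "ends (?g ! i) = {ys ! k, ys ! Suc k}"
        using assms(2) k by (simp add: is_path_def nth_append)
      moreover have "?z ! i = ys ! k" using k kf lb by (simp add: nth_append nth_butlast)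
      moreover have "?z ! (Suc i mod length ?z) = ys ! Suc k"
      proof (cases "Suc k < length fs")
        case True
        then show ?thesis using k lb by (simp add: nth_append nth_butlast)
      next
        case False
        then have "Suc k = length fs" using kf by simp
        then have "Suc i = length ?z" using lb k by simp
        then have "Suc i mod length ?z = 0" by simp
        then have "?z ! (Suc i mod length ?z) = butlast xs ! 0" "ys ! Suc k = last ys"
          using \<open>Suc k = length fs\<close> lb ne ly by (auto simp: nth_append last_conv_nth)
        then show ?thesis using assms(4) ne lb lx by (simp add: nth_butlast hd_conv_nth)
      qed
      ultimately show ?thesis by simp
    qed
  next
    show "?z \<noteq> []" using hx by auto
    show "length ?z = length ?g" using lb by simp
    show "set ?g \<subseteq> E" using assms(1,2) by (auto simp: is_path_def)
  qed (use dz dg in auto)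
  moreover have "set ?z = set xs \<union> set ys" using sx sy hx hy by auto
  ultimately show ?thesis using ring_cyc by fastforce
qed

text \<open>A smaller circuit already uses both edges of A at each of its vertices, so no edge of
  the connected circuit A can leave it.\<close>

lemma ring_closed:
  assumes "ring S A" "ring S' A'" "S' \<subseteq> S" "A' \<subseteq> A"
  shows "S' = S" "A' = A"
proof -
  note r = ringD[OF assms(1)] and r' = ringD[OF assms(2)]
  have full: "{e \<in> A'. v \<in> ends e} = {e \<in> A. v \<in> ends e}" if "v \<in> S'" for v
  proof (rule card_subset_eq)
    show "card {e \<in> A'. v \<in> ends e} = card {e \<in> A. v \<in> ends e}"
      using r(7)[of v] r'(7)[of v] that assms(3) by (auto simp: deg_def)
  qed (use r(5) assms(4) in auto)
  have step: "e \<in> A'" if "e \<in> A" "ends e \<inter> S' \<noteq> {}" for e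
    using full that by blast
  obtain x where x: "x \<in> S'" using r'(1) by blast
  have "S \<subseteq> S'"
  proof
    fix y assume "y \<in> S"
    then have "(x, y) \<in> (adj A)\<^sup>*" using r(8) x assms(3) by blast
    then show "y \<in> S'" using adj_rtrancl_in[of x y A S'] x step r'(6) by blast
  qed
  then show S: "S' = S" using assms(3) by blast
  have "ends e \<noteq> {}" for e by (simp add: ends_def)
  then have "A \<subseteq> A'" using step r(6) S by fastforce
  then show "A' = A" using assms(4) by blast
qed

text \<open>Take a longest path in the circuit. The second edge at its first vertex leads back to
  the path and closes a circuit, which by \<open>ring_closed\<close> is everything.\<close>

lemma cyc_exists:
  assumes "ring S A"
  obtains xs es where "cyc xs es" "set xs = S" "set es = A"
proof -
  note r = ringD[OF assms]
  define P where "P = (\<lambda>(xs, es). is_path A xs es \<and> set xs \<subseteq> S)"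
  obtain v where v: "v \<in> S" using r(1) by blast
  have P0: "P ([v], [])" using v by (simp add: P_def)
  have bound: "\<forall>p. P p \<longrightarrow> length (fst p) < Suc (card S)"
  proof (intro allI impI)
    fix p assume "P p"
    then have "distinct (fst p)" "set (fst p) \<subseteq> S" by (auto simp: P_def is_path_def)
    then show "length (fst p) < Suc (card S)"
      using card_mono[OF r(4)] by (metis distinct_card less_Suc_eq_le)
  qed
  obtain p where p: "P p" and maxp: "\<forall>q. P q \<longrightarrow> length (fst q) \<le> length (fst p)"
    using ex_has_greatest_nat[of P "([v], [])" "\<lambda>p. length (fst p)" "Suc (card S)"] P0 bound by blast
  obtain xs es where xe: "p = (xs, es)" by fastforce
  have path: "is_path A xs es" and xsS: "set xs \<subseteq> S" using p xe by (auto simp: P_def)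
  have max: "length ys \<le> length xs" if "is_path A ys fs" "set ys \<subseteq> S" for ys fs
  proof -
    have "P (ys, fs)" using that by (simp add: P_def)
    then show ?thesis using maxp xe by force
  qed
  have len: "length xs = Suc (length es)" "distinct xs" using path by (auto simp: is_path_def)
  then have ne: "xs \<noteq> []" by auto
  define z where "z = hd xs"
  have z: "z \<in> S" "z = xs ! 0" using ne xsS hd_conv_nth[OF ne] unfolding z_def by auto
  have nb: "w \<in> set xs" if "e \<in> A" "ends e = {z, w}" for e w
  proof (rule ccontr)
    assume "w \<notin> set xs"
    then have "is_path A (w # xs) (e # es)"
      using path_cons[OF path that(1)] that(2) by (simp add: z_def insert_commute)
    moreover have "set (w # xs) \<subseteq> S" using xsS r(6)[OF that(1)] that(2) by auto
    ultimately show False using max by fastforce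
  qed
  have "card {e \<in> A. z \<in> ends e} = 2" using r(7)[OF z(1)] by (simp add: deg_def)
  then obtain f where f: "f \<in> A" "z \<in> ends f" "es \<noteq> [] \<longrightarrow> f \<noteq> es ! 0"
    by (metis (mono_tags, lifting) card_2_iff' mem_Collect_eq)
  obtain w where w: "ends f = {z, w}" "w \<noteq> z" using ends_other f r(3) by blast
  then obtain j where j: "j < length xs" "w = xs ! j" using nb[OF f(1)] by (auto simp: in_set_conv_nth)
  have j0: "0 < j" using j w z by (cases j) auto
  then have es: "es \<noteq> []" using j len by auto
  have fn: "f \<notin> set es"
  proof
    assume "f \<in> set es"
    then obtain k where k: "k < length es" "f = es ! k" by (auto simp: in_set_conv_nth)
    have "k \<noteq> 0" using f(3) es k(2) by (cases k) auto
    have "z \<in> {xs ! k, xs ! Suc k}" using k f(2) path by (auto simp: is_path_def)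
    then show False using z(2) k(1) len \<open>k \<noteq> 0\<close> by (auto simp: nth_eq_iff_index_eq)
  qed
  define ys where "ys = take (Suc j) xs"
  define fs where "fs = take j es @ [f]"
  have q: "is_path A ys (take j es)" "hd ys = z" "last ys = w"
    using path_take[OF path j(1)] j(2) by (auto simp: ys_def z_def)
  have ly: "length ys = Suc j" using j by (simp add: ys_def)
  have lt: "length (take j es) = j" using j len by simp
  have "cyc ys fs"
    unfolding cyc_def
  proof (intro conjI allI impI)
    show "ys \<noteq> []" using ly by auto
    show "length ys = length fs" using ly lt by (simp add: fs_def)
    show "distinct ys" using q(1) by (simp add: is_path_def)
    show "distinct fs" using path_distinct_edges[OF q(1)] fn by (auto simp: fs_def dest: in_set_takeD)
    show "set fs \<subseteq> E" using q(1) f(1) r(3) by (auto simp: fs_def is_path_def)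
    fix i assume i: "i < length ys"
    show "ends (fs ! i) = {ys ! i, ys ! (Suc i mod length ys)}"
    proof (cases "i < j")
      case True
      then have "ends (take j es ! i) = {ys ! i, ys ! Suc i}" using q(1) lt by (simp add: is_path_def)
      then show ?thesis using True ly lt by (simp add: fs_def nth_append)
    next
      case False
      then have "i = j" using i ly by simp
      moreover have "ys ! 0 = z" "ys ! j = w" using j z by (auto simp: ys_def)
      ultimately show ?thesis using w(1) ly lt by (simp add: fs_def nth_append insert_commute)
    qed
  qed
  moreover from this have "ring (set ys) (set fs)" by (rule ring_cyc)
  moreover have "set ys \<subseteq> S" using xsS set_take_subset[of "Suc j" xs] by (auto simp: ys_def)
  moreover have "set fs \<subseteq> A" using q(1) f(1) by (auto simp: fs_def is_path_def)
  ultimately show thesis using that ring_closed[OF assms] by blast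
qed

end

section \<open>Barbells joining unbalanced circuits\<close>

text \<open>Balance is handled from here on through products of signs, because these multiply under
  symmetric differences.\<close>

lemma prod_sign:
  fixes f :: "'a \<Rightarrow> int"
  assumes "finite A" "\<And>x. x \<in> A \<Longrightarrow> f x \<in> {1, -1}"
  shows "prod f A = (if even (card {x \<in> A. f x = -1}) then 1 else -1)"
  using assms
proof (induction A rule: finite_induct)
  case (insert a A)
  have "{x \<in> insert a A. f x = -1}
      = (if f a = -1 then insert a {x \<in> A. f x = -1} else {x \<in> A. f x = -1})"
    by auto
  then show ?case using insert by auto
qed simp

lemma prod_sign_cases:
  fixes f :: "'a \<Rightarrow> int"
  assumes "finite A" "\<And>x. x \<in> A \<Longrightarrow> f x \<in> {1, -1}"
  shows "prod f A = 1 \<or> prod f A = -1"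
  using prod_sign[OF assms] by simp

locale signed_loopless = loopless_graph G for G :: "('v, 'e) pre_digraph" +
  fixes \<sigma> :: "'e \<Rightarrow> int"
  assumes sig: "e \<in> arcs G \<Longrightarrow> \<sigma> e \<in> {1, -1}"
begin

lemma fin_sub: "A \<subseteq> E \<Longrightarrow> finite A"
  using finite_subset[of A E] by simp

lemma prod_sig:
  assumes "A \<subseteq> E"
  shows "prod \<sigma> A = (if even (card {e \<in> A. \<sigma> e = -1}) then 1 else -1)"
  using assms sig by (intro prod_sign fin_sub) auto

lemma prod_sig_cases: "A \<subseteq> E \<Longrightarrow> prod \<sigma> A = 1 \<or> prod \<sigma> A = -1"
  by (simp add: prod_sig)

text \<open>The sign-circuits may use edges outside A, and k only bounds their length, so covers of
  different pieces of E can be added up.\<close>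

definition coverable :: "'e set \<Rightarrow> nat \<Rightarrow> bool" where
  "coverable A k \<longleftrightarrow> (\<exists>F. (\<forall>C \<in># F. sign_circuit G \<sigma> C) \<and>
     (\<forall>e \<in> A. \<exists>C \<in># F. e \<in> arcs C) \<and> cover_length F \<le> k)"

lemma coverable_mono: "coverable A k \<Longrightarrow> B \<subseteq> A \<Longrightarrow> k \<le> l \<Longrightarrow> coverable B l"
  unfolding coverable_def by (meson le_trans subsetD)

lemma coverable_empty: "coverable {} k"
  unfolding coverable_def by (rule exI[of _ "{#}"]) (simp add: cover_length_def)

lemma coverable_Un:
  assumes "coverable A k" "coverable B l"
  shows "coverable (A \<union> B) (k + l)"
proof -
  obtain F where F: "\<forall>C \<in># F. sign_circuit G \<sigma> C" "\<forall>e \<in> A. \<exists>C \<in># F. e \<in> arcs C"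
    "cover_length F \<le> k"
    using assms(1) by (auto simp: coverable_def)
  obtain F' where F': "\<forall>C \<in># F'. sign_circuit G \<sigma> C" "\<forall>e \<in> B. \<exists>C \<in># F'. e \<in> arcs C"
    "cover_length F' \<le> l"
    using assms(2) by (auto simp: coverable_def)
  show ?thesis unfolding coverable_def
    by (rule exI[of _ "F + F'"]) (use F F' in \<open>fastforce simp: cover_length_def\<close>)
qed

lemma coverable_UN:
  assumes "finite I" "\<And>i. i \<in> I \<Longrightarrow> coverable (f i) (k i)"
  shows "coverable (\<Union>i\<in>I. f i) (\<Sum>i\<in>I. k i)"
  using assms by (induction I rule: finite_induct) (auto intro: coverable_empty coverable_Un)

lemma coverable_single:
  assumes "sign_circuit G \<sigma> C" "A \<subseteq> arcs C" "card (arcs C) \<le> k"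
  shows "coverable A k"
  unfolding coverable_def
  by (rule exI[of _ "{#C#}"]) (use assms in \<open>auto simp: cover_length_def\<close>)

lemma coverable_ring:
  assumes "ring S A" "prod \<sigma> A = 1"
  shows "coverable A (card A)"
proof (rule coverable_single[of "sub S A"])
  note r = ringD[OF assms(1)]
  have "even (card {e \<in> A. \<sigma> e = -1})" using prod_sig[OF r(3)] assms(2) by presburger
  then have "balanced_circuit (sub S A) \<sigma>"
    using circuit_sub[OF assms(1)] by (simp add: balanced_circuit_def)
  then show "sign_circuit G \<sigma> (sub S A)"
    using subgraph_sub_G[OF r(2,3,6)] by (simp add: sign_circuit_def)
qed auto

lemma unbalanced_sub:
  assumes "ring S A" "prod \<sigma> A = -1"
  shows "unbalanced_circuit (sub S A) \<sigma>"
proof -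
  have "odd (card {e \<in> A. \<sigma> e = -1})"
    using prod_sig[OF ringD(3)[OF assms(1)]] assms(2) by presburger
  then show ?thesis using circuit_sub[OF assms(1)] by (simp add: unbalanced_circuit_def)
qed

text \<open>Disjointness of the two circuits makes the barbell long. In a cubic graph there are no
  short ones, as the shared vertex would have degree 4.\<close>

lemma coverable_barbell:
  assumes r: "ring S A" "prod \<sigma> A = -1" "ring S' A'" "prod \<sigma> A' = -1" "S \<inter> S' = {}"
    and p: "is_path E xs es" "set xs \<inter> S = {hd xs}" "set xs \<inter> S' = {last xs}"
  shows "coverable (A \<union> A') (card A + card A' + length es)"
proof (rule coverable_single)
  note r1 = ringD[OF r(1)] and r2 = ringD[OF r(3)]
  let ?S = "S \<union> S' \<union> set xs" and ?A = "A \<union> A' \<union> set es"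
  let ?B = "sub ?S ?A"
  have xsV: "set xs \<subseteq> V" using path_in_V[OF p(1)] p(2) r1(2) by blast
  have esE: "set es \<subseteq> E" using p(1) by (simp add: is_path_def)
  have eA: "ends e \<subseteq> ?S" if "e \<in> ?A" for e
    using that r1(6) r2(6) path_ends_subset[OF p(1)] by blast
  have SV: "?S \<subseteq> V" and AE: "?A \<subseteq> E" using r1 r2 xsV esE by auto
  have "hd xs \<noteq> last xs" using p r(5) by blast
  have "path_graph (sub (set xs) (set es)) (hd xs) (last xs)"
    unfolding path_graph_def
    by (rule exI[of _ xs], rule exI[of _ es]) (use p(1) in \<open>auto simp: is_path_def ends_def\<close>)
  moreover have "subgraph (sub S A) ?B"
    by (rule subgraph_sub[OF _ _ SV AE r1(6) eA]) auto
  moreover have "subgraph (sub S' A') ?B"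
    by (rule subgraph_sub[OF _ _ SV AE r2(6) eA]) auto
  moreover have "subgraph (sub (set xs) (set es)) ?B"
    by (rule subgraph_sub[OF _ _ SV AE path_ends_subset[OF p(1)] eA]) auto
  moreover have "sub S A \<noteq> sub S' A'"
    using r(5) r1(1) by (metis Int_absorb sub_simps(1))
  moreover have "verts (sub (set xs) (set es)) \<inter> verts (sub S A) = {hd xs}"
    "verts (sub (set xs) (set es)) \<inter> verts (sub S' A') = {last xs}"
    "verts (sub S A) \<inter> verts (sub S' A') = (if hd xs = last xs then {hd xs} else {})"
    using p(2,3) r(5) \<open>hd xs \<noteq> last xs\<close> by simp_all
  moreover have "verts ?B = verts (sub S A) \<union> verts (sub S' A') \<union> verts (sub (set xs) (set es))"
    "arcs ?B = arcs (sub S A) \<union> arcs (sub S' A') \<union> arcs (sub (set xs) (set es))" by simp_all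
  ultimately have "barbell ?B \<sigma>"
    unfolding barbell_def
    using unbalanced_sub[OF r(1,2)] unbalanced_sub[OF r(3,4)] by blast
  then show "sign_circuit G \<sigma> ?B"
    using subgraph_sub_G[OF SV AE eA] by (simp add: sign_circuit_def)
  have "card ?A \<le> card A + card A' + card (set es)"
    by (meson card_Un_le add_le_mono1 le_trans)
  then show "card (arcs ?B) \<le> card A + card A' + length es"
    using path_card(1)[OF p(1)] by simp
qed auto

text \<open>
  An edge set J whose odd vertices are exactly one vertex on each of the given unbalanced circuits
  contains edge-disjoint paths that join these circuits in pairs.
\<close>

lemma coverable_unbalanced_rings:
  assumes "finite \<U>" "\<And>S. S \<in> \<U> \<Longrightarrow> ring S (A S)" "\<And>S. S \<in> \<U> \<Longrightarrow> prod \<sigma> (A S) = -1"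
    "\<And>S S'. S \<in> \<U> \<Longrightarrow> S' \<in> \<U> \<Longrightarrow> S \<noteq> S' \<Longrightarrow> S \<inter> S' = {}" "\<And>S. S \<in> \<U> \<Longrightarrow> t S \<in> S"
    "J \<subseteq> E" "\<And>v. bdG J v \<longleftrightarrow> v \<in> t ` \<U>"
  shows "coverable (\<Union>S\<in>\<U>. A S) ((\<Sum>S\<in>\<U>. card (A S)) + card J)"
  using assms
proof (induction \<U> arbitrary: J rule: finite_psubset_induct)
  case (psubset \<U>)
  note rg = psubset.prems(1) and un = psubset.prems(2) and dj = psubset.prems(3)
    and t = psubset.prems(4) and J = psubset.prems(5) and bdJ = psubset.prems(6)
  show ?case
  proof (cases "\<U> = {}")
    case True
    then show ?thesis by (simp add: coverable_empty)
  next
    case False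
    then obtain S where S: "S \<in> \<U>" by blast
    have fJ: "finite J" using J by (rule fin_sub)
    define K where "K = {v. (t S, v) \<in> (adj J)\<^sup>*}"
    have tV: "t S \<in> V" using t[OF S] ringD(2)[OF rg[OF S]] by blast
    have KV: "K \<subseteq> V"
    proof
      fix v assume "v \<in> K"
      then show "v \<in> V" using adj_rtrancl_in[of "t S" v J V] tV J ends_in_V by (auto simp: K_def)
    qed
    then have fK: "finite K" using finite_subset finite_verts by blast
    have cl: "v \<in> K \<longleftrightarrow> w \<in> K" if "e \<in> J" "v \<in> ends e" "w \<in> ends e" for e v w
      using ends_adj[OF that] ends_adj[OF that(1,3,2)] by (auto simp: K_def intro: rtrancl_trans)
    have "{e \<in> J. (tail G e \<in> K) \<noteq> (head G e \<in> K)} = {}"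
      using cl by (auto simp: ends_def)
    \<comment> \<open>No edge of J leaves K, so the boundary inside K is even and \<open>t S\<close>
      has a partner there.\<close>
    then have ev: "even (card {v \<in> K. bdG J v})"
      using odd_card_bd[OF fJ fK, of "tail G" "head G"] by (metis card.empty even_zero)
    have tK: "t S \<in> {v \<in> K. bdG J v}" using S bdJ by (auto simp: K_def)
    obtain t' where t': "t' \<in> K" "bdG J t'" "t' \<noteq> t S"
    proof -
      have "{v \<in> K. bdG J v} \<noteq> {t S}" using ev by (metis One_nat_def card.empty card.insert
            empty_iff finite.emptyI odd_one)
      then show thesis using that tK by blast
    qed
    then obtain S' where S': "S' \<in> \<U>" "t' = t S'" using bdJ by blast
    have SS': "S \<noteq> S'" using t' S' by blast
    obtain xs es where p: "is_path J xs es" "hd xs = t S" "last xs = t'"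
      using path_exists[of "t S" t' J] t'(1) by (auto simp: K_def)
    have pE: "is_path E xs es" using path_mono[OF p(1) J] .
    obtain ys fs where q: "is_path E ys fs" "set fs \<subseteq> set es"
      "set ys \<inter> S = {hd ys}" "set ys \<inter> S' = {last ys}"
      using path_between_sets[OF pE, of S S'] p t[OF S] t[OF S'(1)] S'(2) by metis
    have c1: "coverable (A S \<union> A S') (card (A S) + card (A S') + length fs)"
      using coverable_barbell[OF rg[OF S] un[OF S] rg[OF S'(1)] un[OF S'(1)] _ q(1,3,4)]
        dj[OF S S'(1) SS'] by blast
    have lfs: "length fs \<le> card (set es)"
      using path_card(1)[OF q(1)] card_mono[OF _ q(2)] by simp
    define \<U>' where "\<U>' = \<U> - {S, S'}"
    \<comment> \<open>The barbell uses only the trimmed path, but the whole path is removed from J: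
      this takes exactly \<open>t S\<close> and \<open>t S'\<close> off the boundary.\<close>
    define J' where "J' = J - set es"
    have esJ: "set es \<subseteq> J" using p(1) by (simp add: is_path_def)
    have bdJ': "bdG J' v \<longleftrightarrow> v \<in> t ` \<U>'" for v
    proof -
      have "J' = sym_diff J (set es)" using esJ by (auto simp: J'_def)
      then have 1: "bdG J' v \<longleftrightarrow> bdG J v \<noteq> bdG (set es) v"
        using bd_sym_diff[OF fJ, of "set es"] by simp
      have 2: "bdG (set es) v \<longleftrightarrow> (t S = v) \<noteq> (t S' = v)"
        using bdG_path[OF pE order_refl] p(2,3) S'(2) by simp
      have 3: "t S \<in> t ` \<U>" "t S' \<in> t ` \<U>" "t S \<noteq> t S'" using S S' t'(3) by simp_all
      have "t S1 \<noteq> t S2" if "S1 \<in> \<U>" "S2 \<in> \<U>" "S1 \<noteq> S2" for S1 S2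
      proof
        assume "t S1 = t S2"
        then have "t S1 \<in> S1 \<inter> S2" using t[OF that(1)] t[OF that(2)] by simp
        then show False using dj[OF that] by simp
      qed
      then have "inj_on t \<U>" by (intro inj_onI) blast
      then have "t ` \<U>' = t ` \<U> - t ` {S, S'}"
        unfolding \<U>'_def using S S'(1) by (intro inj_on_image_set_diff) auto
      then have "v \<in> t ` \<U>' \<longleftrightarrow> v \<in> t ` \<U> \<and> v \<noteq> t S \<and> v \<noteq> t S'" by blast
      then show ?thesis using 1 2 3 bdJ[of v] by metis
    qed
    have sub: "\<U>' \<subset> \<U>" using S by (auto simp: \<U>'_def)
    have c2: "coverable (\<Union>S\<in>\<U>'. A S) ((\<Sum>S\<in>\<U>'. card (A S)) + card J')"
    proof (rule psubset.IH[OF sub _ _ _ _ _ bdJ'])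
      show "J' \<subseteq> E" using J by (auto simp: J'_def)
    qed (use sub rg un dj t in \<open>simp_all add: psubset_eq subset_iff\<close>)
    have U: "\<U> = insert S (insert S' \<U>')" "S \<notin> insert S' \<U>'" "S' \<notin> \<U>'"
      using S S'(1) SS' by (auto simp: \<U>'_def)
    have fU': "finite \<U>'" using psubset.hyps by (auto simp: \<U>'_def)
    have "card J = card J' + card (set es)"
      using esJ fJ card_mono[OF fJ esJ] by (simp add: J'_def card_Diff_subset)
    moreover have "(\<Sum>S\<in>\<U>. card (A S)) = card (A S) + card (A S') + (\<Sum>S\<in>\<U>'. card (A S))"
      using U fU' by (subst U(1)) simp
    moreover have "(\<Union>S\<in>\<U>. A S) = A S \<union> A S' \<union> (\<Union>S\<in>\<U>'. A S)"
      by (subst U(1)) auto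
    ultimately show ?thesis
      using coverable_mono[OF coverable_Un[OF c1 c2] order_refl] lfs by simp
  qed
qed

end

section \<open>2-factors with an even number of unbalanced circuits\<close>

context loopless_graph
begin

definition comp :: "'e set \<Rightarrow> 'v \<Rightarrow> 'v set" where
  "comp A v = {w. (v, w) \<in> (adj A)\<^sup>*}"

definition comps :: "'e set \<Rightarrow> 'v set set" where
  "comps A = comp A ` V"

definition inside :: "'e set \<Rightarrow> 'v set \<Rightarrow> 'e set" where
  "inside A S = {e \<in> A. ends e \<subseteq> S}"

lemma comp_self [simp]: "v \<in> comp A v"
  by (simp add: comp_def)

lemma comp_eq: "w \<in> comp A v \<Longrightarrow> comp A w = comp A v"
  unfolding comp_def using adj_rtrancl_sym[of v w A] by (auto intro: rtrancl_trans)

lemma comp_eq_iff: "comp A v = comp A w \<longleftrightarrow> w \<in> comp A v"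
  using comp_eq by auto

lemma comp_edge: "e \<in> A \<Longrightarrow> v \<in> ends e \<Longrightarrow> ends e \<subseteq> comp A v"
  using ends_adj[of e A v] by (auto simp: comp_def)

lemma comp_edge_eq: "e \<in> A \<Longrightarrow> v \<in> ends e \<Longrightarrow> w \<in> ends e \<Longrightarrow> comp A v = comp A w"
  using comp_edge[of e A v] by (auto simp: comp_eq_iff)

lemma comp_in_V: "A \<subseteq> E \<Longrightarrow> v \<in> V \<Longrightarrow> comp A v \<subseteq> V"
  using adj_rtrancl_in[of v _ A V] ends_in_V by (auto simp: comp_def)

lemma finite_comps [simp]: "finite (comps A)"
  by (simp add: comps_def)

lemma comps_subset: "A \<subseteq> E \<Longrightarrow> S \<in> comps A \<Longrightarrow> S \<subseteq> V"
  using comp_in_V by (auto simp: comps_def)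

lemma comps_nonempty: "S \<in> comps A \<Longrightarrow> S \<noteq> {}"
  unfolding comps_def by (metis comp_self empty_iff imageE)

lemma comps_eq_comp: "S \<in> comps A \<Longrightarrow> v \<in> S \<Longrightarrow> S = comp A v"
  using comp_eq by (auto simp: comps_def)

lemma comp_in_comps: "v \<in> V \<Longrightarrow> comp A v \<in> comps A"
  by (simp add: comps_def)

lemma comps_disjoint: "S \<in> comps A \<Longrightarrow> S' \<in> comps A \<Longrightarrow> S \<noteq> S' \<Longrightarrow> S \<inter> S' = {}"
  using comps_eq_comp by blast

lemma inside_subset: "inside A S \<subseteq> A"
  by (auto simp: inside_def)

lemma inside_ends: "e \<in> inside A S \<Longrightarrow> ends e \<subseteq> S"
  by (simp add: inside_def)

lemma comps_edge: "S \<in> comps A \<Longrightarrow> e \<in> A \<Longrightarrow> ends e \<inter> S \<noteq> {} \<Longrightarrow> ends e \<subseteq> S"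
  using comps_eq_comp comp_edge by blast

lemma UN_inside: "A \<subseteq> E \<Longrightarrow> (\<Union>S\<in>comps A. inside A S) = A"
proof (intro equalityI subsetI)
  fix e assume A: "A \<subseteq> E" "e \<in> A"
  then have "tail G e \<in> V" "ends e \<subseteq> comp A (tail G e)"
    using comp_edge[of e A "tail G e"] by (auto simp: ends_def)
  then show "e \<in> (\<Union>S\<in>comps A. inside A S)"
    using A by (auto simp: inside_def intro!: bexI[OF _ comp_in_comps])
qed (auto simp: inside_def)

lemma inside_disjoint:
  assumes "S \<in> comps A" "S' \<in> comps A" "S \<noteq> S'"
  shows "inside A S \<inter> inside A S' = {}"
  using comps_disjoint[OF assms] by (auto simp: inside_def ends_def)

lemma deg_inside:
  assumes "S \<in> comps A" "v \<in> S"
  shows "{e \<in> inside A S. v \<in> ends e} = {e \<in> A. v \<in> ends e}"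
  using comps_edge[OF assms(1)] assms(2) by (auto simp: inside_def)

lemma comps_connected:
  assumes "S \<in> comps A" "x \<in> S" "y \<in> S"
  shows "(x, y) \<in> (adj (inside A S))\<^sup>*"
proof -
  have "(x, y) \<in> (adj A)\<^sup>*" using comps_eq_comp[OF assms(1,2)] assms(3) by (simp add: comp_def)
  then have "y \<in> S \<and> (x, y) \<in> (adj (inside A S))\<^sup>*"
  proof (induction rule: rtrancl_induct)
    case base
    then show ?case using assms(2) by simp
  next
    case (step y z)
    then obtain e where e: "e \<in> A" "ends e = {y, z}" by (auto simp: adj_def)
    then have "ends e \<subseteq> S" using comps_edge[OF assms(1) e(1)] step by auto
    then have "(y, z) \<in> adj (inside A S)" using e by (auto simp: inside_def adj_def)
    then show ?case using step e \<open>ends e \<subseteq> S\<close> by (auto intro: rtrancl_into_rtrancl)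
  qed
  then show ?thesis by simp
qed

definition two_factor :: "'e set \<Rightarrow> bool" where
  "two_factor A \<longleftrightarrow> A \<subseteq> E \<and> (\<forall>v \<in> V. deg A v = 2)"

lemma two_factor_ring:
  assumes "two_factor A" "S \<in> comps A"
  shows "ring S (inside A S)"
proof -
  have A: "A \<subseteq> E" using assms(1) by (simp add: two_factor_def)
  have SV: "S \<subseteq> V" using comps_subset[OF A assms(2)] .
  have "deg (inside A S) v = 2" if "v \<in> S" for v
    using deg_inside[OF assms(2) that] assms(1) SV that by (auto simp: deg_def two_factor_def)
  then show ?thesis
    unfolding ring_def using comps_nonempty[OF assms(2)] SV A inside_subset inside_ends
      comps_connected[OF assms(2)] by blast
qed

lemma two_factor_card:
  assumes "two_factor A"
  shows "card A = card V"
proof -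
  have "A \<subseteq> E" "\<forall>v\<in>V. deg A v = 2" using assms by (auto simp: two_factor_def)
  moreover from this have "(\<Sum>v\<in>V. deg A v) = 2 * card A"
    using ends_in_V by (intro sum_deg) auto
  ultimately show ?thesis by simp
qed

lemma card_inside:
  assumes "A \<subseteq> E" "f \<subseteq> comps A"
  shows "card (\<Union>S\<in>f. inside A S) = (\<Sum>S\<in>f. card (inside A S))"
proof (rule card_UN_disjoint)
  show "\<forall>i\<in>f. finite (inside A i)"
    using finite_subset[OF subset_trans[OF inside_subset assms(1)]] by simp
  show "\<forall>i\<in>f. \<forall>j\<in>f. i \<noteq> j \<longrightarrow> inside A i \<inter> inside A j = {}"
    using inside_disjoint assms(2) by blast
qed (rule finite_subset[OF assms(2) finite_comps])

end

context signed_loopless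
begin

lemma prod_inside:
  assumes "A \<subseteq> E"
  shows "prod \<sigma> A = (\<Prod>S\<in>comps A. prod \<sigma> (inside A S))"
proof -
  have "prod \<sigma> (\<Union>S\<in>comps A. inside A S) = (\<Prod>S\<in>comps A. prod \<sigma> (inside A S))"
  proof (rule prod.UNION_disjoint)
    show "\<forall>i\<in>comps A. finite (inside A i)"
      using fin_sub[OF subset_trans[OF inside_subset assms]] by blast
    show "\<forall>i\<in>comps A. \<forall>j\<in>comps A. i \<noteq> j \<longrightarrow> inside A i \<inter> inside A j = {}"
      using inside_disjoint by blast
  qed simp
  then show ?thesis by (simp add: UN_inside[OF assms])
qed

definition unbal :: "'e set \<Rightarrow> 'v set set" where
  "unbal A = {S \<in> comps A. prod \<sigma> (inside A S) = -1}"

text \<open>The sign of A is the product of the signs of its components, and exactly the unbalanced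
  ones contribute -1.\<close>

lemma unbal_card:
  assumes "A \<subseteq> E"
  shows "even (card (unbal A)) \<longleftrightarrow> prod \<sigma> A = 1"
proof -
  have "prod \<sigma> A = (if even (card (unbal A)) then 1 else -1)"
    unfolding prod_inside[OF assms] unbal_def
  proof (rule prod_sign)
    fix S
    show "prod \<sigma> (inside A S) \<in> {1, -1}"
      using prod_sig_cases[OF subset_trans[OF inside_subset assms]] by blast
  qed simp
  then show ?thesis by simp
qed

lemma coverable_balanced:
  assumes "two_factor A" "f \<subseteq> comps A" "f \<inter> unbal A = {}"
  shows "coverable (\<Union>S\<in>f. inside A S) (\<Sum>S\<in>f. card (inside A S))"
proof (rule coverable_UN)
  have A: "A \<subseteq> E" using assms(1) by (simp add: two_factor_def)
  fix S assume S: "S \<in> f"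
  then have "prod \<sigma> (inside A S) = 1"
    using assms(2,3) prod_sig_cases[OF subset_trans[OF inside_subset A]] by (auto simp: unbal_def)
  then show "coverable (inside A S) (card (inside A S))"
    using coverable_ring two_factor_ring[OF assms(1)] S assms(2) by blast
qed (rule finite_subset[OF assms(2) finite_comps])

lemma coverable_two_factor_balanced:
  assumes "two_factor A" "unbal A = {}"
  shows "coverable A (card V)"
proof -
  have A: "A \<subseteq> E" using assms(1) by (simp add: two_factor_def)
  show ?thesis
    using coverable_balanced[OF assms(1) order_refl] assms(2) card_inside[OF A order_refl]
      UN_inside[OF A] two_factor_card[OF assms(1)] by simp
qed

text \<open>
  Contract the circuits of the 2-factor A and take a join F of the unbalanced ones with fewer edges
  than there are circuits. On each circuit C the edges of F can be linked up using at most half of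
  the edges of C.
\<close>

lemma coverable_even_two_factor:
  assumes tf: "two_factor A" and ev: "prod \<sigma> A = 1"
    and conn: "\<And>x y. x \<in> V \<Longrightarrow> y \<in> V \<Longrightarrow> (x, y) \<in> (adj E)\<^sup>*" and ne: "V \<noteq> {}"
  obtains k where "coverable A k" "2 * k + 2 \<le> 3 * card V + 2 * card (comps A)"
proof -
  have A: "A \<subseteq> E" using tf by (simp add: two_factor_def)
  let ?X = "comps A" and ?B = "inside A"
  note rg = two_factor_ring[OF tf]
  have SV: "S \<subseteq> V" if "S \<in> ?X" for S using comps_subset[OF A that] .
  have fS: "finite S" if "S \<in> ?X" for S
    using finite_subset[OF SV[OF that]] by simp
  define T where "T = unbal A"
  have TX: "T \<subseteq> ?X" by (auto simp: T_def unbal_def)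
  have "even (card T)" unfolding T_def using unbal_card[OF A] ev by simp
  obtain r where r: "r \<in> V" using ne by blast
  \<comment> \<open>Ends in the graph obtained by contracting every component of A to a
    vertex.\<close>
  define p where "p e = comp A (tail G e)" for e
  define q where "q e = comp A (head G e)" for e
  have "\<exists>F\<subseteq>E. card F < card ?X \<and> (\<forall>S. bd p q F S \<longleftrightarrow> S \<in> T)"
  proof (rule T_join_exists[OF finite_comps comp_in_comps[OF r] finite_arcs _ TX \<open>even (card T)\<close>])
    fix \<S> assume \<S>: "comp A r \<in> \<S>" "\<S> \<subset> ?X"
    then obtain v where v: "v \<in> V" "comp A v \<notin> \<S>" by (auto simp: comps_def)
    let ?U = "{v. comp A v \<in> \<S>}"
    obtain a b where ab: "(a, b) \<in> adj E" "a \<in> ?U" "b \<notin> ?U"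
      using rtrancl_crossing[OF conn[OF r v(1)], of ?U] \<S>(1) v(2) by blast
    then obtain e where e: "e \<in> E" "ends e = {a, b}" by (auto simp: adj_def)
    then have "b \<in> V" using ends_in_V by blast
    then have "comp A b \<in> ?X - \<S>" "comp A a \<in> \<S>" using ab by (auto simp: comps_def)
    then show "\<exists>e\<in>E. p e \<in> \<S> \<and> q e \<in> ?X - \<S> \<or> q e \<in> \<S> \<and> p e \<in> ?X - \<S>"
      using e by (intro bexI[of _ e]) (auto simp: p_def q_def ends_def doubleton_eq_iff)
  qed
  then obtain F where F: "F \<subseteq> E" "card F < card ?X" "\<forall>S. bd p q F S \<longleftrightarrow> S \<in> T" by blast
  have fF: "finite F" using F(1) by (rule fin_sub)
  define D where "D S = {v \<in> S. bdG F v}" for S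
  have oddD: "odd (card (D S)) \<longleftrightarrow> S \<in> T" if S: "S \<in> ?X" for S
  proof -
    have eqv: "comp A v = S \<longleftrightarrow> v \<in> S" for v
      using comps_eq_comp[OF S, of v] comp_self[of v A] by metis
    have "bd p q F S \<longleftrightarrow> odd (card {e \<in> F. (tail G e \<in> S) \<noteq> (head G e \<in> S)})"
      unfolding bd_def p_def q_def eqv ..
    then show ?thesis
      using odd_card_bd[OF fF fS[OF S], of "tail G" "head G"] F(3) by (simp add: D_def)
  qed
  define t where "t S = (SOME v. v \<in> S)" for S :: "'v set"
  have tS: "t S \<in> S" if "S \<in> ?X" for S
    using comps_nonempty[OF that] some_in_eq unfolding t_def by blast
  \<comment> \<open>On an unbalanced circuit an odd number of vertices has odd degree in F. Flipping
    the chosen vertex \<open>t S\<close> makes the set even and leaves \<open>t S\<close> as the one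
    odd vertex of J on S.\<close>
  define TT where "TT S = (if S \<in> T then sym_diff (D S) {t S} else D S)" for S
  have "\<exists>J. J \<subseteq> ?B S \<and> 2 * card J \<le> card (?B S) \<and> (\<forall>v\<in>S. bdG J v \<longleftrightarrow> v \<in> TT S)"
    if S: "S \<in> ?X" for S
  proof -
    have fD: "finite (D S)" using fS[OF S] by (simp add: D_def)
    have "TT S \<subseteq> S" using tS[OF S] by (auto simp: TT_def D_def)
    moreover have "even (card (TT S))"
      using oddD[OF S] odd_card_sym_diff[OF fD, of "{t S}"]
      by (cases "S \<in> T") (simp_all add: TT_def)
    ultimately show ?thesis using ring_T_join[OF rg[OF S]] by metis
  qed
  then obtain JJ where JJ: "\<And>S. S \<in> ?X \<Longrightarrow> JJ S \<subseteq> ?B S"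
    "\<And>S. S \<in> ?X \<Longrightarrow> 2 * card (JJ S) \<le> card (?B S)"
    "\<And>S v. S \<in> ?X \<Longrightarrow> v \<in> S \<Longrightarrow> bdG (JJ S) v \<longleftrightarrow> v \<in> TT S"
    by metis
  define U where "U = (\<Union>S\<in>?X. JJ S)"
  have UA: "U \<subseteq> A" using JJ(1) inside_subset by (force simp: U_def)
  have fU: "finite U" using UA A by (meson fin_sub subset_trans)
  have bU: "bdG U v \<longleftrightarrow> v \<in> TT S" if S: "S \<in> ?X" "v \<in> S" for S v
  proof -
    have "e \<in> JJ S" if e: "e \<in> U" "v \<in> ends e" for e
    proof -
      obtain S' where S': "S' \<in> ?X" "e \<in> JJ S'" using e(1) by (auto simp: U_def)
      then have "v \<in> S'" using JJ(1) inside_ends e(2) by blast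
      then have "S' = S" using comps_disjoint[OF S'(1) S(1)] S(2) by blast
      then show ?thesis using S'(2) by simp
    qed
    then have "{e \<in> U. (tail G e = v) \<noteq> (head G e = v)} = {e \<in> JJ S. (tail G e = v) \<noteq> (head G e = v)}"
      using S(1) by (fastforce simp: U_def ends_def)
    then show ?thesis using JJ(3)[OF S] by (simp add: bd_def)
  qed
  define J where "J = sym_diff F U"
  have JE: "J \<subseteq> E" using F(1) UA A by (auto simp: J_def)
  have bJ: "bdG J v \<longleftrightarrow> v \<in> t ` T" for v
  proof (cases "v \<in> V")
    case False
    then have "{e \<in> J. v \<in> ends e} = {}" using JE ends_in_V by blast
    then have "deg J v = 0" unfolding deg_def by (simp only: card.empty)
    then have "\<not> bdG J v" using bdG_deg[OF JE] by simp
    moreover have "v \<notin> t ` T" using False tS TX SV by blast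
    ultimately show ?thesis by simp
  next
    case True
    define S where "S = comp A v"
    have S: "S \<in> ?X" "v \<in> S" using True by (auto simp: S_def comps_def)
    have 1: "bdG J v \<longleftrightarrow> bdG F v \<noteq> bdG U v"
      unfolding J_def by (rule bd_sym_diff[OF fF fU])
    have 2: "v \<in> t ` T \<longleftrightarrow> S \<in> T \<and> v = t S"
    proof
      assume "v \<in> t ` T"
      then obtain S' where S': "S' \<in> T" "v = t S'" by blast
      then have "v \<in> S'" "S' \<in> ?X" using tS TX by auto
      then have "S' = S" using comps_disjoint[of S' A S] S by blast
      then show "S \<in> T \<and> v = t S" using S' by simp
    qed simp
    show ?thesis
      unfolding 1 2 bU[OF S] using S(2) by (auto simp: TT_def D_def)
  qed
  have c1: "coverable (\<Union>S\<in>T. ?B S) ((\<Sum>S\<in>T. card (?B S)) + card J)"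
  proof (rule coverable_unbalanced_rings[OF _ _ _ _ _ JE bJ])
    show "finite T" by (rule finite_subset[OF TX finite_comps])
    show "S \<inter> S' = {}" if "S \<in> T" "S' \<in> T" "S \<noteq> S'" for S S'
      using comps_disjoint that TX by blast
  qed (use rg TX tS in \<open>auto simp: T_def unbal_def\<close>)
  have c2: "coverable (\<Union>S\<in>?X - T. ?B S) (\<Sum>S\<in>?X - T. card (?B S))"
    by (rule coverable_balanced[OF tf]) (auto simp: T_def)
  have sumX: "(\<Sum>S\<in>?X. card (?B S)) = card V"
    using card_inside[OF A order_refl] UN_inside[OF A] two_factor_card[OF tf] by simp
  have "(\<Sum>S\<in>?X. card (?B S)) = (\<Sum>S\<in>?X - T. card (?B S)) + (\<Sum>S\<in>T. card (?B S))"
    by (rule sum.subset_diff[OF TX]) simp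
  moreover have "A = (\<Union>S\<in>T. ?B S) \<union> (\<Union>S\<in>?X - T. ?B S)"
  proof -
    have "A = (\<Union>S\<in>T \<union> (?X - T). ?B S)" using UN_inside[OF A] TX by (simp add: Un_absorb1)
    then show ?thesis by (simp only: UN_Un)
  qed
  ultimately have c: "coverable A (card V + card J)"
    using coverable_mono[OF coverable_Un[OF c1 c2], of A] sumX by simp
  \<comment> \<open>The cover costs n + |J|, and |J| is at most |F| + |U|, where |F| is smaller than
    the number of circuits and |U| is at most n/2.\<close>
  have "2 * card U \<le> (\<Sum>S\<in>?X. 2 * card (JJ S))"
    using card_UN_le[OF finite_comps, of JJ A] by (simp add: U_def sum_distrib_left[symmetric])
  also have "\<dots> \<le> (\<Sum>S\<in>?X. card (?B S))"
    using JJ(2) by (rule sum_mono)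
  finally have "2 * card U \<le> card V" using sumX by simp
  moreover have "card J \<le> card F + card U" unfolding J_def by (rule card_sym_diff_le[OF fF fU])
  ultimately show thesis using that[OF c] F(2) by simp
qed

end

section \<open>3-edge-colourings\<close>

locale cubic_signed = signed_loopless G \<sigma> for G :: "('v, 'e) pre_digraph" and \<sigma> +
  assumes deg_3: "v \<in> verts G \<Longrightarrow> deg (arcs G) v = 3"
    and conn: "x \<in> verts G \<Longrightarrow> y \<in> verts G \<Longrightarrow> (x, y) \<in> (adj (arcs G))\<^sup>*"
    and nonempty: "verts G \<noteq> {}"
begin

abbreviation "n \<equiv> card V"

lemma card_E: "2 * card E = 3 * n"
  using sum_deg[of E V] deg_3 ends_in_V by simp

text \<open>In a cubic graph a proper colouring shows every colour exactly once at each vertex. In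
  this form a Kempe switch just permutes the colours at a vertex.\<close>

definition tricoloring :: "('e \<Rightarrow> nat) \<Rightarrow> bool" where
  "tricoloring c \<longleftrightarrow> (\<forall>e \<in> E. c e < 3) \<and>
     (\<forall>v \<in> V. \<forall>i < 3. card {e \<in> E. v \<in> ends e \<and> c e = i} = 1)"

text \<open>A pair of colours is named by the third colour.\<close>

definition pair_class :: "('e \<Rightarrow> nat) \<Rightarrow> nat \<Rightarrow> 'e set" where
  "pair_class c k = {e \<in> E. c e \<noteq> k}"

lemma pair_class_subset: "pair_class c k \<subseteq> E"
  by (auto simp: pair_class_def)

lemma two_factor_pair_class:
  assumes "tricoloring c" "k < 3"
  shows "two_factor (pair_class c k)"
  unfolding two_factor_def
proof (intro conjI ballI)
  fix v assume v: "v \<in> V"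
  have "{e \<in> E. v \<in> ends e} = {e \<in> pair_class c k. v \<in> ends e} \<union> {e \<in> E. v \<in> ends e \<and> c e = k}"
    by (auto simp: pair_class_def)
  moreover have "card \<dots> = deg (pair_class c k) v + card {e \<in> E. v \<in> ends e \<and> c e = k}"
    unfolding deg_def using fin_sub[OF pair_class_subset[of c k]]
    by (intro card_Un_disjoint) (auto simp: pair_class_def)
  moreover have "card {e \<in> E. v \<in> ends e \<and> c e = k} = 1"
    using assms v by (auto simp: tricoloring_def)
  ultimately show "deg (pair_class c k) v = 2" using deg_3[OF v] by (simp add: deg_def)
qed (rule pair_class_subset)

lemma color_edge:
  assumes "tricoloring c" "v \<in> V" "i < 3"
  obtains e where "e \<in> E" "v \<in> ends e" "c e = i" "\<And>e'. e' \<in> E \<Longrightarrow> v \<in> ends e' \<Longrightarrow> c e' = i \<Longrightarrow> e' = e"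
proof -
  have "card {e \<in> E. v \<in> ends e \<and> c e = i} = 1" using assms by (auto simp: tricoloring_def)
  then obtain e where "{e \<in> E. v \<in> ends e \<and> c e = i} = {e}" by (auto simp: card_1_singleton_iff)
  then show thesis using that[of e] by blast
qed

text \<open>
  The circuits of the three pairs of colours are the faces of an embedding of G in a closed surface,
  and this is the inequality V - E + F <= 2. Up to one redundant face, sums of faces are pairwise
  distinct cycles, and adding joins of vertex sets to them gives distinct edge sets.
\<close>

lemma card_faces:
  assumes c: "tricoloring c"
  shows "2 * (\<Sum>k<3. card (comps (pair_class c k))) \<le> n + 4"
proof -
  let ?A = "pair_class c"
  obtain r where r: "r \<in> V" using nonempty by blast
  define \<F> where "\<F> = Sigma {..<3::nat} (\<lambda>k. comps (?A k))"
  have fF: "finite \<F>" by (auto simp: \<F>_def)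
  have cardF: "card \<F> = (\<Sum>k<3. card (comps (?A k)))" unfolding \<F>_def by (rule card_SigmaI) auto
  \<comment> \<open>The redundant face: a set of faces and its complement have the same sum, so only
    sets without \<open>f0\<close> are used.\<close>
  define f0 where "f0 = (0::nat, comp (?A 0) r)"
  have f0: "f0 \<in> \<F>" using r by (auto simp: f0_def \<F>_def comps_def)
  define face where "face I k v \<longleftrightarrow> (k, comp (?A k) v) \<in> I" for I k v
  have face_edge: "face I k v = face I k w" if "e \<in> E" "v \<in> ends e" "w \<in> ends e" "k \<noteq> c e" for I k v w e
    using comp_edge_eq[of e "?A k" v w] that by (simp add: face_def pair_class_def)
  have mod3: "(0 + 1) mod 3 = (1::nat)" "(0 + 2) mod 3 = (2::nat)" "(1 + 1) mod 3 = (2::nat)"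
    "(1 + 2) mod 3 = (0::nat)" "(2 + 1) mod 3 = (0::nat)" "(2 + 2) mod 3 = (1::nat)" by simp_all
  \<comment> \<open>The sum of the faces in I modulo 2: an edge lies on the two faces named by the
    colours other than its own, and survives iff exactly one of them is in I.\<close>
  define X where "X I = {e \<in> E. face I ((c e + 1) mod 3) (tail G e) \<noteq> face I ((c e + 2) mod 3) (tail G e)}" for I
  have memX: "e \<in> X I \<longleftrightarrow> face I ((c e + 1) mod 3) v \<noteq> face I ((c e + 2) mod 3) v"
    if e: "e \<in> E" "v \<in> ends e" for e v I
  proof -
    have "c e < 3" using c e(1) by (simp add: tricoloring_def)
    then have "(c e + 1) mod 3 \<noteq> c e" "(c e + 2) mod 3 \<noteq> c e" by (auto simp: mod_if)
    moreover have "tail G e \<in> ends e" by (simp add: ends_def)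
    ultimately show ?thesis using face_edge[OF e(1) _ e(2)] e(1) unfolding X_def by blast
  qed
  have XE: "X I \<subseteq> E" for I by (auto simp: X_def)
  have bdX: "\<not> bdG (X I) v" if v: "v \<in> V" for I v
  proof -
    have lt: "(0::nat) < 3" "(1::nat) < 3" "(2::nat) < 3" by simp_all
    obtain e0 where e0: "e0 \<in> E" "v \<in> ends e0" "c e0 = 0"
      "\<And>e'. e' \<in> E \<Longrightarrow> v \<in> ends e' \<Longrightarrow> c e' = 0 \<Longrightarrow> e' = e0" using color_edge[OF c v lt(1)] by blast
    obtain e1 where e1: "e1 \<in> E" "v \<in> ends e1" "c e1 = 1"
      "\<And>e'. e' \<in> E \<Longrightarrow> v \<in> ends e' \<Longrightarrow> c e' = 1 \<Longrightarrow> e' = e1" using color_edge[OF c v lt(2)] by blast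
    obtain e2 where e2: "e2 \<in> E" "v \<in> ends e2" "c e2 = 2"
      "\<And>e'. e' \<in> E \<Longrightarrow> v \<in> ends e' \<Longrightarrow> c e' = 2 \<Longrightarrow> e' = e2" using color_edge[OF c v lt(3)] by blast
    have ne: "e0 \<noteq> e1" "e0 \<noteq> e2" "e1 \<noteq> e2" using e0(3) e1(3) e2(3) by auto
    have "e = e0 \<or> e = e1 \<or> e = e2" if "e \<in> E" "v \<in> ends e" for e
    proof -
      have "c e < 3" using c that(1) by (simp add: tricoloring_def)
      then have "c e = 0 \<or> c e = 1 \<or> c e = 2" by linarith
      then show ?thesis using e0(4) e1(4) e2(4) that by blast
    qed
    then have "{e \<in> X I. v \<in> ends e} = {e \<in> {e0, e1, e2}. e \<in> X I}"
      using XE e0(2) e1(2) e2(2) by blast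
    moreover have "e0 \<in> X I \<longleftrightarrow> face I 1 v \<noteq> face I 2 v" "e1 \<in> X I \<longleftrightarrow> face I 2 v \<noteq> face I 0 v"
      "e2 \<in> X I \<longleftrightarrow> face I 0 v \<noteq> face I 1 v"
      using memX[OF e0(1,2), of I] memX[OF e1(1,2), of I] memX[OF e2(1,2), of I]
      unfolding e0(3) e1(3) e2(3) mod3 by blast+
    \<comment> \<open>The three edges compare the three faces at v pairwise; among three truth
      values either no pair differs or exactly two pairs do.\<close>
    then have "card {e \<in> {e0, e1, e2}. e \<in> X I} \<in> {0, 2}"
    proof -
      have eq: "{e \<in> {e0, e1, e2}. e \<in> X I} = (if e0 \<in> X I then {e0} else {}) \<union>
          (if e1 \<in> X I then {e1} else {}) \<union> (if e2 \<in> X I then {e2} else {})" by auto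
      show ?thesis
        unfolding eq using ne \<open>e0 \<in> X I \<longleftrightarrow> _\<close> \<open>e1 \<in> X I \<longleftrightarrow> _\<close> \<open>e2 \<in> X I \<longleftrightarrow> _\<close>
        by (cases "face I 0 v"; cases "face I 1 v"; cases "face I 2 v") simp_all
    qed
    ultimately have "deg (X I) v \<in> {0, 2}" by (simp only: deg_def)
    moreover have "even m" if "m \<in> {0, 2}" for m :: nat using that by auto
    ultimately show ?thesis using bdG_deg[OF XE] by blast
  qed
  \<comment> \<open>The root r absorbs the parity, so each of the 2^(n - 1) sets of other vertices
    gives a boundary of its own.\<close>
  define TT where "TT T = (if even (card T) then T else insert r T)" for T
  have "\<exists>J. J \<subseteq> E \<and> (\<forall>x. bdG J x \<longleftrightarrow> x \<in> TT T)" if T: "T \<subseteq> V - {r}" for T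
  proof -
    have "finite T" "r \<notin> T" using finite_subset[OF T] T by auto
    then have "even (card (TT T))" "TT T \<subseteq> V" using T r by (auto simp: TT_def)
    then show ?thesis
      using T_join_connected[OF finite_verts nonempty finite_arcs ends_in_V conn] by blast
  qed
  then obtain J where J: "\<And>T. T \<subseteq> V - {r} \<Longrightarrow> J T \<subseteq> E" "\<And>T x. T \<subseteq> V - {r} \<Longrightarrow> bdG (J T) x \<longleftrightarrow> x \<in> TT T"
    by metis
  define \<Phi> where "\<Phi> = (\<lambda>(I, T). sym_diff (X I) (J T))"
  let ?D = "Pow (\<F> - {f0}) \<times> Pow (V - {r})"
  have "inj_on \<Phi> ?D"
  proof (rule inj_onI)
    fix p p' assume p: "p \<in> ?D" and p': "p' \<in> ?D" and eq: "\<Phi> p = \<Phi> p'"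
    obtain I T where IT: "p = (I, T)" "I \<subseteq> \<F> - {f0}" "T \<subseteq> V - {r}" using p by blast
    obtain I' T' where IT': "p' = (I', T')" "I' \<subseteq> \<F> - {f0}" "T' \<subseteq> V - {r}" using p' by blast
    have bT: "bdG (sym_diff (X I) (J T)) x \<longleftrightarrow> x \<in> TT T" if "x \<in> V" "T \<subseteq> V - {r}" for I T x
    proof -
      have "bdG (sym_diff (X I) (J T)) x \<longleftrightarrow> bdG (X I) x \<noteq> bdG (J T) x"
        by (rule bd_sym_diff[OF fin_sub[OF XE] fin_sub[OF J(1)[OF that(2)]]])
      then show ?thesis using bdX[OF that(1), of I] J(2)[OF that(2), of x] by blast
    qed
    have eq': "sym_diff (X I) (J T) = sym_diff (X I') (J T')" using eq IT IT' by (simp add: \<Phi>_def)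
    have "x \<in> T \<longleftrightarrow> x \<in> T'" if x: "x \<in> V - {r}" for x
    proof -
      have "x \<in> TT T \<longleftrightarrow> x \<in> TT T'" using bT[of x T I] bT[of x T' I'] eq' x IT(3) IT'(3) by simp
      then show ?thesis using x by (auto simp: TT_def split: if_splits)
    qed
    then have TT': "T = T'" using IT(3) IT'(3) by blast
    have XX: "X I = X I'" using eq' unfolding TT' by blast
    \<comment> \<open>This marks the faces on which I and I' disagree. Equal sums make the three
      faces at a vertex behave alike, adjacent vertices share a face, and at r the face
      \<open>f0\<close> is in neither set; so there is no disagreement anywhere.\<close>
    define d where "d k v \<longleftrightarrow> face I k v \<noteq> face I' k v" for k v
    have d_eq: "d ((i + 1) mod 3) v = d ((i + 2) mod 3) v" if vi: "v \<in> V" "i < 3" for i v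
    proof -
      obtain e where e: "e \<in> E" "v \<in> ends e" "c e = i" using color_edge[OF c vi] by blast
      show ?thesis using memX[OF e(1,2), of I] memX[OF e(1,2), of I'] XX e(3) by (auto simp: d_def)
    qed
    have d_all: "d k v = d 0 v" if "v \<in> V" "k < 3" for k v
    proof -
      have "k = 0 \<or> k = 1 \<or> k = 2" using that(2) by linarith
      then show ?thesis
        using d_eq[OF that(1), of 1] d_eq[OF that(1), of 2] unfolding mod3 by auto
    qed
    have "\<not> d 0 v" if v: "v \<in> V" for v
    proof -
      have "(r, v) \<in> (adj E)\<^sup>*" using conn[OF r v] .
      then have "v \<in> V \<and> \<not> d 0 v"
      proof (induction rule: rtrancl_induct)
        case base
        have "\<not> face I 0 r" "\<not> face I' 0 r" using IT(2) IT'(2) by (auto simp: face_def f0_def)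
        then show ?case using r by (simp add: d_def)
      next
        case (step v w)
        then obtain e where e: "e \<in> E" "ends e = {v, w}" by (auto simp: adj_def)
        then have w: "w \<in> V" using ends_in_V by blast
        obtain k where k: "k < 3" "k \<noteq> c e" by (rule that[of "if c e = 0 then 1 else 0"]) auto
        have "d k v = d k w" using face_edge[OF e(1) _ _ k(2), of v w] e(2) by (simp add: d_def)
        then show ?case using d_all[OF w k(1)] d_all[OF _ k(1), of v] step w by simp
      qed
      then show ?thesis by simp
    qed
    then have nd: "\<not> d k v" if kv: "v \<in> V" "k < 3" for k v using d_all[OF kv] kv(1) by blast
    have "f \<in> I \<longleftrightarrow> f \<in> I'" if f: "f \<in> \<F>" for f
    proof -
      obtain k v where "f = (k, comp (?A k) v)" "k < 3" "v \<in> V"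
        using f by (auto simp: \<F>_def comps_def)
      then show ?thesis using nd[of v k] by (simp add: d_def face_def)
    qed
    then have "I = I'" using IT(2) IT'(2) by blast
    then show "p = p'" using TT' IT IT' by simp
  qed
  moreover have "\<Phi> ` ?D \<subseteq> Pow E"
  proof clarify
    fix I T e assume "T \<subseteq> V - {r}" "e \<in> \<Phi> (I, T)"
    then show "e \<in> E" using XE[of I] J(1)[of T] unfolding \<Phi>_def by blast
  qed
  ultimately have "card ?D \<le> card (Pow E)" by (intro card_inj_on_le) auto
  moreover have "card ?D = 2 ^ (card \<F> - 1) * 2 ^ (n - 1)"
    using f0 r fF by (simp add: card_cartesian_product card_Pow)
  \<comment> \<open>The exponents are compared: with |E| = 3n/2 this leaves at most n/2 + 2
    faces.\<close>
  ultimately have "2 ^ ((card \<F> - 1) + (n - 1)) \<le> (2 ^ card E :: nat)"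
    by (simp add: card_Pow power_add)
  then have "(card \<F> - 1) + (n - 1) \<le> card E" by (simp add: power_increasing_iff)
  moreover have "card \<F> \<ge> 1" "n \<ge> 1" using f0 r fF by (auto simp: Suc_le_eq card_gt_0_iff)
  ultimately show ?thesis using card_E cardF by linarith
qed

definition short_cover :: bool where
  "short_cover \<longleftrightarrow> (\<exists>k. coverable E k \<and> 3 * k \<le> 10 * n)"

text \<open>An edge missing from one pair lies in both others, so any two of the three covers
  suffice. By \<open>coverable_even_two_factor\<close> and \<open>card_faces\<close> all three
  together cost at most 5n - 1, hence some two of them at most 10n/3.\<close>

lemma short_cover_even:
  assumes c: "tricoloring c" and ev: "\<And>k. k < 3 \<Longrightarrow> prod \<sigma> (pair_class c k) = 1"
  shows short_cover
proof -
  have "\<exists>m. coverable (pair_class c k) m \<and> 2 * m + 2 \<le> 3 * n + 2 * card (comps (pair_class c k))"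
    if "k < 3" for k
    using coverable_even_two_factor[OF two_factor_pair_class[OF c that] ev[OF that] conn nonempty]
    by metis
  then obtain m where m: "\<And>k. k < 3 \<Longrightarrow> coverable (pair_class c k) (m k)"
    "\<And>k. k < 3 \<Longrightarrow> 2 * m k + 2 \<le> 3 * n + 2 * card (comps (pair_class c k))" by metis
  have "2 * (m 0 + m 1 + m 2) + 6 \<le> 10 * n + 4"
    using m(2)[of 0] m(2)[of 1] m(2)[of 2] card_faces[OF c] by (simp add: numeral_eq_Suc)
  then have le: "m 0 + m 1 + m 2 + 1 \<le> 5 * n" by (simp add: distrib_left)
  have pair: "coverable E (m k + m l)" if "k < 3" "l < 3" "k \<noteq> l" for k l
    by (rule coverable_mono[OF coverable_Un[OF m(1)[OF that(1)] m(1)[OF that(2)]]])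
      (use that in \<open>auto simp: pair_class_def\<close>)
  have "3 * (a + b) \<le> 10 * N \<or> 3 * (a + d) \<le> 10 * N \<or> 3 * (b + d) \<le> 10 * N"
    if "a + b + d + 1 \<le> 5 * N" for a b d N :: nat
  proof (rule ccontr)
    assume "\<not> ?thesis"
    then have "10 * N < 3 * (a + b)" "10 * N < 3 * (a + d)" "10 * N < 3 * (b + d)" by simp_all
    then show False using that unfolding distrib_left by linarith
  qed
  from this[OF le]
  have "3 * (m 0 + m 1) \<le> 10 * n \<or> 3 * (m 0 + m 2) \<le> 10 * n \<or> 3 * (m 1 + m 2) \<le> 10 * n" .
  then show ?thesis unfolding short_cover_def using pair[of 0 1] pair[of 0 2] pair[of 1 2] by auto
qed

section \<open>Kempe switches and the parity of the pairs of colours\<close>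

definition kempe :: "('e \<Rightarrow> nat) \<Rightarrow> nat \<Rightarrow> 'v set \<Rightarrow> 'e \<Rightarrow> nat" where
  "kempe c k S e = (if e \<in> inside (pair_class c k) S then 3 - k - c e else c e)"

text \<open>The colours 0, 1, 2 have sum 3, so \<open>3 - k - i\<close> is the colour different from
  k and i; this is the exchange made by \<open>kempe\<close>.\<close>

lemma third_color:
  assumes "k < (3::nat)" "i < 3" "i \<noteq> k"
  shows "3 - k - i < 3" "3 - k - i \<noteq> k" "3 - k - i \<noteq> i" "3 - k - (3 - k - i) = i"
    "j < 3 \<Longrightarrow> j \<noteq> k \<Longrightarrow> j = i \<or> j = 3 - k - i"
proof -
  have "k = 0 \<or> k = 1 \<or> k = 2" "i = 0 \<or> i = 1 \<or> i = 2" using assms by linarith+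
  then show "3 - k - i < 3" "3 - k - i \<noteq> k" "3 - k - i \<noteq> i" "3 - k - (3 - k - i) = i"
    "j < 3 \<Longrightarrow> j \<noteq> k \<Longrightarrow> j = i \<or> j = 3 - k - i"
    using assms(3) by auto
qed

lemma tricoloring_kempe:
  assumes c: "tricoloring c" and k: "k < 3" and S: "S \<in> comps (pair_class c k)"
  shows "tricoloring (kempe c k S)"
  unfolding tricoloring_def
proof (intro conjI ballI allI impI)
  fix e assume "e \<in> E"
  then have "c e < 3" using c by (simp add: tricoloring_def)
  then show "kempe c k S e < 3"
    using third_color(1)[OF k, of "c e"] by (auto simp: kempe_def inside_def pair_class_def)
next
  fix v i assume v: "v \<in> V" and i: "i < (3::nat)"
  let ?B = "inside (pair_class c k) S"
  have inB: "e \<in> ?B \<longleftrightarrow> c e \<noteq> k \<and> v \<in> S" if "e \<in> E" "v \<in> ends e" for e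
    using comps_edge[OF S, of e] that by (auto simp: inside_def pair_class_def)
  \<comment> \<open>The old colour of the edge at v that gets colour i: the two edges at v of a
    colour other than k are both on the circuit or both off it.\<close>
  define j where "j = (if v \<in> S \<and> i \<noteq> k then 3 - k - i else i)"
  have j: "j < 3" using i third_color(1)[OF k i] by (simp add: j_def)
  have "kempe c k S e = i \<longleftrightarrow> c e = j" if e: "e \<in> E" "v \<in> ends e" for e
  proof -
    have ce: "c e < 3" using c e(1) by (simp add: tricoloring_def)
    show ?thesis
    proof (cases "e \<in> ?B")
      case True
      then have "c e \<noteq> k" "v \<in> S" using inB[OF e] by auto
      then show ?thesis
        using third_color[OF k ce] third_color[OF k i] True by (auto simp: kempe_def j_def)
    next
      case False
      then show ?thesis using inB[OF e] third_color(2)[OF k i] by (auto simp: kempe_def j_def)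
    qed
  qed
  then have "{e \<in> E. v \<in> ends e \<and> kempe c k S e = i} = {e \<in> E. v \<in> ends e \<and> c e = j}" by blast
  then show "card {e \<in> E. v \<in> ends e \<and> kempe c k S e = i} = 1"
    using c v j by (simp add: tricoloring_def)
qed

text \<open>The switched circuit carries only the two colours other than k. Exchanging them keeps
  the pair k, and replaces in each other pair the edges it has on the circuit by those it
  lacks.\<close>

lemma pair_class_kempe:
  assumes c: "tricoloring c" and k: "k < 3"
  shows "pair_class (kempe c k S) k = pair_class c k"
    and "l < 3 \<Longrightarrow> l \<noteq> k \<Longrightarrow>
      pair_class (kempe c k S) l = sym_diff (pair_class c l) (inside (pair_class c k) S)"
proof -
  let ?B = "inside (pair_class c k) S"
  have B: "c e < 3" "c e \<noteq> k" if "e \<in> ?B" for e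
    using that c by (auto simp: inside_def pair_class_def tricoloring_def)
  have BE: "?B \<subseteq> E" by (auto simp: inside_def pair_class_def)
  show "pair_class (kempe c k S) k = pair_class c k"
    using B third_color(2)[OF k] by (auto simp: pair_class_def kempe_def)
  show "pair_class (kempe c k S) l = sym_diff (pair_class c l) ?B" if l: "l < 3" "l \<noteq> k"
  proof (rule set_eqI)
    fix e
    show "e \<in> pair_class (kempe c k S) l \<longleftrightarrow> e \<in> sym_diff (pair_class c l) ?B"
    proof (cases "e \<in> ?B")
      case True
      then show ?thesis
        using B[OF True] third_color(3,5)[OF k B[OF True]] l BE by (auto simp: pair_class_def kempe_def)
    qed (auto simp: pair_class_def kempe_def)
  qed
qed

lemma prod_sym_diff:
  assumes "A \<subseteq> E" "B \<subseteq> E"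
  shows "prod \<sigma> (sym_diff A B) = prod \<sigma> A * prod \<sigma> B"
proof -
  have f: "finite A" "finite B" using assms fin_sub by auto
  have "prod \<sigma> A = prod \<sigma> (A - B) * prod \<sigma> (A \<inter> B)"
    using prod.Int_Diff[OF f(1), of \<sigma> B] by (simp add: mult.commute)
  moreover have "prod \<sigma> B = prod \<sigma> (B - A) * prod \<sigma> (A \<inter> B)"
    using prod.Int_Diff[OF f(2), of \<sigma> A] by (simp add: mult.commute Int_commute)
  moreover have "prod \<sigma> (sym_diff A B) = prod \<sigma> (A - B) * prod \<sigma> (B - A)"
    using f by (intro prod.union_disjoint) auto
  moreover have "A \<inter> B \<subseteq> E" using assms by blast
  then have "prod \<sigma> (A \<inter> B) * prod \<sigma> (A \<inter> B) = 1"
    by (rule disjE[OF prod_sig_cases]) simp_all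
  ultimately show ?thesis by (simp add: mult.assoc mult.left_commute)
qed

text \<open>The third class is the symmetric difference of the other two, so its sign is the product
  of theirs.\<close>

lemma prod_pair_classes:
  assumes "tricoloring c"
  shows "prod \<sigma> (pair_class c 0) * prod \<sigma> (pair_class c 1) * prod \<sigma> (pair_class c 2) = 1"
proof -
  have "c e < 3" if "e \<in> E" for e using assms that by (simp add: tricoloring_def)
  then have "pair_class c 2 = sym_diff (pair_class c 0) (pair_class c 1)"
    by (force simp: pair_class_def)
  then have "prod \<sigma> (pair_class c 2) = prod \<sigma> (pair_class c 0) * prod \<sigma> (pair_class c 1)"
    using prod_sym_diff[OF pair_class_subset pair_class_subset] by simp
  then show ?thesis
    using prod_sig_cases[OF pair_class_subset[of c 0]] prod_sig_cases[OF pair_class_subset[of c 1]]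
    by auto
qed

text \<open>A Kempe switch along an unbalanced circuit of this pair flips the signs of the other two
  pairs, which are equal because all three multiply to 1. So either the colouring or the switched
  one has only even pairs.\<close>

lemma unbal_even_pair:
  assumes c: "tricoloring c" and k: "k < 3" "prod \<sigma> (pair_class c k) = 1" and "\<not> short_cover"
  shows "unbal (pair_class c k) = {}"
proof (rule ccontr)
  assume "unbal (pair_class c k) \<noteq> {}"
  then obtain S where S: "S \<in> comps (pair_class c k)" "prod \<sigma> (inside (pair_class c k) S) = -1"
    by (auto simp: unbal_def)
  note c' = tricoloring_kempe[OF c k(1) S(1)]
  have pm: "prod \<sigma> (pair_class c l) = 1 \<or> prod \<sigma> (pair_class c l) = -1" for l
    using prod_sig_cases[OF pair_class_subset] .
  have sw: "prod \<sigma> (pair_class (kempe c k S) l) = - prod \<sigma> (pair_class c l)"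
    if "l < 3" "l \<noteq> k" for l
    using pair_class_kempe(2)[OF c k(1) that] prod_sym_diff[OF pair_class_subset, of "inside (pair_class c k) S" c l]
      S(2) inside_subset[of "pair_class c k" S] pair_class_subset[of c k] by auto
  obtain l m where lm: "l < 3" "m < 3" "l \<noteq> k" "m \<noteq> k" "l \<noteq> m" "{..<3} = {k, l, m}"
  proof -
    have "k = 0 \<or> k = 1 \<or> k = 2" using k(1) by linarith
    then show thesis
    proof (elim disjE)
      assume "k = 0"
      then show thesis by (intro that[of 1 2]) auto
    next
      assume "k = 1"
      then show thesis by (intro that[of 0 2]) auto
    next
      assume "k = 2"
      then show thesis by (intro that[of 0 1]) auto
    qed
  qed
  have "prod \<sigma> (pair_class c l) = prod \<sigma> (pair_class c m)"
  proof -
    have "(\<Prod>j<3. prod \<sigma> (pair_class c j)) = 1"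
      using prod_pair_classes[OF c] by (simp add: numeral_eq_Suc mult_ac)
    then show ?thesis using pm[of l] pm[of m] k(2) lm(3-5) unfolding lm(6) by auto
  qed
  then consider "prod \<sigma> (pair_class c l) = 1" "prod \<sigma> (pair_class c m) = 1"
    | "prod \<sigma> (pair_class c l) = -1" "prod \<sigma> (pair_class c m) = -1" using pm[of l] by metis
  then show False
  proof cases
    case 1
    have "prod \<sigma> (pair_class c j) = 1" if "j < 3" for j
    proof -
      have "j \<in> {k, l, m}" using that unfolding lm(6)[symmetric] by simp
      then show ?thesis using 1 k(2) by auto
    qed
    then show ?thesis using short_cover_even[OF c] assms(4) by blast
  next
    case 2
    have "prod \<sigma> (pair_class (kempe c k S) j) = 1" if "j < 3" for j
    proof -
      have "j \<in> {k, l, m}" using that unfolding lm(6)[symmetric] by simp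
      then show ?thesis
        using 2 sw[OF lm(1,3)] sw[OF lm(2,4)] k(2) pair_class_kempe(1)[OF c k(1)] by auto
    qed
    then show ?thesis using short_cover_even[OF c'] assms(4) by blast
  qed
qed

lemma short_cover_from_odd_circuit_cover:
  assumes c: "tricoloring c"
    and odd: "\<And>S B. ring S B \<Longrightarrow> prod \<sigma> B = -1 \<Longrightarrow> \<exists>k. coverable B k \<and> 3 * k \<le> 4 * n + 3 * card B"
  shows short_cover
proof (rule ccontr)
  assume no: "\<not> short_cover"
  let ?A = "pair_class c"
  have pm: "prod \<sigma> (?A l) = 1 \<or> prod \<sigma> (?A l) = -1" for l
    using prod_sig_cases[OF pair_class_subset] .
  have "\<not> (\<forall>k<3. prod \<sigma> (?A k) = 1)" using short_cover_even[OF c] no by blast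
  then have "prod \<sigma> (?A 0) = -1 \<or> prod \<sigma> (?A 1) = -1 \<or> prod \<sigma> (?A 2) = -1"
    using pm by (metis less_Suc0 less_Suc_eq numeral_2_eq_2 numeral_3_eq_3 One_nat_def)
  then obtain k l m where klm: "k < 3" "l < 3" "m < 3" "k \<noteq> l" "k \<noteq> m" "l \<noteq> m"
    "prod \<sigma> (?A k) = 1" "prod \<sigma> (?A l) = -1" "prod \<sigma> (?A m) = -1" "{..<3} = {k, l, m}"
  proof -
    assume *: "\<And>k l m. \<lbrakk>k < 3; l < 3; m < 3; k \<noteq> l; k \<noteq> m; l \<noteq> m; prod \<sigma> (?A k) = 1;
      prod \<sigma> (?A l) = - 1; prod \<sigma> (?A m) = - 1; {..<3} = {k, l, m}\<rbrakk> \<Longrightarrow> thesis"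
    have s: "{..<3} = {0::nat, 1, 2}" by auto
    consider "prod \<sigma> (?A 0) = 1" "prod \<sigma> (?A 1) = -1" "prod \<sigma> (?A 2) = -1"
      | "prod \<sigma> (?A 0) = -1" "prod \<sigma> (?A 1) = 1" "prod \<sigma> (?A 2) = -1"
      | "prod \<sigma> (?A 0) = -1" "prod \<sigma> (?A 1) = -1" "prod \<sigma> (?A 2) = 1"
      using prod_pair_classes[OF c] pm[of 0] pm[of 1] pm[of 2]
        \<open>prod \<sigma> (?A 0) = -1 \<or> prod \<sigma> (?A 1) = -1 \<or> prod \<sigma> (?A 2) = -1\<close> by fastforce
    then show thesis
    proof cases
      case 1
      then show ?thesis using *[of 0 1 2] s by simp
    next
      case 2
      then show ?thesis using *[of 1 0 2] s by auto
    next
      case 3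
      then show ?thesis using *[of 2 0 1] s by auto
    qed
  qed
  have tfk: "two_factor (?A k)" and tfl: "two_factor (?A l)"
    using two_factor_pair_class[OF c] klm by auto
  have ck: "coverable (?A k) n"
    using coverable_two_factor_balanced[OF tfk] unbal_even_pair[OF c klm(1,7) no] by blast
  have E_split: "c e = k \<or> c e = l \<or> c e = m" if "e \<in> E" for e
    using c that klm(10) by (auto simp: tricoloring_def)
  \<comment> \<open>The switch exchanges the colours k and m on U and makes the pair m even. As no
    short cover is assumed to exist, the circuits of the new pair are all balanced and cost
    n.\<close>
  have swap: "coverable (sym_diff (?A m) (inside (?A l) U)) n" if U: "U \<in> unbal (?A l)" for U
  proof -
    have U': "U \<in> comps (?A l)" "prod \<sigma> (inside (?A l) U) = -1" using U by (auto simp: unbal_def)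
    let ?c = "kempe c l U"
    have c': "tricoloring ?c" using tricoloring_kempe[OF c klm(2) U'(1)] .
    have eq: "pair_class ?c m = sym_diff (?A m) (inside (?A l) U)"
      using pair_class_kempe(2)[OF c klm(2,3)] klm(6) by simp
    have "prod \<sigma> (pair_class ?c m) = 1"
      unfolding eq using prod_sym_diff[OF pair_class_subset, of "inside (?A l) U" c m] U'(2) klm(9)
        inside_subset[of "?A l" U] pair_class_subset[of c l] by auto
    then show ?thesis
      using coverable_two_factor_balanced[OF two_factor_pair_class[OF c' klm(3)]]
        unbal_even_pair[OF c' klm(3) _ no] eq by simp
  qed
  have "unbal (?A l) \<noteq> {}"
    using unbal_card[OF pair_class_subset, of c l] klm(8) by auto
  then obtain U where U: "U \<in> unbal (?A l)" by blast
  have Uc: "U \<in> comps (?A l)" "prod \<sigma> (inside (?A l) U) = -1" using U by (auto simp: unbal_def)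
  show False
  proof (cases "unbal (?A l) = {U}")
    case False
    then obtain U' where U': "U' \<in> unbal (?A l)" "U' \<noteq> U" using U by blast
    then have dis: "inside (?A l) U \<inter> inside (?A l) U' = {}"
      using inside_disjoint Uc(1) by (auto simp: unbal_def)
    \<comment> \<open>Edges outside the even pair have colour k and lie in the pair m. As U and U'
      share no edge, each of them survives in one of the two switched pairs.\<close>
    have "coverable E (n + (n + n))"
    proof (rule coverable_mono[OF coverable_Un[OF ck coverable_Un[OF swap[OF U] swap[OF U'(1)]]]])
      show "E \<subseteq> ?A k \<union> (sym_diff (?A m) (inside (?A l) U) \<union> sym_diff (?A m) (inside (?A l) U'))"
        using dis klm(5) by (auto simp: pair_class_def)
    qed simp
    then show False using no unfolding short_cover_def by fastforce
  next
    case True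
    let ?B = "inside (?A l) U" and ?f = "comps (?A l) - {U}"
    have rU: "ring U ?B" using two_factor_ring[OF tfl Uc(1)] .
    obtain q where q: "coverable ?B q" "3 * q \<le> 4 * n + 3 * card ?B" using odd[OF rU Uc(2)] by blast
    have cf: "coverable (\<Union>S\<in>?f. inside (?A l) S) (\<Sum>S\<in>?f. card (inside (?A l) S))"
      by (rule coverable_balanced[OF tfl]) (use True in auto)
    have "?A l = (\<Union>S\<in>insert U ?f. inside (?A l) S)"
      using UN_inside[OF pair_class_subset, of c l] Uc(1) by (simp add: insert_absorb)
    then have A: "?A l = ?B \<union> (\<Union>S\<in>?f. inside (?A l) S)" by (simp only: UN_insert)
    have "n = (\<Sum>S\<in>comps (?A l). card (inside (?A l) S))"
      using card_inside[OF pair_class_subset order_refl, of c l] UN_inside[OF pair_class_subset, of c l]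
        two_factor_card[OF tfl] by simp
    also have "\<dots> = card ?B + (\<Sum>S\<in>?f. card (inside (?A l) S))"
      using Uc(1) by (simp add: sum.remove)
    finally have s: "n = card ?B + (\<Sum>S\<in>?f. card (inside (?A l) S))" .
    have "coverable E (n + (q + (\<Sum>S\<in>?f. card (inside (?A l) S))))"
    proof (rule coverable_mono[OF coverable_Un[OF ck coverable_Un[OF q(1) cf]]])
      show "E \<subseteq> ?A k \<union> (?B \<union> (\<Union>S\<in>?f. inside (?A l) S))"
        unfolding A[symmetric] using klm(4) by (auto simp: pair_class_def)
    qed simp
    moreover have "3 * (n + (q + (\<Sum>S\<in>?f. card (inside (?A l) S)))) \<le> 10 * n"
      using s q(2) unfolding distrib_left by linarith
    ultimately show False using no unfolding short_cover_def by blast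
  qed
qed

end

section \<open>Switching\<close>

context signed_loopless
begin

definition switched :: "('v \<Rightarrow> int) \<Rightarrow> 'e \<Rightarrow> int" where
  "switched s e = s (tail G e) * s (head G e) * \<sigma> e"

lemma switched_ends: "ends e = {x, y} \<Longrightarrow> switched s e = s x * s y * \<sigma> e"
  by (auto simp: switched_def ends_def doubleton_eq_iff)

lemma pm_square: "(a::int) \<in> {1, -1} \<Longrightarrow> a * a = 1"
  by auto

lemma switched_pm:
  assumes "\<And>v. s v \<in> {1, -1}" "e \<in> E"
  shows "switched s e \<in> {1, -1}"
  using assms(1)[of "tail G e"] assms(1)[of "head G e"] sig[OF assms(2)]
  by (auto simp: switched_def)

text \<open>Every inner vertex of the path contributes its sign twice, so only the factors at the
  two ends remain.\<close>

lemma prod_switched_path: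
  assumes "is_path A xs es" "\<And>v. s v \<in> {1, -1}"
  shows "prod \<sigma> (set es) = s (hd xs) * s (last xs) * prod (switched s) (set es)"
  using assms(1)
proof (induction es arbitrary: xs)
  case Nil
  then obtain x where "xs = [x]" by (auto simp: is_path_def length_Suc_conv)
  then show ?case using pm_square[OF assms(2)[of x]] by simp
next
  case (Cons e es)
  then obtain x y ys where xs: "xs = x # y # ys" by (auto simp: is_path_def length_Suc_conv)
  then have p: "is_path A (y # ys) es" "ends e = {x, y}"
    using path_consD[of A x y ys e es] Cons.prems by auto
  have "e \<notin> set es" using path_distinct_edges[OF Cons.prems] by simp
  then have "prod \<sigma> (set (e # es)) = \<sigma> e * prod \<sigma> (set es)"
    "prod (switched s) (set (e # es)) = s x * s y * \<sigma> e * prod (switched s) (set es)"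
    using switched_ends[OF p(2)] by simp_all
  then show ?case
    using Cons.IH[OF p(1)] xs pm_square[OF assms(2)[of x]] pm_square[OF assms(2)[of y]]
    by (simp add: algebra_simps)
qed

text \<open>
  A switching with the fewest negative edges in A: a remaining negative edge closes a positive path
  to an unbalanced circuit, as otherwise the vertices reachable from one of its ends could be switched.
\<close>

lemma balanced_switching:
  assumes A: "A \<subseteq> E"
    and bal: "\<And>S B. ring S B \<Longrightarrow> B \<subseteq> A \<Longrightarrow> prod \<sigma> B = 1"
  obtains s where "\<And>v. s v \<in> {1, -1}" "\<And>e. e \<in> A \<Longrightarrow> switched s e = 1"
proof -
  define P where "P = (\<lambda>s::'v \<Rightarrow> int. \<forall>v. s v \<in> {1, -1})"
  define N where "N s = {e \<in> A. switched s e \<noteq> 1}" for s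
  have "P (\<lambda>_. 1)" by (simp add: P_def)
  then obtain s where s: "P s" and min: "\<And>s'. P s' \<Longrightarrow> card (N s) \<le> card (N s')"
    using ex_has_least_nat[of P _ "\<lambda>s. card (N s)"] by blast
  have pm: "\<And>v. s v \<in> {1, -1}" using s by (simp add: P_def)
  have fN: "finite (N s)" using fin_sub[OF A] by (simp add: N_def)
  have "N s = {}"
  proof (rule ccontr)
    assume "N s \<noteq> {}"
    then obtain e where e: "e \<in> A" "switched s e \<noteq> 1" by (auto simp: N_def)
    have eE: "e \<in> E" using e A by blast
    define x where "x = tail G e"
    define y where "y = head G e"
    have xy: "ends e = {x, y}" "x \<noteq> y" using no_loop[OF eE] by (auto simp: ends_def x_def y_def)
    have neg: "switched s e = -1" using switched_pm[of s, OF pm eE] e(2) by simp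
    show False
    proof (cases "(x, y) \<in> (adj (A - N s))\<^sup>*")
      case True
      then obtain xs fs where p: "is_path (A - N s) xs fs" "hd xs = x" "last xs = y"
        by (rule path_exists)
      have fs: "set fs \<subseteq> A - N s" using p(1) by (simp add: is_path_def)
      have pE: "is_path E xs fs" by (rule path_mono[OF p(1)]) (use A in blast)
      have efs: "e \<notin> set fs" using fs e by (auto simp: N_def)
      have "is_path E [y, x] [e]" using xy eE by (auto simp: is_path_def insert_commute)
      then have "ring (set xs \<union> set [y, x]) (set fs \<union> set [e])"
        using p(2,3) xy(2) efs path_nonempty[OF pE]
        by (intro cyc_two_paths[OF pE]) auto
      moreover have "prod \<sigma> (set fs) = s x * s y"
      proof -
        have "prod (switched s) (set fs) = 1" using fs by (intro prod.neutral) (auto simp: N_def)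
        then show ?thesis using prod_switched_path[OF pE, of s, OF pm] p(2,3) by simp
      qed
      then have "prod \<sigma> (set fs \<union> set [e]) = switched s e"
        using efs switched_ends[OF xy(1)] by (simp add: mult.commute)
      ultimately show False using bal[of "set xs \<union> set [y, x]" "set fs \<union> set [e]"] fs e(1) neg by auto
    next
      case False
      define K where "K = {v. (x, v) \<in> (adj (A - N s))\<^sup>*}"
      have xK: "x \<in> K" and yK: "y \<notin> K" using False by (auto simp: K_def)
      define s' where "s' v = (if v \<in> K then - s v else s v)" for v
      have P': "P s'" using pm by (auto simp: P_def s'_def)
      have cross: "f \<in> N s" if "f \<in> A" "ends f = {a, b}" "a \<in> K" "b \<notin> K" for f a b
      proof (rule ccontr)
        assume "f \<notin> N s"
        then have "(a, b) \<in> adj (A - N s)" using that by (intro adjI) auto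
        then show False using that(3,4) by (auto simp: K_def intro: rtrancl_into_rtrancl)
      qed
      \<comment> \<open>Every edge of A leaving K is negative, as otherwise K would be larger.
        Switching K makes all of them positive, e included, and changes no other edge of A.\<close>
      have "N s' \<subseteq> N s - {e}"
      proof
        fix f assume f: "f \<in> N s'"
        then have fA: "f \<in> A" and f1: "switched s' f \<noteq> 1" by (auto simp: N_def)
        have t: "ends f = {tail G f, head G f}" by (simp add: ends_def)
        show "f \<in> N s - {e}"
        proof (cases "tail G f \<in> K \<longleftrightarrow> head G f \<in> K")
          case True
          then have "switched s' f = switched s f" by (auto simp: switched_def s'_def)
          moreover have "f \<noteq> e" using True xK yK by (auto simp: x_def y_def)
          ultimately show ?thesis using fA f1 by (simp add: N_def)
        next
          case False
          then have "f \<in> N s"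
            using cross[OF fA t] cross[OF fA, of "head G f" "tail G f"] t by (auto simp: insert_commute)
          then have "switched s f = -1" using switched_pm[of s f, OF pm] fA A by (auto simp: N_def)
          moreover have "switched s' f = - switched s f"
            using False by (auto simp: switched_def s'_def)
          ultimately show ?thesis using f1 by simp
        qed
      qed
      moreover have "e \<in> N s" using e by (simp add: N_def)
      ultimately have "card (N s') < card (N s)"
        using fN by (meson card_Diff1_less card_mono finite_Diff le_less_trans)
      then show False using min[OF P'] by simp
    qed
  qed
  then show thesis using that[of s, OF pm] by (auto simp: N_def)
qed

text \<open>The sign given to a vertex is the product of the edge signs before it, so the factors
  cancel on every edge but the closing one, which collects the total product -1. Vertices off the
  circuit keep their sign, so that a switching found there survives.\<close>

lemma cyc_switching:
  assumes c: "cyc us es" and odd: "prod \<sigma> (set es) = -1" and pm: "\<And>v. s v \<in> {1, -1}"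
  obtains s' where "\<And>v. s' v \<in> {1, -1}" "\<And>v. v \<notin> set us \<Longrightarrow> s' v = s v"
    "\<And>j. j < length us \<Longrightarrow> switched s' (es ! j) = (if Suc j = length us then -1 else 1)"
proof -
  have us: "us \<noteq> []" "length us = length es" "distinct us" "distinct es" "set es \<subseteq> E"
    "\<And>i. i < length us \<Longrightarrow> ends (es ! i) = {us ! i, us ! (Suc i mod length us)}"
    using c by (auto simp: cyc_def)
  have sg: "\<sigma> (es ! j) \<in> {1, -1}" if "j < length us" for j
  proof -
    have "es ! j \<in> set es" using us(2) that by simp
    then show ?thesis using sig us(5) by blast
  qed
  define m where "m i = (\<Prod>j<i. \<sigma> (es ! j))" for i
  have m: "m i \<in> {1, -1}" if "i \<le> length us" for i
    using prod_sign_cases[of "{..<i}" "\<lambda>j. \<sigma> (es ! j)"] sg that unfolding m_def by auto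
  define s' where "s' v = (if v \<in> set us then m (THE i. i < length us \<and> us ! i = v) else s v)" for v
  have s'_us: "s' (us ! i) = m i" if "i < length us" for i
  proof -
    have "(THE j. j < length us \<and> us ! j = us ! i) = i"
      using that us(3) by (intro the_equality) (auto simp: nth_eq_iff_index_eq)
    then show ?thesis using that by (simp add: s'_def)
  qed
  have "m (length us) = prod \<sigma> (set es)"
  proof -
    have "prod \<sigma> (set es) = prod \<sigma> ((!) es ` {..<length es})"
      by (simp add: nth_image[of "length es" es, simplified] lessThan_atLeast0)
    also have "\<dots> = (\<Prod>j<length es. \<sigma> (es ! j))"
      using us(4) by (subst prod.reindex) (auto simp: inj_on_def nth_eq_iff_index_eq)
    finally show ?thesis using us(2) by (simp add: m_def)
  qed
  then have m_len: "m (length us) = -1" using odd by simp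
  show thesis
  proof
    fix v show "s' v \<in> {1, -1}"
    proof (cases "v \<in> set us")
      case True
      then obtain i where "i < length us" "v = us ! i" by (auto simp: in_set_conv_nth)
      then show ?thesis using s'_us m by simp
    next
      case False
      then show ?thesis using pm by (simp add: s'_def)
    qed
    show "v \<notin> set us \<Longrightarrow> s' v = s v" by (simp add: s'_def)
  next
    fix j assume j: "j < length us"
    have mS: "m (Suc j) = m j * \<sigma> (es ! j)" by (simp add: m_def)
    have m1: "m (Suc j) * m (Suc j) = 1" using m[of "Suc j"] j by auto
    show "switched s' (es ! j) = (if Suc j = length us then -1 else 1)"
    proof (cases "Suc j = length us")
      case True
      then have "ends (es ! j) = {us ! j, us ! 0}" using us(6)[OF j] by simp
      then have "switched s' (es ! j) = m j * m 0 * \<sigma> (es ! j)"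
        using switched_ends s'_us j us(1) by simp
      then show ?thesis using mS m_len True by (simp add: m_def)
    next
      case False
      then have "Suc j < length us" using j by simp
      then have "ends (es ! j) = {us ! j, us ! Suc j}" using us(6)[OF j] by simp
      then have "switched s' (es ! j) = m j * m (Suc j) * \<sigma> (es ! j)"
        using switched_ends s'_us j \<open>Suc j < length us\<close> by simp
      also have "\<dots> = m (Suc j) * m (Suc j)" using mS by (simp add: mult_ac)
      finally show ?thesis using m1 False by simp
    qed
  qed
qed

end

section \<open>Two disjoint unbalanced circuits\<close>

context cubic_signed
begin

text \<open>A long barbell has one edge more than vertices, hence at most n + 1 edges. This is
  within the allowance because A has at least two edges.\<close>

lemma coverable_disjoint_unbalanced:
  assumes r: "ring S A" "prod \<sigma> A = -1" "ring S' A'" "prod \<sigma> A' = -1" "S \<inter> S' = {}"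
  shows "\<exists>k. coverable A k \<and> 3 * k \<le> 4 * n + 3 * card A"
proof -
  note r1 = ringD[OF r(1)] and r2 = ringD[OF r(3)]
  obtain x where x: "x \<in> S" using r1(1) by blast
  obtain y where y: "y \<in> S'" using r2(1) by blast
  obtain xs es where p: "is_path E xs es" "hd xs = x" "last xs = y"
    using path_exists[OF conn, of x y] x y r1(2) r2(2) by blast
  obtain ys fs where q: "is_path E ys fs" "set ys \<inter> S = {hd ys}" "set ys \<inter> S' = {last ys}"
    using path_between_sets[OF p(1), of S S'] p x y by metis
  have cov: "coverable (A \<union> A') (card A + card A' + length fs)"
    using coverable_barbell[OF r q] .
  have ysV: "set ys \<subseteq> V" using path_in_V[OF q(1) order_refl] q(2) r1(2) by blast
  let ?I = "set ys - {hd ys, last ys}"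
  have "card (S \<union> S' \<union> ?I) = card S + card S' + card ?I"
    using r1(4) r2(4) r(5) q(2,3) by (subst card_Un_disjoint, simp, simp, blast, subst card_Un_disjoint) auto
  moreover have "card (S \<union> S' \<union> ?I) \<le> n"
    using r1(2) r2(2) ysV by (intro card_mono) auto
  moreover have "Suc (length fs) \<le> card ?I + 2"
  proof -
    have "card (set ys) \<le> card (?I \<union> {hd ys, last ys})" by (intro card_mono) auto
    also have "\<dots> \<le> card ?I + card {hd ys, last ys}" by (rule card_Un_le)
    also have "card {hd ys, last ys} \<le> 2" by (simp add: card_insert_if)
    finally show ?thesis using path_card(2)[OF q(1)] by simp
  qed
  ultimately have "card A' + length fs + card A \<le> n + 1"
    using ring_card[OF r(1)] ring_card[OF r(3)] by linarith
  moreover have "2 \<le> card A" "2 \<le> n"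
  proof -
    show "2 \<le> card A" using ring_card_ge_2[OF r(1)] ring_card[OF r(1)] by simp
    have "card S \<le> n" using r1(2) by (intro card_mono) auto
    then show "2 \<le> n" using ring_card_ge_2[OF r(1)] by simp
  qed
  ultimately have "3 * (card A + card A' + length fs) \<le> 4 * n + 3 * card A"
    unfolding distrib_left by linarith
  then show ?thesis using coverable_mono[OF cov] by blast
qed

end

section \<open>Covering an unbalanced circuit\<close>

lemma set_take_Int_drop:
  assumes "distinct ws" "m < length ws"
  shows "set (take (Suc m) ws) \<inter> set (drop m ws) = {ws ! m}"
proof -
  have d: "drop m ws = ws ! m # drop (Suc m) ws" using assms(2) by (simp add: Cons_nth_drop_Suc)
  have "set (take (Suc m) ws) \<inter> set (drop (Suc m) ws) = {}"
    using assms(1) by (simp add: set_take_disj_set_drop_if_distinct)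
  moreover have "ws ! m \<in> set (take (Suc m) ws)"
    using assms(2) by (simp add: take_Suc_conv_app_nth)
  ultimately show ?thesis unfolding d by auto
qed

text \<open>The form in which the nowhere-zero flow is used: switching cannot leave exactly one
  negative edge. On a component this comes from \<open>flow_no_single_negative\<close>.\<close>

locale admissible_cubic = cubic_signed G \<sigma> for G :: "('v, 'e) pre_digraph" and \<sigma> +
  assumes no_single_negative: "\<lbrakk>\<And>v. s v \<in> {1, -1}; e\<^sub>0 \<in> arcs G\<rbrakk> \<Longrightarrow>
    \<exists>e \<in> arcs G. switched s e \<noteq> (if e = e\<^sub>0 then -1 else 1)"

text \<open>
  An unbalanced circuit U that meets every unbalanced circuit, switched such that the only negative
  edges are the last edge of U and possibly edges that have exactly one end on U or are chords of U.
\<close>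

locale odd_circuit = admissible_cubic G \<sigma> for G :: "('v, 'e) pre_digraph" and \<sigma> +
  fixes us :: "'v list" and es :: "'e list" and s :: "'v \<Rightarrow> int"
  assumes cyc: "cyc us es"
    and pm: "s v \<in> {1, -1}"
    and off: "e \<in> arcs G \<Longrightarrow> ends e \<inter> set us = {} \<Longrightarrow> switched s e = 1"
    and on: "j < length us \<Longrightarrow> switched s (es ! j) = (if Suc j = length us then -1 else 1)"
begin

abbreviation "len \<equiv> length us"
abbreviation "eps \<equiv> switched s"

lemma cycD: "us \<noteq> []" "length es = len" "distinct us" "distinct es" "set es \<subseteq> E"
  "i < len \<Longrightarrow> ends (es ! i) = {us ! i, us ! (Suc i mod len)}"
  using cyc by (auto simp: cyc_def)

lemma ring_U: "ring (set us) (set es)"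
  by (rule ring_cyc[OF cyc])

lemma eps_pm: "e \<in> E \<Longrightarrow> eps e \<in> {1, -1}"
  by (rule switched_pm[of s, OF pm])

lemma prod_eps_cases: "A \<subseteq> E \<Longrightarrow> prod eps A = 1 \<or> prod eps A = -1"
  using eps_pm by (intro prod_sign_cases fin_sub) auto

lemma us_inj: "i < len \<Longrightarrow> j < len \<Longrightarrow> us ! i = us ! j \<longleftrightarrow> i = j"
  using cycD(3) by (rule nth_eq_iff_index_eq)

lemma us_V: "set us \<subseteq> V"
  using ringD(2)[OF ring_U] .

lemma card_us: "card (set us) = len"
  using cycD(3) by (rule distinct_card)

lemma card_es_image: "S \<subseteq> {..<len} \<Longrightarrow> card ((!) es ` S) = card S"
  using cycD(2,4) by (intro card_image) (auto simp: inj_on_def nth_eq_iff_index_eq subset_iff)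

lemma es_image_all: "(!) es ` {..<len} = set es"
  using cycD(2) by (metis atLeast0LessThan nth_image order_refl take_all)

lemma path_U: "is_path E us (butlast es)"
  unfolding is_path_def
proof (intro conjI allI impI)
  show "length us = Suc (length (butlast es))" using cycD(1,2) by (cases es) auto
  show "set (butlast es) \<subseteq> E" using cycD(5) by (auto dest: in_set_butlastD)
  fix i assume "i < length (butlast es)"
  then show "ends (butlast es ! i) = {us ! i, us ! Suc i}"
    using cycD(2) cycD(6)[of i] by (simp add: nth_butlast)
qed (rule cycD)

text \<open>
  The positions of the edges of U on the arc between the i-th and the j-th vertex that an ear with
  sign t and the same ends closes to a balanced circuit.
\<close>

definition between :: "nat \<Rightarrow> nat \<Rightarrow> int \<Rightarrow> nat set" where
  "between i j t = (if t = 1 then {i..<j} else {..<len} - {i..<j})"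

definition ear :: "nat \<Rightarrow> nat \<Rightarrow> 'v list \<Rightarrow> 'e list \<Rightarrow> bool" where
  "ear i j xs fs \<longleftrightarrow> i < j \<and> j < len \<and> is_path (E - set es) xs fs \<and> hd xs = us ! i \<and> last xs = us ! j \<and>
     set xs \<inter> set us = {us ! i, us ! j}"

lemma set_drop_take_image:
  assumes "i \<le> j" "j \<le> length zs"
  shows "set (drop i (take j zs)) = (!) zs ` {i..<j}"
proof (intro equalityI subsetI)
  fix z assume "z \<in> set (drop i (take j zs))"
  then obtain k where "k < length (drop i (take j zs))" "z = drop i (take j zs) ! k"
    by (auto simp: in_set_conv_nth)
  then show "z \<in> (!) zs ` {i..<j}" using assms by (intro image_eqI[of _ _ "i + k"]) auto
next
  fix z assume "z \<in> (!) zs ` {i..<j}"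
  then obtain k where k: "i \<le> k" "k < j" "z = zs ! k" by auto
  then have "z = drop i (take j zs) ! (k - i)" "k - i < length (drop i (take j zs))"
    using assms by auto
  then show "z \<in> set (drop i (take j zs))" by simp
qed

text \<open>The only negative edge of U is its last one; the arc from i to j avoids it and the
  complementary arc contains it.\<close>

lemma prod_eps_between:
  assumes "i < j" "j < len"
  shows "prod eps ((!) es ` {i..<j}) = 1" "prod eps ((!) es ` ({..<len} - {i..<j})) = -1"
proof -
  have inj: "inj_on ((!) es) A" if "A \<subseteq> {..<len}" for A
    using cycD(2,4) that by (auto simp: inj_on_def nth_eq_iff_index_eq subset_iff)
  have sub: "{i..<j} \<subseteq> {..<len}" using assms by auto
  have "prod eps ((!) es ` {i..<j}) = (\<Prod>k\<in>{i..<j}. eps (es ! k))"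
    using inj[OF sub] by (subst prod.reindex) auto
  also have "\<dots> = 1" using on assms by (intro prod.neutral) auto
  finally show "prod eps ((!) es ` {i..<j}) = 1" .
  have "prod eps ((!) es ` ({..<len} - {i..<j})) = (\<Prod>k\<in>{..<len} - {i..<j}. eps (es ! k))"
    using inj[of "{..<len} - {i..<j}"] by (subst prod.reindex) auto
  also have "\<dots> = eps (es ! (len - 1)) * (\<Prod>k\<in>{..<len} - {i..<j} - {len - 1}. eps (es ! k))"
    using assms by (intro prod.remove) auto
  also have "(\<Prod>k\<in>{..<len} - {i..<j} - {len - 1}. eps (es ! k)) = 1"
    using on by (intro prod.neutral) auto
  finally show "prod eps ((!) es ` ({..<len} - {i..<j})) = -1" using on[of "len - 1"] assms by simp
qed

lemma arc_inner:
  assumes "i < j" "j < len"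
  obtains xs fs where "is_path E xs fs" "hd xs = us ! j" "last xs = us ! i" "set xs \<subseteq> set us"
    "set fs = (!) es ` {i..<j}"
proof -
  have "is_path E (drop i (take (Suc j) us)) (drop i (take j (butlast es)))"
    "hd (drop i (take (Suc j) us)) = us ! i" "last (drop i (take (Suc j) us)) = us ! j"
    using path_drop[OF path_take(1)[OF path_U assms(2)], of i] path_take(3)[OF path_U assms(2)] assms
    by auto
  moreover have "set (drop i (take j (butlast es))) = (!) es ` {i..<j}"
  proof -
    have "take j (butlast es) = take j es" using assms cycD(2) by (simp add: take_butlast)
    then show ?thesis using set_drop_take_image[of i j es] assms cycD(2) by simp
  qed
  moreover have "set (drop i (take (Suc j) us)) \<subseteq> set us"
    by (meson set_drop_subset set_take_subset subset_trans)
  ultimately show thesis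
    using that[of "rev (drop i (take (Suc j) us))" "rev (drop i (take j (butlast es)))"]
      path_rev[of E "drop i (take (Suc j) us)"] path_nonempty[of E "drop i (take (Suc j) us)"]
    by (simp add: hd_rev last_rev)
qed

text \<open>The path runs from \<open>us ! j\<close> to the end of the list, through the closing
  edge, and from the start to \<open>us ! i\<close>. The direction is the one needed to close an ear
  from i to j.\<close>

lemma arc_outer:
  assumes "i < j" "j < len"
  obtains xs fs where "is_path E xs fs" "hd xs = us ! j" "last xs = us ! i" "set xs \<subseteq> set us"
    "set fs = (!) es ` ({..<len} - {i..<j})"
proof -
  have lb: "length (butlast es) = len - 1" using cycD(2) by simp
  let ?z = "us ! (len - 1)"
  have p1: "is_path E (drop j us) (drop j (butlast es))" "hd (drop j us) = us ! j" "last (drop j us) = ?z"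
    using path_drop[OF path_U assms(2)] cycD(1) by (auto simp: last_conv_nth)
  have i: "i < len" using assms by simp
  have p2: "is_path E (take (Suc i) us) (take i (butlast es))" "hd (take (Suc i) us) = us ! 0"
    "last (take (Suc i) us) = us ! i"
    using path_take[OF path_U i] cycD(1) by (auto simp: hd_conv_nth)
  have e: "es ! (len - 1) \<in> E" "ends (es ! (len - 1)) = {?z, us ! 0}"
    using cycD(1,2,5) cycD(6)[of "len - 1"] by (auto simp: subset_iff)
  have s2: "set (take (Suc i) us) = (!) us ` {..i}"
    using nth_image[of "Suc i" us] i by (simp add: atLeast0LessThan lessThan_Suc_atMost)
  have s1: "set (drop j us) = (!) us ` {j..<len}"
    using set_drop_take_image[of j len us] assms by simp
  have z2: "?z \<notin> set (take (Suc i) us)"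
    using us_inj assms by (auto simp: s2)
  have p3: "is_path E (?z # take (Suc i) us) (es ! (len - 1) # take i (butlast es))"
    using path_cons[OF p2(1) e(1)] e(2) p2(2) z2 by simp
  have int: "set (drop j us) \<inter> set (?z # take (Suc i) us) = {hd (?z # take (Suc i) us)}"
  proof -
    have "?z \<in> (!) us ` {j..<len}" by (rule image_eqI[of _ _ "len - 1"]) (use assms in auto)
    moreover have "(!) us ` {j..<len} \<inter> (!) us ` {..i} = {}" using us_inj assms by auto
    ultimately show ?thesis unfolding s1 by (simp add: s2)
  qed
  note p = path_append[OF p1(1) p3 _ int]
  let ?xs = "drop j us @ tl (?z # take (Suc i) us)"
  let ?fs = "drop j (butlast es) @ es ! (len - 1) # take i (butlast es)"
  have es': "butlast es ! k = es ! k" if "k < len - 1" for k using that lb by (simp add: nth_butlast)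
  have "set (drop j (butlast es)) = (!) es ` {j..<len - 1}"
    using set_drop_take_image[of j "len - 1" "butlast es"] assms lb es' by auto
  moreover have "set (take i (butlast es)) = (!) es ` {0..<i}"
    using set_drop_take_image[of 0 i "butlast es"] assms lb es' by auto
  ultimately have "set ?fs = (!) es ` ({j..<len - 1} \<union> {len - 1} \<union> {0..<i})" by auto
  moreover have "{j..<len - 1} \<union> {len - 1} \<union> {0..<i} = {..<len} - {i..<j}" using assms by auto
  ultimately have "set ?fs = (!) es ` ({..<len} - {i..<j})" by (simp only:)
  moreover have "set ?xs \<subseteq> set us" by (auto dest: in_set_dropD in_set_takeD)
  moreover have "is_path E ?xs ?fs" "hd ?xs = us ! j" "last ?xs = us ! i"
    using p p1 p2(3) path_nonempty[OF p2(1)] by auto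
  ultimately show thesis using that by blast
qed

text \<open>The arc selected by \<open>between\<close> has the same switched sign as the ear. Around
  the circuit the switching factors at the two attachment vertices occur twice and cancel, so the
  product of the original signs is 1 as well.\<close>

lemma coverable_ear:
  assumes "ear i j xs fs"
  defines "B \<equiv> between i j (prod eps (set fs))"
  shows "coverable ((!) es ` B) (length fs + card B)"
proof -
  have ij: "i < j" "j < len" and p: "is_path (E - set es) xs fs" "hd xs = us ! i" "last xs = us ! j"
    and int: "set xs \<inter> set us = {us ! i, us ! j}"
    using assms(1) by (auto simp: ear_def)
  have pE: "is_path E xs fs" by (rule path_mono[OF p(1)]) blast
  have fsE: "set fs \<subseteq> E" "set fs \<inter> set es = {}" using p(1) by (auto simp: is_path_def)
  have ne: "us ! i \<noteq> us ! j" using us_inj ij by simp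
  have BI: "B \<subseteq> {..<len}" using ij by (auto simp: B_def between_def)
  obtain ys gs where q: "is_path E ys gs" "hd ys = us ! j" "last ys = us ! i" "set ys \<subseteq> set us"
    "set gs = (!) es ` B"
  proof (cases "prod eps (set fs) = 1")
    case True
    then show thesis using arc_inner[OF ij] that by (auto simp: B_def between_def)
  next
    case False
    then show thesis using arc_outer[OF ij] that by (auto simp: B_def between_def)
  qed
  have gs: "set gs \<subseteq> set es" using q(5) BI es_image_all by blast
  have "us ! j \<in> set ys" "us ! i \<in> set ys"
    using q(2,3) hd_in_set[OF path_nonempty[OF q(1)]] last_in_set[OF path_nonempty[OF q(1)]] by auto
  then have r: "ring (set xs \<union> set ys) (set fs \<union> set gs)"
    using p q int ne gs fsE(2) by (intro cyc_two_paths[OF pE q(1)]) auto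
  have "prod eps (set fs) * prod eps (set gs) = 1"
    using prod_eps_cases[OF fsE(1)] prod_eps_between[OF ij] q(5) unfolding B_def between_def by auto
  moreover have "prod \<sigma> (set fs \<union> set gs) = prod \<sigma> (set fs) * prod \<sigma> (set gs)"
    using fsE(2) gs by (intro prod.union_disjoint) auto
  moreover have "prod \<sigma> (set fs) = s (us ! i) * s (us ! j) * prod eps (set fs)"
    using prod_switched_path[OF pE, of s, OF pm] p by simp
  moreover have "prod \<sigma> (set gs) = s (us ! j) * s (us ! i) * prod eps (set gs)"
    using prod_switched_path[OF q(1), of s, OF pm] q by simp
  ultimately have "prod \<sigma> (set fs \<union> set gs) = 1"
    using pm_square[OF pm[of "us ! i"]] pm_square[OF pm[of "us ! j"]] by (simp add: algebra_simps)
  then have "coverable (set fs \<union> set gs) (card (set fs \<union> set gs))"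
    by (rule coverable_ring[OF r])
  moreover have "card (set fs \<union> set gs) \<le> length fs + card B"
    using card_Un_le[of "set fs" "set gs"] card_length[of fs] q(5) card_es_image[OF BI] by simp
  ultimately show ?thesis using q(5) by (auto intro: coverable_mono)
qed

text \<open>Well defined because G is cubic: every vertex of U has exactly one edge outside U.\<close>

definition spoke :: "nat \<Rightarrow> 'e" where
  "spoke i = (THE e. e \<in> E - set es \<and> us ! i \<in> ends e)"

lemma spoke:
  assumes "i < len"
  shows "spoke i \<in> E" "spoke i \<notin> set es" "us ! i \<in> ends (spoke i)"
    "\<And>e. e \<in> E \<Longrightarrow> e \<notin> set es \<Longrightarrow> us ! i \<in> ends e \<Longrightarrow> e = spoke i"
proof -
  let ?v = "us ! i"
  have v: "?v \<in> set us" using assms by simp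
  have "card {e \<in> E. ?v \<in> ends e} = 3" using deg_3[of ?v] us_V v by (auto simp: deg_def)
  moreover have "card {e \<in> set es. ?v \<in> ends e} = 2" using ringD(7)[OF ring_U v] by (simp add: deg_def)
  moreover have "{e \<in> E. ?v \<in> ends e} - {e \<in> set es. ?v \<in> ends e} = {e. e \<in> E - set es \<and> ?v \<in> ends e}"
    by blast
  moreover have "{e \<in> set es. ?v \<in> ends e} \<subseteq> {e \<in> E. ?v \<in> ends e}" using cycD(5) by blast
  ultimately have "card {e. e \<in> E - set es \<and> ?v \<in> ends e} = 1"
    using card_Diff_subset[of "{e \<in> set es. ?v \<in> ends e}" "{e \<in> E. ?v \<in> ends e}"] by simp
  then obtain e where "{e. e \<in> E - set es \<and> ?v \<in> ends e} = {e}"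
    by (auto simp: card_1_singleton_iff)
  then have "x \<in> E - set es \<and> ?v \<in> ends x \<longleftrightarrow> x = e" for x
    unfolding set_eq_iff mem_Collect_eq singleton_iff by blast
  then have ex: "\<exists>!e. e \<in> E - set es \<and> ?v \<in> ends e" by simp
  from theI'[OF ex] show "spoke i \<in> E" "spoke i \<notin> set es" "?v \<in> ends (spoke i)"
    unfolding spoke_def by auto
  with ex show "\<And>e. e \<in> E \<Longrightarrow> e \<notin> set es \<Longrightarrow> ?v \<in> ends e \<Longrightarrow> e = spoke i" by blast
qed

section \<open>Components off the circuit and the ears through them\<close>

definition off_edges :: "'e set" where
  "off_edges = {e \<in> E. ends e \<inter> set us = {}}"

lemma off_edges: "off_edges \<subseteq> E" "off_edges \<inter> set es = {}" "e \<in> off_edges \<Longrightarrow> eps e = 1"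
proof -
  show "off_edges \<subseteq> E" "e \<in> off_edges \<Longrightarrow> eps e = 1" by (auto simp: off_edges_def off)
  show "off_edges \<inter> set es = {}"
    using ringD(6)[OF ring_U] by (fastforce simp: off_edges_def ends_def)
qed

definition att :: "'v set \<Rightarrow> nat \<Rightarrow> bool" where
  "att K i \<longleftrightarrow> i < len \<and> (\<exists>w \<in> K - set us. ends (spoke i) = {us ! i, w})"

lemma comp_off: "w \<notin> set us \<Longrightarrow> comp off_edges w \<inter> set us = {}"
  using adj_rtrancl_in[of w _ off_edges "- set us"] by (auto simp: comp_def off_edges_def)

text \<open>One leg of an ear or of a claw. As built in \<open>stemI\<close> it is a spoke followed
  by positive edges off U, so the spoke alone decides its sign.\<close>

definition stem :: "nat \<Rightarrow> 'v \<Rightarrow> 'v list \<Rightarrow> 'e list \<Rightarrow> bool" where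
  "stem i c xs fs \<longleftrightarrow> i < len \<and> is_path (E - set es) xs fs \<and> hd xs = us ! i \<and> last xs = c \<and>
     set xs \<inter> set us = {us ! i} \<and> c \<notin> set us \<and> prod eps (set fs) = eps (spoke i)"

lemma stemI:
  assumes "i < len" "ends (spoke i) = {us ! i, w}" "w \<notin> set us"
    and p: "is_path off_edges ws gs" "hd ws = w"
  shows "stem i (last ws) (us ! i # ws) (spoke i # gs)" "set ws \<subseteq> comp off_edges w"
proof -
  note sp = spoke[OF assms(1)]
  have gs: "set gs \<subseteq> off_edges" using p(1) by (simp add: is_path_def)
  show sub: "set ws \<subseteq> comp off_edges w"
  proof
    fix x assume "x \<in> set ws"
    then have "(w, x) \<in> (adj (set gs))\<^sup>*"
      using path_connected[OF p(1), of w x] p(2) path_nonempty[OF p(1)] by auto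
    then show "x \<in> comp off_edges w" using adj_rtrancl_mono[OF gs] by (simp add: comp_def)
  qed
  have dis: "set ws \<inter> set us = {}" using sub comp_off[OF assms(3)] by blast
  have ui: "us ! i \<in> set us" using assms(1) by simp
  have "is_path (E - set es) ws gs"
    by (rule path_mono[OF p(1)]) (use off_edges in blast)
  then have "is_path (E - set es) (us ! i # ws) (spoke i # gs)"
    by (rule path_cons) (use assms(2) p(2) sp(1,2) dis ui in auto)
  moreover have "last ws \<notin> set us" using dis last_in_set[OF path_nonempty[OF p(1)]] by blast
  moreover have "prod eps (set (spoke i # gs)) = eps (spoke i)"
  proof -
    have "prod eps (set gs) = 1" using gs off_edges(3) by (intro prod.neutral) blast
    moreover have "spoke i \<notin> set gs" using gs sp(3) ui by (auto simp: off_edges_def)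
    ultimately show ?thesis by simp
  qed
  ultimately show "stem i (last ws) (us ! i # ws) (spoke i # gs)"
    using assms(1) dis ui path_nonempty[OF p(1)] by (auto simp: stem_def)
qed

lemma ear_of_stems:
  assumes "stem i c xs fs" "stem j c ys gs" "i < j" "set xs \<inter> set ys = {c}"
  shows "\<exists>zs hs. ear i j zs hs \<and> length hs = length fs + length gs \<and>
    prod eps (set hs) = eps (spoke i) * eps (spoke j)"
proof -
  have x: "is_path (E - set es) xs fs" "hd xs = us ! i" "last xs = c" "set xs \<inter> set us = {us ! i}"
    "prod eps (set fs) = eps (spoke i)" using assms(1) by (auto simp: stem_def)
  have y: "j < len" "is_path (E - set es) ys gs" "hd ys = us ! j" "last ys = c"
    "set ys \<inter> set us = {us ! j}" "prod eps (set gs) = eps (spoke j)"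
    using assms(2) by (auto simp: stem_def)
  have r: "is_path (E - set es) (rev ys) (rev gs)" "hd (rev ys) = c" "last (rev ys) = us ! j"
    using path_rev[OF y(2)] path_nonempty[OF y(2)] y by (auto simp: hd_rev last_rev)
  note p = path_append[OF x(1) r(1)]
  have d: "set fs \<inter> set gs = {}"
  proof (rule equals0I)
    fix e assume e: "e \<in> set fs \<inter> set gs"
    then have "ends e \<subseteq> {c}"
      using path_ends_subset[OF x(1), of e] path_ends_subset[OF y(2), of e] assms(4) by blast
    moreover have "e \<in> E" using e x(1) by (auto simp: is_path_def)
    ultimately show False using card_ends[of e] card_mono[of "{c}" "ends e"] by simp
  qed
  have "ear i j (xs @ tl (rev ys)) (fs @ rev gs)"
    unfolding ear_def using assms(3,4) p x r y by auto
  moreover have "prod eps (set (fs @ rev gs)) = eps (spoke i) * eps (spoke j)"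
    using prod.union_disjoint[of "set fs" "set gs" eps] d x(5) y(6) by simp
  ultimately show ?thesis by (intro exI[of _ "xs @ tl (rev ys)"] exI[of _ "fs @ rev gs"]) simp
qed

text \<open>The edges off U are positive and the component is connected, so a path inside it joins
  the two spokes without changing their sign.\<close>

lemma att_ear:
  assumes "w \<notin> set us" "att (comp off_edges w) i" "att (comp off_edges w) j" "i < j"
  obtains xs fs where "ear i j xs fs" "prod eps (set fs) = eps (spoke i) * eps (spoke j)"
proof -
  obtain a where a: "a \<in> comp off_edges w" "a \<notin> set us" "ends (spoke i) = {us ! i, a}" "i < len"
    using assms(2) by (auto simp: att_def)
  obtain b where b: "b \<in> comp off_edges w" "b \<notin> set us" "ends (spoke j) = {us ! j, b}" "j < len"
    using assms(3) by (auto simp: att_def)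
  have "(a, b) \<in> (adj off_edges)\<^sup>*"
    using a(1) b(1) adj_rtrancl_sym by (auto simp: comp_def intro: rtrancl_trans)
  then obtain ws gs where p: "is_path off_edges ws gs" "hd ws = a" "last ws = b"
    by (rule path_exists)
  have s1: "stem i b (us ! i # ws) (spoke i # gs)" and sub: "set ws \<subseteq> comp off_edges a"
    using stemI[OF a(4,3,2) p(1,2)] p(3) by auto
  have s2: "stem j b (us ! j # [b]) (spoke j # [])"
    using stemI(1)[OF b(4,3,2), of "[b]" "[]"] by simp
  have bw: "b \<in> set ws" using p last_in_set[OF path_nonempty[OF p(1)]] by auto
  have "set ws \<inter> set us = {}" using sub comp_off[OF a(2)] by blast
  then have "set (us ! i # ws) \<inter> set (us ! j # [b]) = {b}"
    using a(2,4) b(2,4) us_inj[of i j] assms(4) bw nth_mem[of i us] nth_mem[of j us] by auto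
  from ear_of_stems[OF s1 s2 assms(4) this] show thesis using that by blast
qed


text \<open>Apart from its first and last edge, which are spokes, such an ear stays inside one
  component off U. Its sign thus depends only on where it attaches, which is the converse of
  \<open>att_ear\<close>.\<close>

lemma ear_interior:
  assumes "ear i j xs fs" "v \<in> set xs" "v \<notin> set us"
  shows "att (comp off_edges v) i" "att (comp off_edges v) j"
    "prod eps (set fs) = eps (spoke i) * eps (spoke j)"
proof -
  have ij: "i < j" "j < len" "i < len" and p: "is_path (E - set es) xs fs" "hd xs = us ! i" "last xs = us ! j"
    and int: "set xs \<inter> set us = {us ! i, us ! j}"
    using assms(1) by (auto simp: ear_def)
  have vn: "v \<noteq> us ! i" "v \<noteq> us ! j" using assms(3) ij by auto
  have ne: "us ! i \<noteq> us ! j" using us_inj ij by simp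
  obtain xs1 where xs1: "xs = us ! i # xs1" using p(2) path_nonempty[OF p(1)] by (cases xs) auto
  have "xs1 \<noteq> []" using xs1 p(3) ne by auto
  then obtain ws where ws: "xs1 = ws @ [us ! j]" using xs1 p(3) by (metis append_butlast_last_id last_ConsR)
  have xs: "xs = us ! i # ws @ [us ! j]" using xs1 ws by simp
  have vws: "v \<in> set ws" using assms(2) vn xs by auto
  then have wsne: "ws \<noteq> []" by auto
  have lf: "length fs = Suc (length ws)" using p(1) xs by (simp add: is_path_def)
  then obtain e fs1 where fs1: "fs = e # fs1" by (cases fs) auto
  then have "fs1 \<noteq> []" using lf wsne by auto
  then obtain gs e' where fs: "fs = e # gs @ [e']" using fs1 by (metis rev_exhaust)
  have lg: "length ws = Suc (length gs)" using lf fs by simp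
  have q1: "is_path (E - set es) (ws @ [us ! j]) (gs @ [e'])"
    using path_drop(1)[OF p(1), of 1] xs fs by simp
  have q: "is_path (E - set es) ws gs"
    using path_take(1)[OF q1, of "length gs"] lg by simp
  have dw: "set ws \<inter> set us = {}"
  proof (rule equals0I)
    fix x assume x: "x \<in> set ws \<inter> set us"
    then have "x \<in> {us ! i, us ! j}" using int xs by auto
    then show False using p(1) x xs by (auto simp: is_path_def)
  qed
  have gs: "set gs \<subseteq> off_edges"
  proof
    fix g assume g: "g \<in> set gs"
    then have "ends g \<subseteq> set ws" using path_ends_subset[OF q] by blast
    then show "g \<in> off_edges" using g q dw by (auto simp: off_edges_def is_path_def)
  qed
  have conn_ws: "x \<in> comp off_edges v" if "x \<in> set ws" for x
    using path_connected[OF q vws that] adj_rtrancl_mono[OF gs] by (simp add: comp_def)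
  have eE: "e \<in> E - set es" "e' \<in> E - set es" using p(1) fs by (auto simp: is_path_def)
  have ee: "ends e = {us ! i, hd ws}"
    using p(1) wsne fs xs by (auto simp: is_path_def hd_append hd_conv_nth nth_append)
  have "ends ((gs @ [e']) ! length gs) = {(ws @ [us ! j]) ! length gs, (ws @ [us ! j]) ! Suc (length gs)}"
    using q1 by (auto simp: is_path_def)
  then have ee': "ends e' = {us ! j, last ws}"
    using wsne lg by (auto simp: nth_append last_conv_nth)
  have e: "e = spoke i" using spoke(4)[OF ij(3), of e] eE(1) ee by auto
  have e': "e' = spoke j" using spoke(4)[OF ij(2), of e'] eE(2) ee' by auto
  have hw: "hd ws \<in> set ws" "last ws \<in> set ws" using wsne by auto
  show "att (comp off_edges v) i"
    using ee e hw(1) conn_ws dw ij(3) unfolding att_def by blast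
  show "att (comp off_edges v) j"
    using ee' e' hw(2) conn_ws dw ij(2) unfolding att_def by blast
  have dist: "distinct fs" by (rule path_distinct_edges[OF p(1)])
  have "prod eps (set gs) = 1" using gs off_edges(3) by (intro prod.neutral) blast
  then show "prod eps (set fs) = eps (spoke i) * eps (spoke j)"
    using dist fs e e' by (simp add: mult.commute)
qed

lemma chord_ear:
  assumes "i < j" "j < len" "ends (spoke i) = {us ! i, us ! j}"
  shows "ear i j [us ! i, us ! j] [spoke i]"
proof -
  have i: "i < len" using assms by simp
  have "us ! i \<noteq> us ! j" using us_inj[OF i assms(2)] assms(1) by simp
  then have "is_path (E - set es) [us ! i, us ! j] [spoke i]"
    using spoke(1,2)[OF i] assms(3) by (simp add: is_path_def)
  then show ?thesis using assms(1,2) i by (simp add: ear_def)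
qed

text \<open>
  If no balanced circuit through an ear contains the t-th edge of U, then a further switching makes
  this edge the only negative one.
\<close>

lemma ear_covers:
  assumes t: "t < len"
  shows "\<exists>i j xs fs. ear i j xs fs \<and> t \<in> between i j (prod eps (set fs))"
proof (rule ccontr)
  assume no: "\<not> ?thesis"
  \<comment> \<open>Switching the vertices of U after position t moves the negative edge of U from
    the last position to t.\<close>
  define \<theta> :: "nat \<Rightarrow> int" where "\<theta> i = (if t < i then -1 else 1)" for i
  have \<theta>2: "\<theta> i * \<theta> i = 1" for i by (simp add: \<theta>_def)
  have \<theta>pm: "\<theta> i \<in> {1, -1}" for i by (simp add: \<theta>_def)
  \<comment> \<open>An ear whose arc misses the t-th edge has exactly the sign that this switching
    turns positive.\<close>
  have ear_sign: "prod eps (set fs) = \<theta> i * \<theta> j" if ear: "ear i j xs fs" for i j xs fs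
  proof -
    have "set fs \<subseteq> E" "i < j" using ear by (auto simp: ear_def is_path_def)
    have nb: "t \<notin> between i j (prod eps (set fs))" using no ear by blast
    consider "prod eps (set fs) = 1" | "prod eps (set fs) = -1"
      using prod_eps_cases[OF \<open>set fs \<subseteq> E\<close>] by blast
    then show ?thesis
    proof cases
      case 1
      then have "t \<notin> {i..<j}" using nb by (simp add: between_def)
      then show ?thesis using 1 \<open>i < j\<close> by (auto simp: \<theta>_def)
    next
      case 2
      then have "t \<in> {i..<j}" using nb t by (simp add: between_def)
      then show ?thesis using 2 by (auto simp: \<theta>_def)
    qed
  qed
  have eps2: "eps e * eps e = 1" if "e \<in> E" for e
    using pm_square[OF eps_pm[OF that]] .
  have att_lt: "eps (spoke i) * \<theta> i = eps (spoke j) * \<theta> j"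
    if w: "w \<notin> set us" "att (comp off_edges w) i" "att (comp off_edges w) j" "i < j" for w i j
  proof -
    obtain xs fs where "ear i j xs fs" "prod eps (set fs) = eps (spoke i) * eps (spoke j)"
      by (rule att_ear[OF w])
    then have "eps (spoke i) * eps (spoke j) = \<theta> i * \<theta> j" using ear_sign by metis
    moreover have "spoke i \<in> E" "spoke j \<in> E" using w(2,3) spoke(1) by (auto simp: att_def)
    ultimately show ?thesis
      using eps_pm[of "spoke i"] eps_pm[of "spoke j"] \<theta>pm[of i] \<theta>pm[of j] by auto
  qed
  have att_eq: "eps (spoke i) * \<theta> i = eps (spoke j) * \<theta> j"
    if "w \<notin> set us" "att (comp off_edges w) i" "att (comp off_edges w) j" for w i j
  proof (cases i j rule: linorder_cases)
    case less
    then show ?thesis by (rule att_lt[OF that])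
  next
    case greater
    then show ?thesis by (rule att_lt[OF that(1,3,2), symmetric])
  qed simp
  \<comment> \<open>The sign for a whole component off U that makes its spokes positive. By
    \<open>att_eq\<close> all its spokes ask for the same sign; the value 1 is a default for sets
    without spokes.\<close>
  define \<rho> where "\<rho> K = (if \<exists>i. att K i then (let i = SOME i. att K i in eps (spoke i) * \<theta> i) else 1)" for K
  have \<rho>_att: "\<rho> (comp off_edges w) = eps (spoke i) * \<theta> i"
    if w: "w \<notin> set us" "att (comp off_edges w) i" for w i
  proof -
    define k where "k = (SOME i. att (comp off_edges w) i)"
    have "att (comp off_edges w) k" unfolding k_def using w(2) by (rule someI)
    then have "eps (spoke k) * \<theta> k = eps (spoke i) * \<theta> i" by (rule att_eq[OF w(1) _ w(2)])
    moreover have "\<rho> (comp off_edges w) = eps (spoke k) * \<theta> k"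
      unfolding \<rho>_def Let_def k_def[symmetric] using w(2) by (intro if_P exI)
    ultimately show ?thesis by simp
  qed
  have \<rho>pm: "\<rho> K \<in> {1, -1}" for K
  proof (cases "\<exists>i. att K i")
    case True
    then have "att K (SOME i. att K i)" by (rule someI_ex)
    then have "spoke (SOME i. att K i) \<in> E" using spoke(1) by (auto simp: att_def)
    then show ?thesis using True eps_pm[of "spoke (SOME i. att K i)"] \<theta>pm[of "SOME i. att K i"]
      by (auto simp: \<rho>_def Let_def)
  qed (simp add: \<rho>_def)
  define g where "g v = (if v \<in> set us then \<theta> (THE i. i < len \<and> us ! i = v) else \<rho> (comp off_edges v))" for v
  have gpm: "g v \<in> {1, -1}" for v using \<theta>pm \<rho>pm by (simp add: g_def)
  have g_us: "g (us ! i) = \<theta> i" if "i < len" for i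
  proof -
    have "(THE j. j < len \<and> us ! j = us ! i) = i"
      using that us_inj by (intro the_equality) auto
    then show ?thesis using that by (simp add: g_def)
  qed
  define s' where "s' v = s v * g v" for v
  have s'pm: "s' v \<in> {1, -1}" for v using pm[of v] gpm[of v] by (auto simp: s'_def)
  have sw: "switched s' e = eps e * g x * g y" if "ends e = {x, y}" for e x y
    using switched_ends[OF that] by (simp add: s'_def mult_ac)
  \<comment> \<open>Edges of U are settled by \<theta>, edges off U because g is constant on
    components, chords by \<open>ear_sign\<close>, and the other spokes by \<rho>.\<close>
  have "switched s' e = (if e = es ! t then -1 else 1)" if e: "e \<in> E" for e
  proof (cases "e \<in> set es")
    case True
    then obtain j where j: "j < len" "e = es ! j" using cycD(2) by (auto simp: in_set_conv_nth)
    have "Suc j mod len < len" using j(1) by (intro mod_less_divisor) linarith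
    then have 1: "switched s' e = eps e * \<theta> j * \<theta> (Suc j mod len)"
      using sw[OF cycD(6)[OF j(1)]] g_us j by simp
    have 2: "e = es ! t \<longleftrightarrow> j = t" using j t cycD(2,4) by (simp add: nth_eq_iff_index_eq)
    show ?thesis
    proof (cases "Suc j = len")
      case True
      then show ?thesis unfolding 1 2 using on[OF j(1)] j t by (auto simp: \<theta>_def)
    next
      case False
      then have "Suc j mod len = Suc j" using j by simp
      then show ?thesis unfolding 1 2 using on[OF j(1)] j False by (auto simp: \<theta>_def)
    qed
  next
    case False
    have net: "e \<noteq> es ! t" using False t cycD(2) by auto
    show ?thesis
    proof (cases "ends e \<inter> set us = {}")
      case True
      have "e \<in> off_edges" using e True by (simp add: off_edges_def)
      then have "comp off_edges (tail G e) = comp off_edges (head G e)"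
        by (rule comp_edge_eq) (auto simp: ends_def)
      then have "g (tail G e) = g (head G e)" using True by (simp add: g_def ends_def)
      then show ?thesis
        using sw[of e "tail G e" "head G e"] off[OF e True] pm_square[OF gpm[of "head G e"]] net
        by (simp add: ends_def)
    next
      case ne: False
      then obtain i where i: "i < len" "us ! i \<in> ends e" by (auto simp: in_set_conv_nth)
      have sp: "e = spoke i" by (rule spoke(4)[OF i(1) e False i(2)])
      obtain y where y: "ends e = {us ! i, y}" "y \<noteq> us ! i" by (rule ends_other[OF e i(2)])
      show ?thesis
      proof (cases "y \<in> set us")
        case True
        then obtain j where j: "j < len" "y = us ! j" by (auto simp: in_set_conv_nth)
        have spj: "e = spoke j" using spoke(4)[OF j(1) e False] y j by simp
        have "i \<noteq> j" using y j by auto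
        then have "eps e = \<theta> i * \<theta> j"
        proof (cases "i < j")
          case True
          then have "ear i j [us ! i, us ! j] [spoke i]" using chord_ear j y sp by simp
          then show ?thesis using ear_sign sp by fastforce
        next
          case False
          then have "ear j i [us ! j, us ! i] [spoke j]"
            using chord_ear[of j i] i j y spj \<open>i \<noteq> j\<close> by (simp add: insert_commute)
          then show ?thesis using ear_sign spj by fastforce
        qed
        then have "switched s' e = (\<theta> i * \<theta> i) * (\<theta> j * \<theta> j)"
          using sw[OF y(1)] g_us i j by (simp add: mult_ac)
        then show ?thesis using net \<theta>2 by simp
      next
        case False
        have "att (comp off_edges y) i"
          using i(1) y(1) False sp by (auto simp: att_def)
        then have "g y = eps e * \<theta> i" using \<rho>_att False sp by (simp add: g_def)
        then have "switched s' e = (eps e * eps e) * (\<theta> i * \<theta> i)"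
          using sw[OF y(1)] g_us i by (simp add: mult_ac)
        then show ?thesis using net \<theta>2 eps2[OF e] by simp
      qed
    qed
  qed
  moreover have "es ! t \<in> E" using t cycD(2,5) by (auto simp: subset_iff)
  ultimately show False using no_single_negative[of s' "es ! t"] s'pm by blast
qed

text \<open>A stem with f edges has f - 1 vertices strictly between U and c. Those of the three
  stems are distinct, and together with c they fit into the n - len vertices off U.\<close>

lemma stems_length:
  assumes st: "stem i c xs fs" "stem j c ys gs" "stem k c zs hs"
    and int: "set xs \<inter> set ys = {c}" "set xs \<inter> set zs = {c}" "set ys \<inter> set zs = {c}"
  shows "length fs + length gs + length hs + len \<le> n + 2"
proof -
  have *: "set xs - {us ! i, c} \<subseteq> V - set us" "c \<in> V" "c \<notin> set us"
    "length fs \<le> card (set xs - {us ! i, c}) + 1" if "stem i c xs fs" for i xs fs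
  proof -
    have x: "i < len" "is_path (E - set es) xs fs" "hd xs = us ! i" "last xs = c"
      "set xs \<inter> set us = {us ! i}" "c \<notin> set us" using that by (auto simp: stem_def)
    have "set xs \<subseteq> V"
      by (rule path_in_V[OF x(2)]) (use x(1,3) us_V in auto)
    then show "set xs - {us ! i, c} \<subseteq> V - set us" "c \<in> V"
      using x(4,5) last_in_set[OF path_nonempty[OF x(2)]] by auto
    show "c \<notin> set us" by fact
    have "card (set xs) \<le> card ((set xs - {us ! i, c}) \<union> {us ! i, c})" by (intro card_mono) auto
    also have "\<dots> \<le> card (set xs - {us ! i, c}) + card {us ! i, c}" by (rule card_Un_le)
    also have "card {us ! i, c} \<le> 2" by (simp add: card_insert_if)
    finally show "length fs \<le> card (set xs - {us ! i, c}) + 1" using path_card(2)[OF x(2)] by simp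
  qed
  let ?X = "set xs - {us ! i, c}" and ?Y = "set ys - {us ! j, c}" and ?Z = "set zs - {us ! k, c}"
  have "card (?X \<union> ?Y \<union> ?Z) = card ?X + card ?Y + card ?Z"
  proof -
    have "?X \<inter> ?Y = {}" "(?X \<union> ?Y) \<inter> ?Z = {}" using int by auto
    then show ?thesis by (simp add: card_Un_disjoint)
  qed
  moreover have "card (insert c (?X \<union> ?Y \<union> ?Z)) = Suc (card (?X \<union> ?Y \<union> ?Z))"
    by (rule card_insert_disjoint) auto
  moreover have "card (insert c (?X \<union> ?Y \<union> ?Z)) \<le> card (V - set us)"
    using *[OF st(1)] *[OF st(2)] *[OF st(3)] by (intro card_mono) auto
  moreover have "card (V - set us) = n - len" "len \<le> n"
    using us_V card_us card_mono[OF finite_verts us_V] by (simp_all add: card_Diff_subset)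
  ultimately show ?thesis using *(4)[OF st(1)] *(4)[OF st(2)] *(4)[OF st(3)] by linarith
qed

text \<open>
  U together with a subdivided claw attached at three vertices, such that no leg pair closes the
  corresponding third of U to a balanced circuit, is a subdivision of the complete graph on four
  vertices. Its three balanced circuits cover every edge twice, and any two of them cover everything.
\<close>

lemma coverable_claw:
  assumes w: "w \<notin> set us"
    and att: "att (comp off_edges w) i" "att (comp off_edges w) j" "att (comp off_edges w) k"
    and ijk: "i < j" "j < k"
    and alt: "eps (spoke i) \<noteq> eps (spoke j)" "eps (spoke j) \<noteq> eps (spoke k)"
  shows "\<exists>m. coverable (set es) m \<and> 3 * m \<le> 4 * n + 3 * len"
proof -
  obtain a where a: "a \<in> comp off_edges w" "a \<notin> set us" "ends (spoke i) = {us ! i, a}" "i < len"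
    using att(1) by (auto simp: att_def)
  obtain b where b: "b \<in> comp off_edges w" "b \<notin> set us" "ends (spoke j) = {us ! j, b}" "j < len"
    using att(2) by (auto simp: att_def)
  obtain d where d: "d \<in> comp off_edges w" "d \<notin> set us" "ends (spoke k) = {us ! k, d}" "k < len"
    using att(3) by (auto simp: att_def)
  have conn': "(x, y) \<in> (adj off_edges)\<^sup>*" if "x \<in> comp off_edges w" "y \<in> comp off_edges w" for x y
    using that adj_rtrancl_sym by (auto simp: comp_def intro: rtrancl_trans)
  obtain ws gs where p: "is_path off_edges ws gs" "hd ws = a" "last ws = b"
    using path_exists[OF conn'[OF a(1) b(1)]] by blast
  obtain zs0 hs0 where p0: "is_path off_edges zs0 hs0" "hd zs0 = d" "last zs0 = a"
    using path_exists[OF conn'[OF d(1) a(1)]] by blast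
  have aw: "a \<in> set ws" using p(2) hd_in_set[OF path_nonempty[OF p(1)]] by simp
  \<comment> \<open>The first vertex met on ws becomes the branch vertex c of the claw. It may be a,
    b or d, and then that leg is a single spoke.\<close>
  obtain zs hs where q: "is_path off_edges zs hs" "set zs \<inter> {d} = {hd zs}" "set zs \<inter> set ws = {last zs}"
  proof -
    have "hd zs0 \<in> {d}" "last zs0 \<in> set ws" using p0(2,3) aw by simp_all
    then show thesis by (rule path_between_sets[OF p0(1)]) (assumption | rule that)+
  qed
  define c where "c = last zs"
  have "c \<in> set ws" using q(3) by (auto simp: c_def)
  then obtain m where m: "m < length ws" "c = ws ! m" by (auto simp: in_set_conv_nth)
  have hz: "hd zs = d" using q(2) by blast
  have s1: "stem i c (us ! i # take (Suc m) ws) (spoke i # take m gs)"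
    and sub1: "set (take (Suc m) ws) \<subseteq> comp off_edges a"
    using stemI[OF a(4,3,2) path_take(1,2)[OF p(1) m(1), unfolded p(2)]] path_take(3)[OF p(1) m(1)] m(2)
    by auto
  have pd: "is_path off_edges (rev (drop m ws)) (rev (drop m gs))" "hd (rev (drop m ws)) = b"
    "last (rev (drop m ws)) = c"
    using path_rev[OF path_drop(1)[OF p(1) m(1)]] path_drop(2,3)[OF p(1) m(1)] p(3) m
    by (auto simp: hd_rev last_rev)
  have s2: "stem j c (us ! j # rev (drop m ws)) (spoke j # rev (drop m gs))"
    and sub2: "set (drop m ws) \<subseteq> comp off_edges b"
    using stemI[OF b(4,3,2) pd(1,2)] pd(3) by auto
  have s3: "stem k c (us ! k # zs) (spoke k # hs)" and sub3: "set zs \<subseteq> comp off_edges d"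
    using stemI[OF d(4,3,2) q(1) hz] by (auto simp: c_def)
  have off: "set (take (Suc m) ws) \<inter> set us = {}" "set (drop m ws) \<inter> set us = {}" "set zs \<inter> set us = {}"
    using sub1 sub2 sub3 comp_off[OF a(2)] comp_off[OF b(2)] comp_off[OF d(2)] by blast+
  have ne: "us ! i \<noteq> us ! j" "us ! i \<noteq> us ! k" "us ! j \<noteq> us ! k"
    using us_inj a(4) b(4) d(4) ijk by auto
  have U: "us ! i \<in> set us" "us ! j \<in> set us" "us ! k \<in> set us" using a(4) b(4) d(4) by auto
  have cz: "c \<in> set zs" unfolding c_def using last_in_set[OF path_nonempty[OF q(1)]] .
  have td: "set (take (Suc m) ws) \<inter> set (drop m ws) = {c}"
    using set_take_Int_drop[OF _ m(1)] p(1) m(2) by (simp add: is_path_def)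
  have tz: "set (take (Suc m) ws) \<inter> set zs = {c}" "set (drop m ws) \<inter> set zs = {c}"
    using q(3) td cz set_take_subset[of "Suc m" ws] set_drop_subset[of m ws] unfolding c_def by blast+
  have int: "set (us ! i # take (Suc m) ws) \<inter> set (us ! j # rev (drop m ws)) = {c}"
    "set (us ! i # take (Suc m) ws) \<inter> set (us ! k # zs) = {c}"
    "set (us ! j # rev (drop m ws)) \<inter> set (us ! k # zs) = {c}"
    using off ne U td tz by auto
  define f1 where "f1 = length (spoke i # take m gs)"
  define f2 where "f2 = length (spoke j # rev (drop m gs))"
  define f3 where "f3 = length (spoke k # hs)"
  have sum: "f1 + f2 + f3 + len \<le> n + 2"
    using stems_length[OF s1 s2 s3 int] by (simp only: f1_def f2_def f3_def)
  have spE: "spoke i \<in> E" "spoke j \<in> E" "spoke k \<in> E" using spoke(1) a(4) b(4) d(4) by auto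
  \<comment> \<open>The alternation makes the ears i-j and j-k negative, so they take complementary
    arcs, while the ear i-k is positive and takes the arc from i to k.\<close>
  have sg: "eps (spoke i) * eps (spoke j) = -1" "eps (spoke j) * eps (spoke k) = -1"
    "eps (spoke i) * eps (spoke k) = 1"
    using alt eps_pm[OF spE(1)] eps_pm[OF spE(2)] eps_pm[OF spE(3)] by auto
  obtain x1 h1 where e1: "ear i j x1 h1" "length h1 = f1 + f2" "prod eps (set h1) = -1"
    using ear_of_stems[OF s1 s2 ijk(1) int(1)] sg(1) unfolding f1_def f2_def by metis
  obtain x2 h2 where e2: "ear j k x2 h2" "length h2 = f2 + f3" "prod eps (set h2) = -1"
    using ear_of_stems[OF s2 s3 ijk(2) int(3)] sg(2) unfolding f2_def f3_def by metis
  obtain x3 h3 where e3: "ear i k x3 h3" "length h3 = f1 + f3" "prod eps (set h3) = 1"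
    using ear_of_stems[OF s1 s3 less_trans[OF ijk] int(2)] sg(3) unfolding f1_def f3_def by metis
  let ?B1 = "{..<len} - {i..<j}" and ?B2 = "{..<len} - {j..<k}" and ?B3 = "{i..<k}"
  have c1: "coverable ((!) es ` ?B1) (f1 + f2 + card ?B1)"
    using coverable_ear[OF e1(1)] e1(2,3) by (simp add: between_def)
  have c2: "coverable ((!) es ` ?B2) (f2 + f3 + card ?B2)"
    using coverable_ear[OF e2(1)] e2(2,3) by (simp add: between_def)
  have c3: "coverable ((!) es ` ?B3) (f1 + f3 + card ?B3)"
    using coverable_ear[OF e3(1)] e3(2,3) by (simp add: between_def)
  have "card ({..<len} - {x..<y}) = len - (y - x)" if "x < y" "y < len" for x y
    using that by (subst card_Diff_subset) auto
  then have cards: "card ?B1 = len - (j - i)" "card ?B2 = len - (k - j)" "card ?B3 = k - i"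
    using ijk d(4) by auto
  define m1 where "m1 = f1 + f2 + card ?B1"
  define m2 where "m2 = f2 + f3 + card ?B2"
  define m3 where "m3 = f1 + f3 + card ?B3"
  have pair: "coverable (set es) (k1 + k2)"
    if "coverable ((!) es ` X) k1" "coverable ((!) es ` Y) k2" "X \<union> Y = {..<len}" for X Y k1 k2
    using coverable_Un[OF that(1,2)] that(3) es_image_all by (metis image_Un)
  have p12: "coverable (set es) (m1 + m2)"
    unfolding m1_def m2_def using ijk d(4) by (intro pair[OF c1 c2]) auto
  have p13: "coverable (set es) (m1 + m3)"
    unfolding m1_def m3_def using ijk d(4) by (intro pair[OF c1 c3]) auto
  have p23: "coverable (set es) (m2 + m3)"
    unfolding m2_def m3_def using ijk d(4) by (intro pair[OF c2 c3]) auto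
  \<comment> \<open>The three arcs have 2 len edges in all and each stem is used twice, so the total
    is 2 (f1 + f2 + f3 + len). The cheapest two circuits then cost at most 4n/3 + 8/3, which
    \<open>l3\<close> brings below 4n/3 + len.\<close>
  have tot: "m1 + m2 + m3 \<le> 2 * n + 4"
    unfolding m1_def m2_def m3_def using sum cards ijk d(4) by linarith
  have l3: "3 \<le> len" using ijk d(4) by linarith
  have "3 * (m1 + m2) \<le> 4 * n + 3 * len \<or> 3 * (m1 + m3) \<le> 4 * n + 3 * len \<or>
      3 * (m2 + m3) \<le> 4 * n + 3 * len"
  proof (rule ccontr)
    assume "\<not> ?thesis"
    then have "4 * n + 3 * len < 3 * (m1 + m2)" "4 * n + 3 * len < 3 * (m1 + m3)"
      "4 * n + 3 * len < 3 * (m2 + m3)" by simp_all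
    then show False using tot l3 unfolding distrib_left by linarith
  qed
  then show ?thesis using p12 p13 p23 by blast
qed

text \<open>
  Among three arcs of a circle with a common point p, the ones that reach furthest to either side
  of p contain the third.
\<close>

lemma between_around:
  assumes "i < j" "j < len" "p < len" "p \<in> between i j t"
  shows "\<exists>r l. \<forall>x<len. x \<in> between i j t \<longleftrightarrow>
    (if p \<le> x then x - p else x + len - p) \<le> r \<or> (if x \<le> p then p - x else p + len - x) \<le> l"
proof (cases "t = 1")
  case True
  then show ?thesis
    \<comment> \<open>The witnesses r and l count how far the arc extends forwards and backwards
      from p; in the cases below one of the two directions wraps around.\<close>
    using assms by (intro exI[of _ "j - 1 - p"] exI[of _ "p - i"]) (auto simp: between_def)
next
  case False
  then consider "p < i" | "j \<le> p" using assms by (force simp: between_def)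
  then show ?thesis
  proof cases
    case 1
    then show ?thesis
      using assms False by (intro exI[of _ "i - 1 - p"] exI[of _ "p + len - j"]) (auto simp: between_def)
  next
    case 2
    then show ?thesis
      using assms False by (intro exI[of _ "len - p + i - 1"] exI[of _ "p - j"]) (auto simp: between_def)
  qed
qed

lemma between_three:
  assumes "i1 < j1" "j1 < len" "i2 < j2" "j2 < len" "i3 < j3" "j3 < len" "p < len"
    and "p \<in> between i1 j1 t1" "p \<in> between i2 j2 t2" "p \<in> between i3 j3 t3"
  defines "A \<equiv> between i1 j1 t1" and "B \<equiv> between i2 j2 t2" and "C \<equiv> between i3 j3 t3"
  shows "A \<subseteq> B \<union> C \<or> B \<subseteq> A \<union> C \<or> C \<subseteq> A \<union> B"
proof -
  let ?f = "\<lambda>x. if p \<le> x then x - p else x + len - p"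
  let ?g = "\<lambda>x. if x \<le> p then p - x else p + len - x"
  obtain r1 l1 where 1: "\<And>x. x < len \<Longrightarrow> x \<in> A \<longleftrightarrow> ?f x \<le> r1 \<or> ?g x \<le> l1"
    using between_around[OF assms(1,2,7,8)] unfolding A_def by blast
  obtain r2 l2 where 2: "\<And>x. x < len \<Longrightarrow> x \<in> B \<longleftrightarrow> ?f x \<le> r2 \<or> ?g x \<le> l2"
    using between_around[OF assms(3,4,7,9)] unfolding B_def by blast
  obtain r3 l3 where 3: "\<And>x. x < len \<Longrightarrow> x \<in> C \<longleftrightarrow> ?f x \<le> r3 \<or> ?g x \<le> l3"
    using between_around[OF assms(5,6,7,10)] unfolding C_def by blast
  have sub: "A \<subseteq> {..<len}" "B \<subseteq> {..<len}" "C \<subseteq> {..<len}"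
    using assms(1-6) by (auto simp: A_def B_def C_def between_def)
  have gen: "X \<subseteq> Y \<union> Z"
    if X: "X \<subseteq> {..<len}" "\<And>x. x < len \<Longrightarrow> x \<in> X \<longleftrightarrow> ?f x \<le> r \<or> ?g x \<le> l"
      and Y: "\<And>x. x < len \<Longrightarrow> x \<in> Y \<longleftrightarrow> ?f x \<le> r' \<or> ?g x \<le> l'"
      and Z: "\<And>x. x < len \<Longrightarrow> x \<in> Z \<longleftrightarrow> ?f x \<le> r'' \<or> ?g x \<le> l''"
      and le: "r \<le> r' \<or> r \<le> r''" "l \<le> l' \<or> l \<le> l''" for X Y Z r l r' l' r'' l''
  proof
    fix x assume x: "x \<in> X"
    then have xl: "x < len" using X(1) by blast
    have "?f x \<le> r \<or> ?g x \<le> l" using X(2)[OF xl] x by simp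
    then have "(?f x \<le> r' \<or> ?g x \<le> l') \<or> (?f x \<le> r'' \<or> ?g x \<le> l'')"
      using le by (meson le_trans)
    then show "x \<in> Y \<union> Z" using Y[OF xl] Z[OF xl] by blast
  qed
  have "(r1 \<le> r2 \<or> r1 \<le> r3) \<and> (l1 \<le> l2 \<or> l1 \<le> l3) \<or> (r2 \<le> r1 \<or> r2 \<le> r3) \<and> (l2 \<le> l1 \<or> l2 \<le> l3) \<or>
      (r3 \<le> r1 \<or> r3 \<le> r2) \<and> (l3 \<le> l1 \<or> l3 \<le> l2)"
    by (meson le_cases)
  then show ?thesis
    using gen[OF sub(1) 1 2 3] gen[OF sub(2) 2 1 3] gen[OF sub(3) 3 1 2] by blast
qed

text \<open>
  Without an alternating triple the spokes into a component outside U change sign at most once, so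
  a single ear serves all pairs of them.
\<close>

lemma ear_merge:
  assumes e: "ear i j xs fs" "ear i' j' xs' fs'"
    and v: "v \<in> set xs" "v \<in> set xs'" "v \<notin> set us"
    and no: "\<And>i j k. \<lbrakk>att (comp off_edges v) i; att (comp off_edges v) j; att (comp off_edges v) k;
      i < j; j < k\<rbrakk> \<Longrightarrow> eps (spoke i) = eps (spoke j) \<or> eps (spoke j) = eps (spoke k)"
  shows "\<exists>a b zs hs. ear a b zs hs \<and>
    between i j (prod eps (set fs)) \<union> between i' j' (prod eps (set fs')) \<subseteq> between a b (prod eps (set hs))"
proof -
  define K where "K = comp off_edges v"
  define \<mu> where "\<mu> x = eps (spoke x)" for x
  define L where "L = {i, j, i', j'}"
  note i1 = ear_interior[OF e(1) v(1,3)] and i2 = ear_interior[OF e(2) v(2,3)]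
  have ij: "i < j" "i' < j'" using e by (auto simp: ear_def)
  have attL: "att K x" if "x \<in> L" for x
    using that i1(1,2) i2(1,2) unfolding K_def L_def by blast
  have no': "\<mu> x = \<mu> y \<or> \<mu> y = \<mu> z" if "x \<in> L" "y \<in> L" "z \<in> L" "x < y" "y < z" for x y z
    using no[of x y z] attL that unfolding K_def \<mu>_def by blast
  have prod: "\<mu> x * \<mu> y = 1 \<longleftrightarrow> \<mu> x = \<mu> y" if "x \<in> L" "y \<in> L" for x y
  proof -
    have "spoke x \<in> E" "spoke y \<in> E" using attL[OF that(1)] attL[OF that(2)] spoke(1) by (auto simp: att_def)
    then show ?thesis using eps_pm[of "spoke x"] eps_pm[of "spoke y"] by (auto simp: \<mu>_def)
  qed
  have lt: "x < len" if "x \<in> L" for x using attL[OF that] by (simp add: att_def)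
  have fin: "finite L" "L \<noteq> {}" by (auto simp: L_def)
  define m where "m = Min L"
  have m: "m \<in> L" "\<And>x. x \<in> L \<Longrightarrow> m \<le> x" using fin by (auto simp: m_def)
  have "\<exists>a b. a \<in> L \<and> b \<in> L \<and> a < b \<and>
      (\<forall>x\<in>L. \<forall>y\<in>L. x < y \<longrightarrow> between x y (\<mu> x * \<mu> y) \<subseteq> between a b (\<mu> a * \<mu> b))"
  proof (cases "\<forall>x\<in>L. \<mu> x = \<mu> m")
    case True
    \<comment> \<open>Without a sign change all arcs are intervals, and the extreme attachments span
      them all.\<close>
    define M where "M = Max L"
    have M: "M \<in> L" "\<And>x. x \<in> L \<Longrightarrow> x \<le> M" using fin by (auto simp: M_def)
    have "i \<in> L" "j \<in> L" by (auto simp: L_def)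
    then have "m < M" using m(2)[of i] M(2)[of j] ij by linarith
    moreover have "between x y (\<mu> x * \<mu> y) = {x..<y}" if "x \<in> L" "y \<in> L" for x y
    proof -
      have "\<mu> x = \<mu> y" using True that by metis
      then show ?thesis using prod[OF that] by (simp add: between_def)
    qed
    ultimately show ?thesis using m M
      by (intro exI[of _ m] exI[of _ M]) (auto intro: order_trans order_less_le_trans)
  next
    case False
    \<comment> \<open>The positions a and b enclose the only sign change among the four attachments.
      Pairs of equal sign stay on one side of it and pairs of different sign enclose it, so all
      their arcs avoid \<open>{a..<b}\<close>.\<close>
    define a where "a = Max {x \<in> L. \<mu> x = \<mu> m}"
    define b where "b = Min {x \<in> L. \<mu> x \<noteq> \<mu> m}"
    have f1: "finite {x \<in> L. \<mu> x = \<mu> m}" "{x \<in> L. \<mu> x = \<mu> m} \<noteq> {}" using fin m by auto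
    have f2: "finite {x \<in> L. \<mu> x \<noteq> \<mu> m}" "{x \<in> L. \<mu> x \<noteq> \<mu> m} \<noteq> {}" using fin False by auto
    have a: "a \<in> L" "\<mu> a = \<mu> m" "\<And>x. x \<in> L \<Longrightarrow> \<mu> x = \<mu> m \<Longrightarrow> x \<le> a"
      using Max_in[OF f1] Max_ge[OF f1(1)] by (auto simp: a_def)
    have b: "b \<in> L" "\<mu> b \<noteq> \<mu> m" "\<And>x. x \<in> L \<Longrightarrow> \<mu> x \<noteq> \<mu> m \<Longrightarrow> b \<le> x"
      using Min_in[OF f2] Min_le[OF f2(1)] by (auto simp: b_def)
    have "a < b"
    proof (rule ccontr)
      assume "\<not> a < b"
      moreover have "a \<noteq> b" "m \<noteq> b" using a(2) b(2) by auto
      ultimately have "m < b" "b < a" using m(2)[OF b(1)] by linarith+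
      then show False using no'[OF m(1) b(1) a(1)] a(2) b(2) by auto
    qed
    have ab: "between a b (\<mu> a * \<mu> b) = {..<len} - {a..<b}"
      using prod[OF a(1) b(1)] a(2) b(2) by (simp add: between_def)
    have "between x y (\<mu> x * \<mu> y) \<subseteq> {..<len} - {a..<b}" if xy: "x \<in> L" "y \<in> L" "x < y" for x y
    proof (cases "\<mu> x = \<mu> y")
      case True
      then have eq: "between x y (\<mu> x * \<mu> y) = {x..<y}" using prod[OF xy(1,2)] by (simp add: between_def)
      show ?thesis
      proof (cases "\<mu> x = \<mu> m")
        case True
        then have "y \<le> a" using a(3)[OF xy(2)] \<open>\<mu> x = \<mu> y\<close> by simp
        then show ?thesis unfolding eq using lt[OF xy(2)] by auto
      next
        case False
        then have "b \<le> x" using b(3)[OF xy(1)] by simp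
        then show ?thesis unfolding eq using lt[OF xy(2)] by auto
      qed
    next
      case False
      then have eq: "between x y (\<mu> x * \<mu> y) = {..<len} - {x..<y}"
        using prod[OF xy(1,2)] by (simp add: between_def)
      have xm: "\<mu> x = \<mu> m"
      proof (rule ccontr)
        assume x: "\<mu> x \<noteq> \<mu> m"
        then have "m < x" using m(2)[OF xy(1)] by (metis le_neq_implies_less)
        then show False using no'[OF m(1) xy(1,2) _ xy(3)] x False by metis
      qed
      then have "\<mu> y \<noteq> \<mu> m" using False by simp
      then have "x \<le> a" "b \<le> y" using a(3)[OF xy(1) xm] b(3)[OF xy(2)] by auto
      then show ?thesis unfolding eq by auto
    qed
    then show ?thesis using a(1) b(1) \<open>a < b\<close> ab by metis
  qed
  then obtain a b where ab: "a \<in> L" "b \<in> L" "a < b"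
    "\<And>x y. x \<in> L \<Longrightarrow> y \<in> L \<Longrightarrow> x < y \<Longrightarrow> between x y (\<mu> x * \<mu> y) \<subseteq> between a b (\<mu> a * \<mu> b)" by blast
  obtain zs hs where z: "ear a b zs hs" "prod eps (set hs) = \<mu> a * \<mu> b"
    using att_ear[OF v(3), of a b] attL[OF ab(1)] attL[OF ab(2)] ab(3) unfolding K_def \<mu>_def by blast
  have "prod eps (set fs) = \<mu> i * \<mu> j" "prod eps (set fs') = \<mu> i' * \<mu> j'"
    using i1(3) i2(3) by (simp_all add: \<mu>_def)
  moreover have "i \<in> L" "j \<in> L" "i' \<in> L" "j' \<in> L" by (auto simp: L_def)
  ultimately have "between i j (prod eps (set fs)) \<union> between i' j' (prod eps (set fs')) \<subseteq> between a b (prod eps (set hs))"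
    using ab(4)[of i j] ab(4)[of i' j'] ij z(2) by simp
  then show ?thesis using z(1) by blast
qed

text \<open>Take a covering family of ears with fewest members. By \<open>ear_merge\<close> no two
  of them share a vertex off U, by \<open>between_three\<close> no edge of U is covered three times,
  and each ear covers some edge of U alone. With q ears there are at most n - len + q ear edges and
  at most 2 len - q arc edges, and q cancels in the sum.\<close>

lemma coverable_no_claw:
  assumes no: "\<And>w i j k. \<lbrakk>w \<notin> set us; att (comp off_edges w) i; att (comp off_edges w) j;
      att (comp off_edges w) k; i < j; j < k\<rbrakk> \<Longrightarrow> eps (spoke i) = eps (spoke j) \<or> eps (spoke j) = eps (spoke k)"
  shows "coverable (set es) (n + len)"
proof -
  define is_ear where "is_ear = (\<lambda>(i, j, xs, fs). ear i j xs fs)"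
  define arc where "arc = (\<lambda>(i, j, xs::'v list, fs). between i j (prod eps (set fs)))"
  define edges where "edges = (\<lambda>(i::nat, j::nat, xs::'v list, fs::'e list). length fs)"
  define inner where "inner = (\<lambda>(i::nat, j::nat, xs, fs::'e list). set xs - set us)"
  define P where "P Q \<longleftrightarrow> finite Q \<and> (\<forall>q\<in>Q. is_ear q) \<and> {..<len} \<subseteq> (\<Union>q\<in>Q. arc q)" for Q
  have "\<exists>q. is_ear q \<and> t \<in> arc q" if t: "t < len" for t
  proof -
    obtain i j xs fs where "ear i j xs fs" "t \<in> between i j (prod eps (set fs))"
      using ear_covers[OF t] by blast
    then show ?thesis by (intro exI[of _ "(i, j, xs, fs)"]) (simp add: is_ear_def arc_def)
  qed
  then obtain q where q: "\<And>t. t < len \<Longrightarrow> is_ear (q t) \<and> t \<in> arc (q t)" by metis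
  have "P (q ` {..<len})" using q by (auto simp: P_def)
  then obtain Q where Q: "P Q" and min: "\<And>Q'. P Q' \<Longrightarrow> card Q \<le> card Q'"
    using ex_has_least_nat[of P _ card] by blast
  have fQ: "finite Q" and ears: "\<And>q. q \<in> Q \<Longrightarrow> is_ear q" and cov: "{..<len} \<subseteq> (\<Union>q\<in>Q. arc q)"
    using Q by (auto simp: P_def)
  have arcI: "arc q \<subseteq> {..<len}" if "is_ear q" for q
  proof -
    obtain i j xs fs where "q = (i, j, xs, fs)" by (cases q) auto
    then show ?thesis using that by (auto simp: is_ear_def ear_def arc_def between_def)
  qed
  have smaller: "\<not> {..<len} \<subseteq> (\<Union>q\<in>Q'. arc q)" if Q': "finite Q'" "card Q' < card Q" "\<And>q. q \<in> Q' \<Longrightarrow> is_ear q" for Q'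
    using min[of Q'] Q' by (auto simp: P_def)
  have priv: "\<exists>t<len. t \<in> arc q \<and> (\<forall>q'\<in>Q. t \<in> arc q' \<longrightarrow> q' = q)" if q: "q \<in> Q" for q
  proof -
    have "card (Q - {q}) < card Q" by (rule card_Diff1_less[OF fQ q])
    then have "\<not> {..<len} \<subseteq> (\<Union>q\<in>Q - {q}. arc q)" using smaller[of "Q - {q}"] fQ ears by auto
    then obtain t where "t < len" "t \<notin> (\<Union>q\<in>Q - {q}. arc q)" by blast
    then show ?thesis using cov by blast
  qed
  have disj: "inner q \<inter> inner q' = {}" if qq: "q \<in> Q" "q' \<in> Q" "q \<noteq> q'" for q q'
  proof (rule equals0I)
    fix v assume v: "v \<in> inner q \<inter> inner q'"
    obtain i j xs fs where q: "q = (i, j, xs, fs)" by (cases q) auto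
    obtain i' j' xs' fs' where q': "q' = (i', j', xs', fs')" by (cases q') auto
    have v': "v \<in> set xs" "v \<in> set xs'" "v \<notin> set us" using v by (auto simp: q q' inner_def)
    have e: "ear i j xs fs" "ear i' j' xs' fs'"
      using ears[OF qq(1)] ears[OF qq(2)] by (auto simp: q q' is_ear_def)
    obtain a b zs hs where z: "ear a b zs hs"
      "between i j (prod eps (set fs)) \<union> between i' j' (prod eps (set fs')) \<subseteq> between a b (prod eps (set hs))"
      using ear_merge[OF e v' no[OF v'(3)]] by blast
    let ?z = "(a, b, zs, hs)"
    let ?Q = "insert ?z (Q - {q, q'})"
    have "card ?Q < card Q"
    proof -
      have "card (Q - {q, q'}) = card Q - 2" "2 \<le> card Q"
        using qq fQ card_mono[OF fQ, of "{q, q'}"] by (auto simp: card_Diff_subset)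
      moreover have "card ?Q \<le> Suc (card (Q - {q, q'}))" using fQ by (simp add: card_insert_if)
      ultimately show ?thesis by linarith
    qed
    moreover have "{..<len} \<subseteq> (\<Union>q\<in>?Q. arc q)"
    proof
      fix t assume "t \<in> {..<len}"
      then obtain p where p: "p \<in> Q" "t \<in> arc p" using cov by blast
      have "arc q \<union> arc q' \<subseteq> arc ?z" using z(2) by (simp add: arc_def q q')
      then have "t \<in> arc ?z" if "p = q \<or> p = q'" using that p(2) by blast
      then show "t \<in> (\<Union>q\<in>?Q. arc q)" using p by blast
    qed
    moreover have "is_ear p" if "p \<in> ?Q" for p using that ears z(1) by (auto simp: is_ear_def)
    ultimately show False using smaller[of ?Q] fQ by blast
  qed
  have two: "card {q \<in> Q. t \<in> arc q} \<le> 2" if t: "t < len" for t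
  proof (rule ccontr)
    assume "\<not> card {q \<in> Q. t \<in> arc q} \<le> 2"
    then have "3 \<le> card {q \<in> Q. t \<in> arc q}" by simp
    then obtain X where X: "X \<subseteq> {q \<in> Q. t \<in> arc q}" "card X = 3"
      by (meson obtain_subset_with_card_n)
    then obtain q1 q2 q3 where X3: "X = {q1, q2, q3}" "q1 \<noteq> q2" "q1 \<noteq> q3" "q2 \<noteq> q3"
      by (auto simp: card_3_iff)
    obtain i1 j1 xs1 fs1 where q1: "q1 = (i1, j1, xs1, fs1)" by (cases q1) auto
    obtain i2 j2 xs2 fs2 where q2: "q2 = (i2, j2, xs2, fs2)" by (cases q2) auto
    obtain i3 j3 xs3 fs3 where q3: "q3 = (i3, j3, xs3, fs3)" by (cases q3) auto
    have mem: "q1 \<in> Q" "q2 \<in> Q" "q3 \<in> Q" "t \<in> arc q1" "t \<in> arc q2" "t \<in> arc q3"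
      using X X3 by auto
    have "arc q1 \<subseteq> arc q2 \<union> arc q3 \<or> arc q2 \<subseteq> arc q1 \<union> arc q3 \<or> arc q3 \<subseteq> arc q1 \<union> arc q2"
    proof -
      have "i1 < j1" "j1 < len" "i2 < j2" "j2 < len" "i3 < j3" "j3 < len"
        using ears[OF mem(1)] ears[OF mem(2)] ears[OF mem(3)]
        by (auto simp: q1 q2 q3 is_ear_def ear_def)
      then show ?thesis
        using between_three[of i1 j1 i2 j2 i3 j3 t] t mem(4-6) unfolding arc_def q1 q2 q3 by simp
    qed
    moreover have "\<not> arc q \<subseteq> arc q' \<union> arc q''"
      if "q \<in> Q" "q' \<in> Q" "q'' \<in> Q" "q \<noteq> q'" "q \<noteq> q''" for q q' q''
      using priv[OF that(1)] that(2-5) by blast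
    ultimately show False using mem X3 by metis
  qed
  obtain pv where pv: "\<And>q. q \<in> Q \<Longrightarrow> pv q < len \<and> pv q \<in> arc q \<and> (\<forall>q'\<in>Q. pv q \<in> arc q' \<longrightarrow> q' = q)"
    using priv by metis
  have inj: "inj_on pv Q"
  proof (rule inj_onI)
    fix q q' assume "q \<in> Q" "q' \<in> Q" "pv q = pv q'"
    then show "q = q'" using pv[of q] pv[of q'] by auto
  qed
  \<comment> \<open>The private positions, one for each ear, are covered once and the others at most
    twice.\<close>
  have arcs: "(\<Sum>q\<in>Q. card (arc q)) + card Q \<le> 2 * len"
  proof -
    have "(\<Sum>q\<in>Q. card (arc q)) = (\<Sum>q\<in>Q. \<Sum>t\<in>{t \<in> {..<len}. t \<in> arc q}. 1)"
    proof (rule sum.cong)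
      fix q assume "q \<in> Q"
      then have "{t \<in> {..<len}. t \<in> arc q} = arc q" using arcI[OF ears] by blast
      then show "card (arc q) = (\<Sum>t\<in>{t \<in> {..<len}. t \<in> arc q}. 1)" by simp
    qed simp
    also have "\<dots> = (\<Sum>t<len. \<Sum>q\<in>{q \<in> Q. t \<in> arc q}. 1)"
      using sum.swap_restrict[OF fQ finite_lessThan[of len], of "\<lambda>q t. 1::nat" "\<lambda>q t. t \<in> arc q"] .
    also have "\<dots> = (\<Sum>t<len. card {q \<in> Q. t \<in> arc q})" by simp
    finally have s: "(\<Sum>q\<in>Q. card (arc q)) = (\<Sum>t<len. card {q \<in> Q. t \<in> arc q})" .
    have "card Q = card (pv ` Q)" using card_image[OF inj] by simp
    also have "pv ` Q \<subseteq> {..<len}" using pv by auto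
    then have "card (pv ` Q) = (\<Sum>t<len. if t \<in> pv ` Q then 1 else 0)"
      by (simp add: sum.If_cases Int_absorb1)
    finally have "(\<Sum>q\<in>Q. card (arc q)) + card Q
        = (\<Sum>t<len. card {q \<in> Q. t \<in> arc q} + (if t \<in> pv ` Q then 1 else 0))"
      using s by (simp add: sum.distrib)
    also have "\<dots> \<le> (\<Sum>t<len. 2)"
    proof (rule sum_mono)
      fix t assume "t \<in> {..<len}"
      then have t: "t < len" by simp
      show "card {q \<in> Q. t \<in> arc q} + (if t \<in> pv ` Q then 1 else 0) \<le> 2"
      proof (cases "t \<in> pv ` Q")
        case True
        then obtain q where "q \<in> Q" "t = pv q" by blast
        then have "{q \<in> Q. t \<in> arc q} \<subseteq> {q}" using pv[of q] by blast
        then have "card {q \<in> Q. t \<in> arc q} \<le> card {q}" by (intro card_mono) auto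
        then show ?thesis by simp
      next
        case False
        then show ?thesis using two[OF t] by simp
      qed
    qed
    finally show ?thesis by simp
  qed
  have inner_card: "Suc (card (inner q)) = edges q" if q: "q \<in> Q" for q
  proof -
    obtain i j xs fs where qq: "q = (i, j, xs, fs)" by (cases q) auto
    have e: "i < j" "j < len" "is_path (E - set es) xs fs" "set xs \<inter> set us = {us ! i, us ! j}"
      using ears[OF q] by (auto simp: qq is_ear_def ear_def)
    have "us ! i \<noteq> us ! j" using us_inj e(1,2) by simp
    then have "card (set xs \<inter> set us) = 2" using e(4) by simp
    moreover have "card (set xs) = card (set xs \<inter> set us) + card (set xs - set us)"
      by (rule card_Int_Diff) simp
    ultimately show ?thesis using path_card(2)[OF e(3)] by (simp add: qq inner_def edges_def)
  qed
  have "(\<Sum>q\<in>Q. card (inner q)) = card (\<Union>q\<in>Q. inner q)"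
    using disj fQ by (intro card_UN_disjoint[symmetric]) (auto simp: inner_def)
  also have "\<dots> \<le> card (V - set us)"
  proof (rule card_mono)
    show "(\<Union>q\<in>Q. inner q) \<subseteq> V - set us"
    proof
      fix v assume "v \<in> (\<Union>q\<in>Q. inner q)"
      then obtain q where q: "q \<in> Q" "v \<in> inner q" by blast
      obtain i j xs fs where qq: "q = (i, j, xs, fs)" by (cases q) auto
      have "is_path (E - set es) xs fs" "hd xs = us ! i" "i < len"
        using ears[OF q(1)] by (auto simp: qq is_ear_def ear_def)
      then have "set xs \<subseteq> V" using us_V by (intro path_in_V) auto
      then show "v \<in> V - set us" using q(2) by (auto simp: qq inner_def)
    qed
  qed simp
  also have "\<dots> = n - len" using us_V card_us by (simp add: card_Diff_subset)
  finally have inn: "(\<Sum>q\<in>Q. card (inner q)) \<le> n - len" .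
  have ln: "len \<le> n" using card_mono[OF finite_verts us_V] card_us by simp
  have "(\<Sum>q\<in>Q. edges q) = (\<Sum>q\<in>Q. card (inner q)) + card Q"
  proof -
    have "(\<Sum>q\<in>Q. edges q) = (\<Sum>q\<in>Q. card (inner q) + 1)"
      using inner_card by (intro sum.cong) auto
    then show ?thesis unfolding sum.distrib by simp
  qed
  then have total: "(\<Sum>q\<in>Q. edges q + card (arc q)) \<le> n + len"
    using arcs inn ln by (simp add: sum.distrib)
  have "coverable (\<Union>q\<in>Q. (!) es ` arc q) (\<Sum>q\<in>Q. edges q + card (arc q))"
  proof (rule coverable_UN[OF fQ])
    fix q assume q: "q \<in> Q"
    obtain i j xs fs where qq: "q = (i, j, xs, fs)" by (cases q) auto
    then show "coverable ((!) es ` arc q) (edges q + card (arc q))"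
      using coverable_ear[of i j xs fs] ears[OF q] by (simp add: is_ear_def arc_def edges_def)
  qed
  moreover have "set es \<subseteq> (\<Union>q\<in>Q. (!) es ` arc q)"
    using image_mono[OF cov, of "(!) es"] unfolding es_image_all image_UN .
  ultimately show ?thesis using total by (rule coverable_mono)
qed

lemma coverable_U: "\<exists>m. coverable (set es) m \<and> 3 * m \<le> 4 * n + 3 * len"
proof (cases "\<exists>w i j k. w \<notin> set us \<and> att (comp off_edges w) i \<and> att (comp off_edges w) j \<and>
    att (comp off_edges w) k \<and> i < j \<and> j < k \<and> eps (spoke i) \<noteq> eps (spoke j) \<and> eps (spoke j) \<noteq> eps (spoke k)")
  case True
  then show ?thesis using coverable_claw by blast
next
  case False
  then have "coverable (set es) (n + len)" by (intro coverable_no_claw) blast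
  then show ?thesis by (intro exI[of _ "n + len"]) simp
qed

end

section \<open>Components and flows\<close>

context admissible_cubic
begin

text \<open>If no unbalanced circuit is disjoint from this one, then everything away from it is
  balanced and can be switched positive. A second switching, on the vertices of S only, normalises B
  and leaves the edges away from S alone.\<close>

lemma coverable_odd_circuit:
  assumes r: "ring S B" "prod \<sigma> B = -1"
  shows "\<exists>k. coverable B k \<and> 3 * k \<le> 4 * n + 3 * card B"
proof (cases "\<exists>S' B'. ring S' B' \<and> prod \<sigma> B' = -1 \<and> S \<inter> S' = {}")
  case True
  then show ?thesis using coverable_disjoint_unbalanced[OF r] by blast
next
  case False
  define A where "A = {e \<in> E. ends e \<inter> S = {}}"
  have A: "A \<subseteq> E" by (auto simp: A_def)
  have bal: "prod \<sigma> B' = 1" if B': "ring S' B'" "B' \<subseteq> A" for S' B'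
  proof -
    have "v \<notin> S" if v: "v \<in> S'" for v
    proof -
      have "deg B' v \<noteq> 0" using ringD(7)[OF B'(1) v] by simp
      then have "{e \<in> B'. v \<in> ends e} \<noteq> {}" unfolding deg_def by (metis card.empty)
      then show ?thesis using B'(2) by (auto simp: A_def)
    qed
    then have "prod \<sigma> B' \<noteq> -1" using False B'(1) by blast
    then show ?thesis using prod_sig_cases[OF ringD(3)[OF B'(1)]] by blast
  qed
  obtain s where s: "\<And>v. s v \<in> {1, -1}" "\<And>e. e \<in> A \<Longrightarrow> switched s e = 1"
  proof -
    assume *: "\<And>s. \<lbrakk>\<And>v. s v \<in> {1, -1}; \<And>e. e \<in> A \<Longrightarrow> switched s e = 1\<rbrakk> \<Longrightarrow> thesis"
    show thesis by (rule balanced_switching[OF A]) (erule (1) bal, rule *)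
  qed
  obtain us es where us: "cyc us es" "set us = S" "set es = B" by (rule cyc_exists[OF r(1)])
  obtain s' where s': "\<And>v. s' v \<in> {1, -1}" "\<And>v. v \<notin> set us \<Longrightarrow> s' v = s v"
    "\<And>j. j < length us \<Longrightarrow> switched s' (es ! j) = (if Suc j = length us then -1 else 1)"
  proof -
    assume *: "\<And>s'. \<lbrakk>\<And>v. s' v \<in> {1, -1}; \<And>v. v \<notin> set us \<Longrightarrow> s' v = s v;
      \<And>j. j < length us \<Longrightarrow> switched s' (es ! j) = (if Suc j = length us then -1 else 1)\<rbrakk> \<Longrightarrow> thesis"
    have "prod \<sigma> (set es) = -1" using r(2) us(3) by simp
    then show thesis by (rule cyc_switching[OF us(1), of s]) (rule s(1), rule *)
  qed
  interpret odd_circuit G \<sigma> us es s'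
  proof
    fix e assume e: "e \<in> E" "ends e \<inter> set us = {}"
    then have "switched s' e = switched s e"
      using s'(2) by (simp add: switched_def ends_def)
    then show "switched s' e = 1" using s(2) e us(2) by (simp add: A_def)
  qed (use us(1) s' in auto)
  show ?thesis using coverable_U us ring_card[OF r(1)] card_us by simp
qed

lemma short_cover: "tricoloring c \<Longrightarrow> short_cover"
  using short_cover_from_odd_circuit_cover coverable_odd_circuit by blast

end

section \<open>Degrees and sums over half-edges\<close>

context loopless_graph
begin

lemma degree_deg: "degree G v = deg E v"
proof -
  have "half_edges (sub V E) v = half_edges G v" by (simp add: half_edges_def)
  then show ?thesis using degree_sub[OF order_refl, of V v] by (simp add: degree_def)
qed

text \<open>Turns conservation at a vertex into a sum over all edges, so that it can be exchanged
  with a sum over vertices.\<close>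

lemma sum_half_edges:
  fixes \<phi> :: "'e \<times> bool \<Rightarrow> int"
  shows "(\<Sum>h\<in>half_edges G v. \<phi> h) =
    (\<Sum>e\<in>E. (if tail G e = v then \<phi> (e, False) else 0) + (if head G e = v then \<phi> (e, True) else 0))"
proof -
  let ?T = "{e \<in> E. tail G e = v}" and ?H = "{e \<in> E. head G e = v}"
  have "half_edges G v = (\<lambda>e. (e, False)) ` ?T \<union> (\<lambda>e. (e, True)) ` ?H"
    by (auto simp: half_edges_def image_iff split: if_splits)
  then have "(\<Sum>h\<in>half_edges G v. \<phi> h) = (\<Sum>h\<in>(\<lambda>e. (e, False)) ` ?T. \<phi> h) + (\<Sum>h\<in>(\<lambda>e. (e, True)) ` ?H. \<phi> h)"
    by (simp only:) (intro sum.union_disjoint, auto)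
  also have "\<dots> = (\<Sum>e\<in>?T. \<phi> (e, False)) + (\<Sum>e\<in>?H. \<phi> (e, True))"
    by (simp add: sum.reindex inj_on_def)
  also have "\<dots> = (\<Sum>e\<in>E. if tail G e = v then \<phi> (e, False) else 0) +
      (\<Sum>e\<in>E. if head G e = v then \<phi> (e, True) else 0)"
    by (simp add: sum.inter_filter)
  finally show ?thesis by (simp add: sum.distrib)
qed

end

section \<open>Flow conservation and the passage to components\<close>

context signed_loopless
begin

text \<open>
  Add up the conservation laws on a component, with the signs of a switching: every positive edge
  cancels, and a single negative edge contributes twice its flow.
\<close>

lemma flow_no_single_negative:
  assumes fl: "integer_flow G \<sigma> \<tau> f" and S: "S \<in> comps E"
    and s: "\<And>v. s v \<in> {1, -1}" and e0: "e\<^sub>0 \<in> inside E S"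
    and sw: "\<And>e. e \<in> inside E S \<Longrightarrow> switched s e = (if e = e\<^sub>0 then -1 else 1)"
  shows "f e\<^sub>0 = 0"
proof -
  have fS: "finite S" "S \<subseteq> V"
    using comps_subset[OF order_refl S] finite_subset[of S V] by auto
  have bi: "bidirection G \<sigma> \<tau>" and cons: "\<And>v. v \<in> V \<Longrightarrow> (\<Sum>h \<in> half_edges G v. \<tau> h * f (fst h)) = 0"
    using fl by (auto simp: integer_flow_def)
  define a where "a e = (if tail G e \<in> S then s (tail G e) * (\<tau> (e, False) * f e) else 0)" for e
  define b where "b e = (if head G e \<in> S then s (head G e) * (\<tau> (e, True) * f e) else 0)" for e
  have "0 = (\<Sum>v\<in>S. s v * (\<Sum>h \<in> half_edges G v. \<tau> h * f (fst h)))"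
    using cons fS(2) by (intro sum.neutral[symmetric]) auto
  also have "\<dots> = (\<Sum>v\<in>S. \<Sum>e\<in>E. (if tail G e = v then s v * (\<tau> (e, False) * f e) else 0) +
      (if head G e = v then s v * (\<tau> (e, True) * f e) else 0))"
    unfolding sum_half_edges sum_distrib_left by (intro sum.cong) (auto simp: distrib_left)
  also have "\<dots> = (\<Sum>e\<in>E. \<Sum>v\<in>S. (if tail G e = v then s v * (\<tau> (e, False) * f e) else 0) +
      (if head G e = v then s v * (\<tau> (e, True) * f e) else 0))"
    by (rule sum.swap)
  also have "\<dots> = (\<Sum>e\<in>E. a e + b e)"
    using fS(1) by (simp add: a_def b_def sum.distrib)
  also have "\<dots> = (\<Sum>e\<in>{e\<^sub>0}. a e + b e)"
  proof (rule sum.mono_neutral_right)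
    show "{e\<^sub>0} \<subseteq> E" using e0 by (simp add: inside_def)
    show "\<forall>e\<in>E - {e\<^sub>0}. a e + b e = 0"
    proof
      fix e assume e: "e \<in> E - {e\<^sub>0}"
      show "a e + b e = 0"
      proof (cases "ends e \<inter> S = {}")
        case True
        then show ?thesis by (simp add: a_def b_def ends_def)
      next
        case False
        then have sub: "ends e \<subseteq> S" using comps_edge[OF S] e by blast
        then have "s (tail G e) * s (head G e) * \<sigma> e = 1"
          using sw[of e] e by (simp add: inside_def switched_def)
        moreover have "\<tau> (e, False) \<in> {1, -1}" "\<tau> (e, True) \<in> {1, -1}"
          "\<tau> (e, False) * \<tau> (e, True) = - \<sigma> e" using bi e by (auto simp: bidirection_def)
        \<comment> \<open>The product of the two terms is minus the switched sign of e, so they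
          cancel on a positive edge and agree on a negative one.\<close>
        ultimately have "s (tail G e) * \<tau> (e, False) + s (head G e) * \<tau> (e, True) = 0"
          using s[of "tail G e"] s[of "head G e"] by auto
        then have "(s (tail G e) * \<tau> (e, False) + s (head G e) * \<tau> (e, True)) * f e = 0" by simp
        then show ?thesis using sub by (simp add: a_def b_def ends_def algebra_simps)
      qed
    qed
  qed simp
  finally have z: "a e\<^sub>0 + b e\<^sub>0 = 0" by simp
  have "s (tail G e\<^sub>0) * s (head G e\<^sub>0) * \<sigma> e\<^sub>0 = -1"
    using sw[OF e0] by (simp add: switched_def)
  moreover have "\<tau> (e\<^sub>0, False) \<in> {1, -1}" "\<tau> (e\<^sub>0, True) \<in> {1, -1}"
    "\<tau> (e\<^sub>0, False) * \<tau> (e\<^sub>0, True) = - \<sigma> e\<^sub>0" using bi e0 by (auto simp: bidirection_def inside_def)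
  ultimately have "s (tail G e\<^sub>0) * \<tau> (e\<^sub>0, False) + s (head G e\<^sub>0) * \<tau> (e\<^sub>0, True) \<in> {2, -2}"
    using s[of "tail G e\<^sub>0"] s[of "head G e\<^sub>0"] by auto
  moreover have "(s (tail G e\<^sub>0) * \<tau> (e\<^sub>0, False) + s (head G e\<^sub>0) * \<tau> (e\<^sub>0, True)) * f e\<^sub>0 = 0"
    using z e0 by (simp add: a_def b_def inside_def ends_def algebra_simps)
  ultimately show ?thesis by auto
qed

text \<open>The connected case is applied to the component as a graph of its own. Degrees, adjacency
  and switchings refer only to tail and head, hence mean the same there, and its sign-circuits are
  sign-circuits of G.\<close>

lemma coverable_component:
  assumes deg3: "\<And>v. v \<in> V \<Longrightarrow> deg E v = 3"
    and col: "\<And>e. e \<in> E \<Longrightarrow> c e < (3::nat)"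
    and one: "\<And>v i. v \<in> V \<Longrightarrow> i < 3 \<Longrightarrow> card {e \<in> E. v \<in> ends e \<and> c e = i} = 1"
    and fl: "integer_flow G \<sigma> \<tau> f" "\<And>e. e \<in> E \<Longrightarrow> f e \<noteq> 0"
    and S: "S \<in> comps E"
  shows "\<exists>k. coverable (inside E S) k \<and> 3 * k \<le> 10 * card S"
proof -
  let ?H = "sub S (inside E S)"
  have SV: "S \<subseteq> V" using comps_subset[OF order_refl S] .
  have fH: "fin_digraph ?H"
    using SV finite_subset[OF SV] finite_subset[OF inside_subset[of E S]] inside_ends[of _ E S]
    by unfold_locales (auto simp: ends_def)
  interpret H: signed_loopless ?H \<sigma>
  proof (intro signed_loopless.intro loopless_graph.intro fH)
    show "loopless_graph_axioms ?H" using no_loop by unfold_locales (auto simp: inside_def)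
    show "signed_loopless_axioms ?H \<sigma>" using sig by unfold_locales (auto simp: inside_def)
  qed
  have ends_H: "H.ends = ends" by (simp add: fun_eq_iff H.ends_def ends_def)
  have adj_H: "H.adj = adj" by (simp add: fun_eq_iff H.adj_def adj_def ends_H)
  have deg_H: "H.deg = deg" by (simp add: fun_eq_iff H.deg_def deg_def ends_H)
  have sw_H: "H.switched = switched" by (simp add: fun_eq_iff H.switched_def switched_def)
  interpret H: admissible_cubic ?H \<sigma>
  proof
    fix v assume "v \<in> verts ?H"
    then have v: "v \<in> S" by simp
    then show "H.deg (arcs ?H) v = 3"
      using deg_inside[OF S v] deg3[of v] SV by (auto simp: deg_H deg_def)
  next
    fix x y assume "x \<in> verts ?H" "y \<in> verts ?H"
    then show "(x, y) \<in> (H.adj (arcs ?H))\<^sup>*" using comps_connected[OF S] by (simp add: adj_H)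
  next
    show "verts ?H \<noteq> {}" using comps_nonempty[OF S] by simp
  next
    fix s :: "'v \<Rightarrow> int" and e0
    assume s: "\<And>v. s v \<in> {1, -1}" and e0: "e0 \<in> arcs ?H"
    show "\<exists>e\<in>arcs ?H. H.switched s e \<noteq> (if e = e0 then -1 else 1)"
    proof (rule ccontr)
      assume "\<not> ?thesis"
      then have "f e0 = 0"
        using e0 by (intro flow_no_single_negative[OF fl(1) S s]) (auto simp: sw_H)
      then show False using fl(2)[of e0] e0 by (simp add: inside_def)
    qed
  qed
  have "H.tricoloring c"
    unfolding H.tricoloring_def
  proof (intro conjI ballI allI impI)
    fix e assume "e \<in> arcs ?H"
    then show "c e < 3" using col by (simp add: inside_def)
  next
    fix v i assume "v \<in> verts ?H" and i: "i < (3::nat)"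
    then have v: "v \<in> S" by simp
    have "{e \<in> inside E S. v \<in> ends e \<and> c e = i} = {e \<in> E. v \<in> ends e \<and> c e = i}"
      using deg_inside[OF S v] by blast
    then show "card {e \<in> arcs ?H. v \<in> H.ends e \<and> c e = i} = 1"
      using one[of v i] v SV i by (auto simp: ends_H)
  qed
  then obtain k where k: "H.coverable (inside E S) k" "3 * k \<le> 10 * card S"
    using H.short_cover unfolding H.short_cover_def by auto
  have HG: "subgraph ?H G"
    using SV inside_subset inside_ends by (intro subgraph_sub_G) auto
  have "sign_circuit G \<sigma> C" if "sign_circuit ?H \<sigma> C" for C
    using that subgraph_trans[OF _ HG] by (auto simp: sign_circuit_def)
  then have "coverable (inside E S) k"
    using k(1) unfolding coverable_def H.coverable_def by blast
  then show ?thesis using k(2) by blast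
qed

end

theorem theorem1p4:
  fixes G :: "('v, 'e) pre_digraph" and \<sigma> :: "'e \<Rightarrow> int"
  assumes "signed_graph G \<sigma>"
    and "flow_admissible G \<sigma>"
    and "cubic G"
    and "edge_colorable 3 G"
  shows "\<exists>F. sign_circuit_cover G \<sigma> F \<and>
           real (cover_length F) \<le> 20 / 9 * real (card (arcs G))"
proof -
  interpret signed_graph G \<sigma> by fact
  obtain c where c: "\<And>e. e \<in> arcs G \<Longrightarrow> c e < (3::nat)" "proper_edge_coloring G c"
    using assms(4) by (auto simp: edge_colorable_def)
  have proper: "c e \<noteq> c e'"
    if "v \<in> verts G" "(e, b) \<in> half_edges G v" "(e', b') \<in> half_edges G v" "(e, b) \<noteq> (e', b')" for v e e' b b'
    using c(2) that unfolding proper_edge_coloring_def by fastforce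
  interpret signed_loopless G \<sigma>
  proof
    fix e assume e: "e \<in> arcs G"
    \<comment> \<open>A loop has two half-edges at one vertex, and the colouring would have to give
      them different colours.\<close>
    show "tail G e \<noteq> head G e"
      using proper[of "tail G e" e False e True] e by (auto simp: half_edges_def)
  qed (rule signature)
  have deg3: "deg E v = 3" if "v \<in> V" for v
    using assms(3) that degree_deg by (auto simp: regular_def)
  have one: "card {e \<in> E. v \<in> ends e \<and> c e = i} = 1" if v: "v \<in> V" and i: "i < 3" for v i
  proof -
    let ?D = "{e \<in> E. v \<in> ends e}"
    have inj: "inj_on c ?D"
    proof (rule inj_onI)
      fix e e' assume e: "e \<in> ?D" "e' \<in> ?D" "c e = c e'"
      have "\<exists>b. (e, b) \<in> half_edges G v" if "e \<in> ?D" for e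
        using that by (auto simp: half_edges_def ends_def)
      then obtain b b' where "(e, b) \<in> half_edges G v" "(e', b') \<in> half_edges G v" using e by blast
      then show "e = e'" using proper[OF v] e(3) by blast
    qed
    \<comment> \<open>Three edges at v with distinct colours below 3 use every colour.\<close>
    have "c ` ?D = {..<3}"
    proof (rule card_subset_eq)
      show "card (c ` ?D) = card {..<3::nat}"
        using card_image[OF inj] deg3[OF v] by (simp add: deg_def)
    qed (use c(1) in auto)
    then have "i \<in> c ` ?D" using i by simp
    then obtain e where e: "e \<in> ?D" "c e = i" by blast
    have "e' = e" if "e' \<in> E" "v \<in> ends e'" "c e' = i" for e'
      using inj_onD[OF inj, of e' e] that e by simp
    then have "{e \<in> E. v \<in> ends e \<and> c e = i} = {e}" using e by blast
    then show ?thesis by simp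
  qed
  obtain \<tau> f where fl: "integer_flow G \<sigma> \<tau> f" "\<And>e. e \<in> E \<Longrightarrow> f e \<noteq> 0"
    using assms(2) by (auto simp: flow_admissible_def)
  obtain k where k: "\<And>S. S \<in> comps E \<Longrightarrow> coverable (inside E S) (k S)"
    "\<And>S. S \<in> comps E \<Longrightarrow> 3 * k S \<le> 10 * card S"
    using coverable_component[OF deg3 c(1) one fl] by metis
  define m where "m = (\<Sum>S\<in>comps E. k S)"
  have "coverable E m"
    using coverable_UN[OF finite_comps, of E "inside E" k] k(1) UN_inside[OF order_refl]
    by (simp add: m_def)
  then obtain F where F: "\<forall>C \<in># F. sign_circuit G \<sigma> C" "\<forall>e \<in> E. \<exists>C \<in># F. e \<in> arcs C"
    "cover_length F \<le> m" by (auto simp: coverable_def)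
  have "card (\<Union>(comps E)) = (\<Sum>S\<in>comps E. card S)"
  proof (rule card_Union_disjoint)
    show "pairwise disjnt (comps E)"
      using comps_disjoint by (auto simp: pairwise_def disjnt_def)
    show "\<And>S. S \<in> comps E \<Longrightarrow> finite S"
      using comps_subset[OF order_refl] finite_subset by fastforce
  qed
  moreover have "\<Union>(comps E) \<subseteq> V" using comps_subset[OF order_refl] by blast
  then have "card (\<Union>(comps E)) \<le> card V" by (intro card_mono) auto
  ultimately have "3 * m \<le> 10 * card V"
    using sum_mono[of "comps E" "\<lambda>S. 3 * k S" "\<lambda>S. 10 * card S"] k(2)
    by (simp add: m_def sum_distrib_left[symmetric])
  \<comment> \<open>Turns the bound 10n/3 into 20/9 of the number of edges.\<close>
  moreover have "2 * card E = 3 * card V"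
    using sum_deg[of E V] deg3 ends_in_V by simp
  ultimately have "9 * cover_length F \<le> 20 * card E" using F(3) by linarith
  then have "real (9 * cover_length F) \<le> real (20 * card E)" by (simp only: of_nat_le_iff)
  then have "real (cover_length F) \<le> 20 / 9 * real (card E)" by simp
  then show ?thesis using F by (auto simp: sign_circuit_cover_def)
qed

end
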